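(* Let $\phi:G\to H$ be a homomorphism between two Riemannian Lie groups which is a Riemannian submersion, and let $\xi:\mathfrak g\to\mathfrak h$ be its differential at the identity. Let $\tau(\xi)=\tau(\phi)(e)\in\mathfrak h$ and let $\tau(\xi)^\ell$ be the corresponding left invariant vector field on $H$. Let $\mathrm r:\mathfrak h\to(\ker\xi)^\perp$ be the inverse of $\xi|_{(\ker\xi)^\perp}$ and $\omega(h_1,h_2)=[\mathrm r(h_1),\mathrm r(h_2)]^{\mathfrak g}-\mathrm r([h_1,h_2]^{\mathfrak h})\in\ker\xi$ for $h_1,h_2\in\mathfrak h$. Then: (i) When $\mathfrak h$ is unimodular, $\phi$ is biharmonic if and only if $\tau(\xi)^\ell$ is a Killing vector field. (ii) When $\ker\xi$ is unimodular or $\omega=0$, $\phi$ is biharmonic if and only if $\tau(\xi)^\ell$ is a parallel vector field.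
   Context: All Lie groups are real and connected. A Riemannian Lie group is a Lie group with a left invariant Riemannian metric; its Lie algebra carries the induced inner product. A Lie algebra is unimodular if $\mathrm{tr}(\mathrm{ad}_u)=0$ for all its elements $u$. For a smooth map $\phi:(M,g)\to(N,h)$ of Riemannian manifolds and a local orthonormal frame $(E_i)$ of $TM$, the tension field is $\tau(\phi)=\sum_i(\nabla_{E_i}d\phi)(E_i)$, a section of $\phi^*TN$, and the bitension field is $\tau_2(\phi)=-\sum_i\big((\nabla^\phi)^2_{E_i,E_i}\tau(\phi)+R^N(\tau(\phi),d\phi(E_i))d\phi(E_i)\big)$, where $\nabla^\phi$ is the pull-back of the Levi-Civita connection of $N$, $(\nabla^\phi)^2_{X,Y}=\nabla^\phi_X\nabla^\phi_Y-\nabla^\phi_{\nabla^M_XY}$ and $R^N(X,Y)=\nabla_X\nabla_Y-\nabla_Y\nabla_X-\nabla_{[X,Y]}$. The map $\phi$ is biharmonic if $\tau_2(\phi)=0$. *)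

theory Defs
  imports "HOL-Analysis.Analysis" "HOL-Algebra.Group" "HOL-Library.Function_Algebras"
begin

section \<open>Function spaces as real vector spaces\<close>

text \<open>\<open>Function_Algebras\<close> provides the pointwise ring operations on functions. With pointwise
  scalars, tangent spaces become subspaces of a \<open>real_vector\<close> type, so that \<open>subspace\<close>, \<open>span\<close>,
  \<open>independent\<close> and \<open>representation\<close> apply to them.\<close>

instantiation "fun" :: (type, real_vector) real_vector
begin

definition scaleR_fun :: "real \<Rightarrow> ('a \<Rightarrow> 'b) \<Rightarrow> 'a \<Rightarrow> 'b"
  where "scaleR_fun r f = (\<lambda>x. r *\<^sub>R f x)"

instance
  by standard
    (simp_all add: scaleR_fun_def fun_eq_iff scaleR_add_right scaleR_add_left)

end


section \<open>Smooth manifolds\<close>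

primrec Ck_on :: "nat \<Rightarrow> 'e::real_normed_vector set \<Rightarrow> ('e \<Rightarrow> 'f::real_normed_vector) \<Rightarrow> bool" where
  "Ck_on 0 U f \<longleftrightarrow> continuous_on U f"
| "Ck_on (Suc k) U f \<longleftrightarrow> (\<forall>x\<in>U. f differentiable (at x)) \<and>
     (\<forall>v. Ck_on k U (\<lambda>x. frechet_derivative f (at x) v))"

text \<open>Smoothness on an arbitrary set means local extendability to smooth functions on open sets. The
  sets that occur below are relatively open in a linear subspace, where this is the usual notion.\<close>

definition smooth_on :: "'e::real_normed_vector set \<Rightarrow> ('e \<Rightarrow> 'f::real_normed_vector) \<Rightarrow> bool" where
  "smooth_on S f \<longleftrightarrow> (\<forall>x\<in>S. \<exists>U F. open U \<and> x \<in> U \<and> (\<forall>k. Ck_on k U F) \<and> (\<forall>y\<in>S \<inter> U. F y = f y))"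

text \<open>An atlas is a set of charts \<open>(U, c)\<close>. Only the values of \<open>c\<close> on \<open>U\<close> matter.\<close>

type_synonym ('a, 'e) atlas = "('a set \<times> ('a \<Rightarrow> 'e)) set"

text \<open>The charts take values in a fixed linear subspace \<open>V\<close> of a Euclidean space, which plays the
  role of \<open>\<real>\<^sup>n\<close>; as \<open>DIM('e)\<close> is positive, taking all of \<open>'e\<close> would exclude dimension 0.\<close>

definition smooth_manifold ::
  "('a::{t2_space, second_countable_topology}, 'e::euclidean_space) atlas \<Rightarrow> bool" where
  "smooth_manifold A \<longleftrightarrow>
     (\<exists>V. subspace V \<and>
        (\<forall>(U, c)\<in>A. open U \<and> openin (top_of_set V) (c ` U) \<and>
                    homeomorphism U (c ` U) c (inv_into U c))) \<and>
     \<Union> (fst ` A) = UNIV \<and>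
     (\<forall>(U, c)\<in>A. \<forall>(U', c')\<in>A. smooth_on (c ` (U \<inter> U')) (c' \<circ> inv_into U c))"

definition smooth_map ::
  "('a::topological_space, 'e::real_normed_vector) atlas
    \<Rightarrow> ('b::topological_space, 'f::real_normed_vector) atlas \<Rightarrow> ('a \<Rightarrow> 'b) \<Rightarrow> bool" where
  "smooth_map A B \<phi> \<longleftrightarrow> continuous_on UNIV \<phi> \<and>
     (\<forall>(U, c)\<in>A. \<forall>(W, d)\<in>B. smooth_on (c ` (U \<inter> \<phi> -` W)) (d \<circ> \<phi> \<circ> inv_into U c))"

definition smooth_fun ::
  "('a::topological_space, 'e::real_normed_vector) atlas \<Rightarrow> ('a \<Rightarrow> real) \<Rightarrow> bool" where
  "smooth_fun A f \<longleftrightarrow> smooth_map A {(UNIV, \<lambda>x. x)} f"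

definition prod_atlas :: "('a, 'e) atlas \<Rightarrow> ('b, 'f) atlas \<Rightarrow> ('a \<times> 'b, 'e \<times> 'f) atlas" where
  "prod_atlas A B = {(U \<times> W, map_prod c d) | U c W d. (U, c) \<in> A \<and> (W, d) \<in> B}"


section \<open>Tangent vectors and vector fields\<close>

text \<open>Tangent vectors are point derivations of the algebra of smooth functions. They are set to 0 on
  non-smooth functions, so that a tangent vector is determined by the derivation.\<close>

type_synonym 'a tangent = "('a \<Rightarrow> real) \<Rightarrow> real"

definition tangent_space ::
  "('a::topological_space, 'e::real_normed_vector) atlas \<Rightarrow> 'a \<Rightarrow> 'a tangent set" where
  "tangent_space A p = {v.
     (\<forall>f. \<not> smooth_fun A f \<longrightarrow> v f = 0) \<and>
     (\<forall>f k. smooth_fun A f \<longrightarrow> smooth_fun A k \<longrightarrow> v (\<lambda>x. f x + k x) = v f + v k) \<and>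
     (\<forall>r f. smooth_fun A f \<longrightarrow> v (\<lambda>x. r * f x) = r * v f) \<and>
     (\<forall>f k. smooth_fun A f \<longrightarrow> smooth_fun A k \<longrightarrow> v (\<lambda>x. f x * k x) = f p * v k + k p * v f)}"

text \<open>For smooth \<open>\<phi>\<close> into the manifold with atlas \<open>B\<close>, \<open>differential B \<phi>\<close> maps the tangent space at
  \<open>p\<close> to the one at \<open>\<phi> p\<close>; the base point is implicit in the tangent vector.\<close>

definition differential ::
  "('b::topological_space, 'f::real_normed_vector) atlas \<Rightarrow> ('a \<Rightarrow> 'b) \<Rightarrow> 'a tangent \<Rightarrow> 'b tangent" where
  "differential B \<phi> v = (\<lambda>f. if smooth_fun B f then v (f \<circ> \<phi>) else 0)"

text \<open>Smooth sections of the pull-back bundle \<open>\<phi>\<^sup>*TN\<close>.\<close>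

definition section_along ::
  "('a::topological_space, 'e::real_normed_vector) atlas
    \<Rightarrow> ('b::topological_space, 'f::real_normed_vector) atlas
    \<Rightarrow> ('a \<Rightarrow> 'b) \<Rightarrow> ('a \<Rightarrow> 'b tangent) \<Rightarrow> bool" where
  "section_along A B \<phi> V \<longleftrightarrow> (\<forall>p. V p \<in> tangent_space B (\<phi> p)) \<and>
     (\<forall>f. smooth_fun B f \<longrightarrow> smooth_fun A (\<lambda>p. V p f))"

definition vector_field ::
  "('a::topological_space, 'e::real_normed_vector) atlas \<Rightarrow> ('a \<Rightarrow> 'a tangent) \<Rightarrow> bool" where
  "vector_field A X \<longleftrightarrow> section_along A A (\<lambda>p. p) X"

definition lie_bracket ::
  "('a \<Rightarrow> 'a tangent) \<Rightarrow> ('a \<Rightarrow> 'a tangent) \<Rightarrow> 'a \<Rightarrow> 'a tangent" where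
  "lie_bracket X Y p = (\<lambda>f. X p (\<lambda>q. Y q f) - Y p (\<lambda>q. X q f))"


section \<open>Riemannian metrics and connections\<close>

type_synonym 'a metric = "'a \<Rightarrow> 'a tangent \<Rightarrow> 'a tangent \<Rightarrow> real"

definition riemannian_metric ::
  "('a::topological_space, 'e::real_normed_vector) atlas \<Rightarrow> 'a metric \<Rightarrow> bool" where
  "riemannian_metric A g \<longleftrightarrow>
     (\<forall>p. \<forall>u\<in>tangent_space A p. \<forall>v\<in>tangent_space A p.
        g p u v = g p v u \<and> (\<forall>r. g p (r *\<^sub>R u) v = r * g p u v) \<and>
        (\<forall>w\<in>tangent_space A p. g p (u + w) v = g p u v + g p w v) \<and>
        (u \<noteq> 0 \<longrightarrow> g p u u > 0)) \<and>
     (\<forall>X Y. vector_field A X \<longrightarrow> vector_field A Y \<longrightarrow> smooth_fun A (\<lambda>p. g p (X p) (Y p)))"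

text \<open>Connections on the bundle \<open>\<phi>\<^sup>*TN\<close>; the case \<open>\<phi> = id\<close> gives connections on the tangent bundle.
  Only the values on smooth vector fields and smooth sections matter.\<close>

definition connection_along ::
  "('a::topological_space, 'e::real_normed_vector) atlas
    \<Rightarrow> ('b::topological_space, 'f::real_normed_vector) atlas \<Rightarrow> ('a \<Rightarrow> 'b)
    \<Rightarrow> (('a \<Rightarrow> 'a tangent) \<Rightarrow> ('a \<Rightarrow> 'b tangent) \<Rightarrow> 'a \<Rightarrow> 'b tangent) \<Rightarrow> bool" where
  "connection_along A B \<phi> D \<longleftrightarrow>
     (\<forall>X V. vector_field A X \<longrightarrow> section_along A B \<phi> V \<longrightarrow>
        section_along A B \<phi> (D X V) \<and>
        (\<forall>Y. vector_field A Y \<longrightarrow> D (\<lambda>p. X p + Y p) V = (\<lambda>p. D X V p + D Y V p)) \<and>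
        (\<forall>W. section_along A B \<phi> W \<longrightarrow> D X (\<lambda>p. V p + W p) = (\<lambda>p. D X V p + D X W p)) \<and>
        (\<forall>f. smooth_fun A f \<longrightarrow>
           D (\<lambda>p. f p *\<^sub>R X p) V = (\<lambda>p. f p *\<^sub>R D X V p) \<and>
           D X (\<lambda>p. f p *\<^sub>R V p) = (\<lambda>p. X p f *\<^sub>R V p + f p *\<^sub>R D X V p)))"

definition is_levi_civita ::
  "('a::topological_space, 'e::real_normed_vector) atlas \<Rightarrow> 'a metric
    \<Rightarrow> (('a \<Rightarrow> 'a tangent) \<Rightarrow> ('a \<Rightarrow> 'a tangent) \<Rightarrow> 'a \<Rightarrow> 'a tangent) \<Rightarrow> bool" where
  "is_levi_civita A g D \<longleftrightarrow> connection_along A A (\<lambda>p. p) D \<and>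
     (\<forall>X Y. vector_field A X \<longrightarrow> vector_field A Y \<longrightarrow>
        (\<forall>p. D X Y p - D Y X p = lie_bracket X Y p) \<and>
        (\<forall>Z. vector_field A Z \<longrightarrow>
           (\<forall>p. X p (\<lambda>q. g q (Y q) (Z q)) = g p (D X Y p) (Z p) + g p (Y p) (D X Z p))))"

text \<open>The Levi-Civita connection is unique as an operator on smooth vector fields.\<close>

definition levi_civita ::
  "('a::topological_space, 'e::real_normed_vector) atlas \<Rightarrow> 'a metric
    \<Rightarrow> ('a \<Rightarrow> 'a tangent) \<Rightarrow> ('a \<Rightarrow> 'a tangent) \<Rightarrow> 'a \<Rightarrow> 'a tangent" where
  "levi_civita A g = (SOME D. is_levi_civita A g D)"

text \<open>The pull-back \<open>P\<close> of a connection \<open>D\<close> is the connection on \<open>\<phi>\<^sup>*TN\<close> with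
  \<open>P\<^sub>X (Y \<circ> \<phi>) = D\<^bsub>d\<phi>(X)\<^esub> Y\<close> for vector fields \<open>Y\<close> on \<open>N\<close>; here \<open>d\<phi>(X\<^sub>p)\<close> is extended to a vector
  field \<open>Z\<close> on \<open>N\<close>, and the value at \<open>\<phi> p\<close> does not depend on the extension.\<close>

definition is_pullback_connection ::
  "('a::topological_space, 'e::real_normed_vector) atlas
    \<Rightarrow> ('b::topological_space, 'f::real_normed_vector) atlas \<Rightarrow> ('a \<Rightarrow> 'b)
    \<Rightarrow> (('b \<Rightarrow> 'b tangent) \<Rightarrow> ('b \<Rightarrow> 'b tangent) \<Rightarrow> 'b \<Rightarrow> 'b tangent)
    \<Rightarrow> (('a \<Rightarrow> 'a tangent) \<Rightarrow> ('a \<Rightarrow> 'b tangent) \<Rightarrow> 'a \<Rightarrow> 'b tangent) \<Rightarrow> bool" where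
  "is_pullback_connection A B \<phi> D P \<longleftrightarrow> connection_along A B \<phi> P \<and>
     (\<forall>X Y Z p. vector_field A X \<longrightarrow> vector_field B Y \<longrightarrow> vector_field B Z \<longrightarrow>
        Z (\<phi> p) = differential B \<phi> (X p) \<longrightarrow> P X (\<lambda>q. Y (\<phi> q)) p = D Z Y (\<phi> p))"

definition pullback_connection ::
  "('a::topological_space, 'e::real_normed_vector) atlas
    \<Rightarrow> ('b::topological_space, 'f::real_normed_vector) atlas \<Rightarrow> ('a \<Rightarrow> 'b)
    \<Rightarrow> (('b \<Rightarrow> 'b tangent) \<Rightarrow> ('b \<Rightarrow> 'b tangent) \<Rightarrow> 'b \<Rightarrow> 'b tangent)
    \<Rightarrow> ('a \<Rightarrow> 'a tangent) \<Rightarrow> ('a \<Rightarrow> 'b tangent) \<Rightarrow> 'a \<Rightarrow> 'b tangent" where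
  "pullback_connection A B \<phi> D = (SOME P. is_pullback_connection A B \<phi> D P)"

text \<open>The curvature tensor at a point: the arguments are extended to vector fields, and the result
  does not depend on the extensions.\<close>

definition curvature_at ::
  "('b::topological_space, 'f::real_normed_vector) atlas \<Rightarrow> 'b metric \<Rightarrow> 'b
    \<Rightarrow> 'b tangent \<Rightarrow> 'b tangent \<Rightarrow> 'b tangent \<Rightarrow> 'b tangent" where
  "curvature_at B h q u v w = (let D = levi_civita B h in
     SOME z. \<exists>X Y Z. vector_field B X \<and> vector_field B Y \<and> vector_field B Z \<and>
       X q = u \<and> Y q = v \<and> Z q = w \<and>
       z = D X (D Y Z) q - D Y (D X Z) q - D (lie_bracket X Y) Z q)"

definition killing_field ::
  "('b::topological_space, 'f::real_normed_vector) atlas \<Rightarrow> 'b metric \<Rightarrow> ('b \<Rightarrow> 'b tangent) \<Rightarrow> bool" where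
  "killing_field B h X \<longleftrightarrow> vector_field B X \<and>
     (\<forall>Y Z. vector_field B Y \<longrightarrow> vector_field B Z \<longrightarrow>
        (\<forall>p. X p (\<lambda>q. h q (Y q) (Z q)) =
             h p (lie_bracket X Y p) (Z p) + h p (Y p) (lie_bracket X Z p)))"

definition parallel_field ::
  "('b::topological_space, 'f::real_normed_vector) atlas \<Rightarrow> 'b metric \<Rightarrow> ('b \<Rightarrow> 'b tangent) \<Rightarrow> bool" where
  "parallel_field B h X \<longleftrightarrow> vector_field B X \<and>
     (\<forall>Y. vector_field B Y \<longrightarrow> (\<forall>p. levi_civita B h Y X p = 0))"


section \<open>Tension field and bitension field\<close>

text \<open>Every local orthonormal frame agrees near \<open>p\<close> with globally defined smooth vector fields, so
  local frames are represented by global fields that are orthonormal on a neighbourhood of \<open>p\<close>.\<close>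

definition local_orthonormal_frame ::
  "('a::topological_space, 'e::real_normed_vector) atlas \<Rightarrow> 'a metric \<Rightarrow> 'a
    \<Rightarrow> ('a \<Rightarrow> 'a tangent) list \<Rightarrow> bool" where
  "local_orthonormal_frame A g p Es \<longleftrightarrow> (\<forall>X\<in>set Es. vector_field A X) \<and>
     (\<exists>U. open U \<and> p \<in> U \<and> (\<forall>q\<in>U.
        span ((\<lambda>X. X q) ` set Es) = tangent_space A q \<and>
        (\<forall>i<length Es. \<forall>j<length Es. g q ((Es ! i) q) ((Es ! j) q) = (if i = j then 1 else 0))))"

context
  fixes A :: "('a::topological_space, 'e::real_normed_vector) atlas" and g :: "'a metric"
    and B :: "('b::topological_space, 'f::real_normed_vector) atlas" and h :: "'b metric"
    and \<phi> :: "'a \<Rightarrow> 'b"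
begin

text \<open>\<open>(\<nabla>\<^sub>X d\<phi>)(Y)\<close>\<close>

definition hessian_map ::
  "('a \<Rightarrow> 'a tangent) \<Rightarrow> ('a \<Rightarrow> 'a tangent) \<Rightarrow> 'a \<Rightarrow> 'b tangent" where
  "hessian_map X Y p =
     pullback_connection A B \<phi> (levi_civita B h) X (\<lambda>q. differential B \<phi> (Y q)) p
     - differential B \<phi> (levi_civita A g X Y p)"

definition tension_field :: "'a \<Rightarrow> 'b tangent" where
  "tension_field p = (let Es = SOME Es. local_orthonormal_frame A g p Es in
     \<Sum>X\<leftarrow>Es. hessian_map X X p)"

definition bitension_field :: "'a \<Rightarrow> 'b tangent" where
  "bitension_field p =
     (let Es = SOME Es. local_orthonormal_frame A g p Es;
          P = pullback_connection A B \<phi> (levi_civita B h);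
          \<tau> = tension_field
      in - (\<Sum>X\<leftarrow>Es. (P X (P X \<tau>) p - P (levi_civita A g X X) \<tau> p)
              + curvature_at B h (\<phi> p) (\<tau> p) (differential B \<phi> (X p)) (differential B \<phi> (X p))))"

definition biharmonic :: bool where
  "biharmonic \<longleftrightarrow> (\<forall>p. bitension_field p = 0)"

text \<open>A submersion whose differential is isometric on the orthogonal complement of its kernel.\<close>

definition riemannian_submersion :: bool where
  "riemannian_submersion \<longleftrightarrow> smooth_map A B \<phi> \<and>
     (\<forall>p. differential B \<phi> ` tangent_space A p = tangent_space B (\<phi> p) \<and>
        (let hor = {u \<in> tangent_space A p.
                      \<forall>k\<in>tangent_space A p. differential B \<phi> k = 0 \<longrightarrow> g p u k = 0}
         in \<forall>u\<in>hor. \<forall>v\<in>hor. h (\<phi> p) (differential B \<phi> u) (differential B \<phi> v) = g p u v))"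

end


section \<open>Riemannian Lie groups\<close>

definition connected_lie_group ::
  "('a::{t2_space, second_countable_topology}, 'm) monoid_scheme
    \<Rightarrow> ('a, 'e::euclidean_space) atlas \<Rightarrow> bool" where
  "connected_lie_group G A \<longleftrightarrow> group G \<and> carrier G = UNIV \<and>
     smooth_manifold A \<and> connected (UNIV :: 'a set) \<and>
     smooth_map (prod_atlas A A) A (\<lambda>(x, y). x \<otimes>\<^bsub>G\<^esub> y) \<and>
     smooth_map A A (m_inv G)"

definition left_invariant_field ::
  "('a::topological_space, 'm) monoid_scheme \<Rightarrow> ('a, 'e::real_normed_vector) atlas
    \<Rightarrow> 'a tangent \<Rightarrow> 'a \<Rightarrow> 'a tangent" where
  "left_invariant_field G A u = (\<lambda>a. differential A (\<lambda>x. a \<otimes>\<^bsub>G\<^esub> x) u)"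

definition riemannian_lie_group ::
  "('a::{t2_space, second_countable_topology}, 'm) monoid_scheme
    \<Rightarrow> ('a, 'e::euclidean_space) atlas \<Rightarrow> 'a metric \<Rightarrow> bool" where
  "riemannian_lie_group G A g \<longleftrightarrow> connected_lie_group G A \<and> riemannian_metric A g \<and>
     (\<forall>a p. \<forall>u\<in>tangent_space A p. \<forall>v\<in>tangent_space A p.
        g (a \<otimes>\<^bsub>G\<^esub> p) (differential A (\<lambda>x. a \<otimes>\<^bsub>G\<^esub> x) u) (differential A (\<lambda>x. a \<otimes>\<^bsub>G\<^esub> x) v) = g p u v)"

text \<open>The Lie algebra is the tangent space at the identity, with the bracket of left invariant
  vector fields.\<close>

abbreviation lie_algebra ::
  "('a::topological_space, 'm) monoid_scheme \<Rightarrow> ('a, 'e::real_normed_vector) atlas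
    \<Rightarrow> 'a tangent set" where
  "lie_algebra G A \<equiv> tangent_space A \<one>\<^bsub>G\<^esub>"

definition lie_alg_bracket ::
  "('a::topological_space, 'm) monoid_scheme \<Rightarrow> ('a, 'e::real_normed_vector) atlas
    \<Rightarrow> 'a tangent \<Rightarrow> 'a tangent \<Rightarrow> 'a tangent" where
  "lie_alg_bracket G A u v =
     lie_bracket (left_invariant_field G A u) (left_invariant_field G A v) \<one>\<^bsub>G\<^esub>"

text \<open>The trace of an endomorphism \<open>T\<close> of a finite-dimensional subspace \<open>V\<close>.\<close>

definition trace_on :: "'v::real_vector set \<Rightarrow> ('v \<Rightarrow> 'v) \<Rightarrow> real" where
  "trace_on V T = (let \<B> = SOME \<B>. independent \<B> \<and> span \<B> = V in
     \<Sum>b\<in>\<B>. representation \<B> (T b) b)"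

definition unimodular :: "'v::real_vector set \<Rightarrow> ('v \<Rightarrow> 'v \<Rightarrow> 'v) \<Rightarrow> bool" where
  "unimodular V br \<longleftrightarrow> (\<forall>u\<in>V. trace_on V (br u) = 0)"

end

theory Submission
  imports Defs
begin

text \<open>On a Lie group with orthonormal left invariant frame, smooth fields and sections are functions with
  values in the Lie algebra, and the Levi-Civita and pull-back connections become the flat derivative plus the
  Koszul product \<open>nab\<close> of the Lie algebra. Hence \<open>\<tau>(\<phi>)\<close> is the left invariant section given by
  \<open>\<tau> = \<tau>(\<xi>)\<close>, and since \<open>\<phi>\<close> is a submersion, \<open>-\<tau>\<^sub>2\<close> is the left invariant section given by
  \<open>b(\<tau>) = \<Sum> \<nabla>\<^sub>f \<nabla>\<^sub>f \<tau> + R(\<tau>, f) f - \<nabla>\<^bsub>U - \<tau>\<^esub> \<tau>\<close>, where \<open>f\<close> runs through an orthonormal basis of \<open>\<hh>\<close> and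
  \<open>U = \<Sum> \<nabla>\<^sub>f f\<close> is dual to the trace form of \<open>ad\<close>.

  Let \<open>S\<close> be \<open>ad \<tau>\<close> and \<open>S*\<close> its adjoint. Then \<open>\<langle>b(\<tau>), \<tau>\<rangle> = - \<bar>S + S*\<bar>\<^sup>2 / 2 - \<langle>U, \<nabla>\<^sub>\<tau> \<tau>\<rangle>\<close>. Conversely, if \<open>S\<close> is skew,
  then it is a derivation of the Koszul product, which yields the Killing identity and \<open>b(\<tau>) = 0\<close>. This settles
  (i), where \<open>U = 0\<close>. For (ii), \<open>\<langle>\<tau>, w\<rangle>\<close> is minus the trace of \<open>ad (r w)\<close> on \<open>ker \<xi>\<close>; as the trace of a commutator
  vanishes, \<open>\<tau>\<close> is orthogonal to \<open>[\<hh>, \<hh>]\<close>, so that \<open>\<nabla>\<^sub>\<tau> \<tau> = 0\<close> and \<open>\<nabla> \<tau> = - (S + S*) / 2\<close>.\<close>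

section \<open>Functions of class C-infinity\<close>

text \<open>The obstacle is that connections, curvature, frames and traces are all given by
  \<open>SOME\<close>, and tangent vectors are derivations inside a huge function type. Each choice
  therefore needs a witness and a uniqueness argument. The left invariant frame is global, so a
  connection is determined by its values on the frame and the Leibniz rule, with no localisation.
  The Koszul product provides the witness. The frame and the basis picked by \<open>SOME\<close>
  stay unknown; they disappear because the sums over them depend only on a bilinear form or on an
  endomorphism.

  Analysis enters in two places. Hadamard's lemma and plateau functions show that a derivation is
  determined by finitely many coordinates, which makes tangent spaces finite dimensional, and that a
  derivation applied to a function varying with the base point varies smoothly. The second fact
  gives the smoothness of left invariant fields and of trivialised sections.

  The submersion enters through \<open>tau_ctr\<close>: the vertical basis vectors drop out of every
  sum over the image of the basis, so \<open>tau\<close> is the difference of two trace vectors and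
  the bitension depends on \<open>tau\<close> alone.\<close>

lemma Ck_on_subset: "Ck_on k U f \<Longrightarrow> W \<subseteq> U \<Longrightarrow> Ck_on k W f"
  by (induction k arbitrary: f) (auto intro: continuous_on_subset)

text \<open>Derivatives at points of the open set \<open>U\<close> see only values on
  \<open>U\<close>, so they agree, and the induction passes to them.\<close>

lemma Ck_on_cong:
  assumes "open U" "\<And>x. x \<in> U \<Longrightarrow> f x = g x" "Ck_on k U f"
  shows "Ck_on k U g"
  using assms(2,3)
proof (induction k arbitrary: f g)
  case 0
  then show ?case using continuous_on_cong by force
next
  case (Suc k)
  have d: "(g has_derivative frechet_derivative f (at x)) (at x)" if "x \<in> U" for x
    using Suc.prems that assms(1)
    by (metis Ck_on.simps(2) frechet_derivative_works has_derivative_transform_within_open)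
  then have e: "frechet_derivative g (at x) = frechet_derivative f (at x)" if "x \<in> U" for x
    using frechet_derivative_at that by metis
  have "Ck_on k U (\<lambda>x. frechet_derivative g (at x) v)" for v
    using Suc.IH[of "\<lambda>x. frechet_derivative f (at x) v"] Suc.prems e by auto
  then show ?case using d by (auto simp: differentiable_def)
qed

text \<open>Replaces the chosen \<open>frechet_derivative\<close> by any explicit formula
  \<open>f'\<close>, using uniqueness of derivatives on open sets.\<close>

lemma Ck_on_SucI:
  assumes "open U" "\<And>x. x \<in> U \<Longrightarrow> (f has_derivative f' x) (at x)"
    "\<And>v. Ck_on k U (\<lambda>x. f' x v)"
  shows "Ck_on (Suc k) U f"
proof -
  have "frechet_derivative f (at x) = f' x" if "x \<in> U" for x
    using assms(2) that frechet_derivative_at by metis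
  then have "Ck_on k U (\<lambda>x. frechet_derivative f (at x) v)" for v
    using Ck_on_cong[OF assms(1) _ assms(3)] by simp
  then show ?thesis using assms(2) by (auto simp: differentiable_def)
qed

lemma Ck_on_SucD:
  assumes "Ck_on (Suc k) U f" "x \<in> U"
  shows "(f has_derivative frechet_derivative f (at x)) (at x)"
  using assms by (auto simp: frechet_derivative_works)

lemma Ck_on_imp_continuous: "Ck_on k U f \<Longrightarrow> continuous_on U f"
  by (cases k) (auto intro!: differentiable_imp_continuous_on simp: differentiable_on_def
      differentiable_at_withinI)

text \<open>The product and chain rules contain undifferentiated factors, to which the induction
  hypotheses must be applied one order lower.\<close>

lemma Ck_on_Suc_imp: "Ck_on (Suc k) U f \<Longrightarrow> Ck_on k U f"
proof (induction k arbitrary: f)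
  case 0
  then show ?case using Ck_on_imp_continuous by fastforce
next
  case (Suc k)
  then show ?case by (metis Ck_on.simps(2))
qed

lemma Ck_on_const: "Ck_on k U (\<lambda>x. c)"
  by (induction k arbitrary: c) auto

lemma Ck_on_bounded_linear_compose:
  assumes "open U" "bounded_linear L" "Ck_on k U f"
  shows "Ck_on k U (\<lambda>x. L (f x))"
  using assms(3)
proof (induction k arbitrary: f)
  case 0
  then show ?case using assms(2) bounded_linear.continuous_on by auto
next
  case (Suc k)
  show ?case
  proof (rule Ck_on_SucI[OF assms(1)])
    show "((\<lambda>x. L (f x)) has_derivative (\<lambda>v. L (frechet_derivative f (at x) v))) (at x)"
      if "x \<in> U" for x
      by (rule bounded_linear.has_derivative[OF assms(2) Ck_on_SucD[OF Suc.prems that]])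
    show "Ck_on k U (\<lambda>x. L (frechet_derivative f (at x) v))" for v
      by (rule Suc.IH) (use Suc.prems in simp)
  qed
qed

lemma Ck_on_id: "open U \<Longrightarrow> Ck_on k U (\<lambda>x. x)"
  by (cases k) (auto intro: Ck_on_const)

lemma Ck_on_add:
  assumes "open U" "Ck_on k U f" "Ck_on k U g"
  shows "Ck_on k U (\<lambda>x. f x + g x)"
  using assms(2,3)
proof (induction k arbitrary: f g)
  case 0
  then show ?case by (auto intro: continuous_on_add)
next
  case (Suc k)
  show ?case
    by (rule Ck_on_SucI[OF assms(1), where
          f' = "\<lambda>x v. frechet_derivative f (at x) v + frechet_derivative g (at x) v"])
      (use Suc in \<open>auto intro!: has_derivative_add simp: frechet_derivative_works\<close>)
qed

lemma Ck_on_sum: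
  assumes "open U" "\<And>i. i \<in> I \<Longrightarrow> Ck_on k U (f i)"
  shows "Ck_on k U (\<lambda>x. \<Sum>i\<in>I. f i x)"
  using assms(2)
  by (induction I rule: infinite_finite_induct) (auto intro: Ck_on_const Ck_on_add assms(1))

lemma Ck_on_scaleR:
  fixes f :: "'e::real_normed_vector \<Rightarrow> real" and g :: "'e \<Rightarrow> 'f::real_normed_vector"
  assumes "open U" "Ck_on k U f" "Ck_on k U g"
  shows "Ck_on k U (\<lambda>x. f x *\<^sub>R g x)"
  using assms(2,3)
proof (induction k arbitrary: f g)
  case 0
  then show ?case by (auto intro: continuous_on_scaleR)
next
  case (Suc k)
  show ?case
  proof (rule Ck_on_SucI[OF assms(1)])
    show "((\<lambda>x. f x *\<^sub>R g x) has_derivative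
        (\<lambda>v. f x *\<^sub>R frechet_derivative g (at x) v + frechet_derivative f (at x) v *\<^sub>R g x)) (at x)"
      if "x \<in> U" for x
      using that Suc.prems by (intro has_derivative_scaleR Ck_on_SucD) auto
    show "Ck_on k U (\<lambda>x. f x *\<^sub>R frechet_derivative g (at x) v
        + frechet_derivative f (at x) v *\<^sub>R g x)" for v
      using Ck_on_Suc_imp[OF Suc.prems(1)] Ck_on_Suc_imp[OF Suc.prems(2)] Suc.prems
      by (intro Ck_on_add Suc.IH assms(1)) auto
  qed
qed

text \<open>The chain rule evaluates the derivative of \<open>f\<close> in the direction
  \<open>?g' x v\<close>, which moves with \<open>x\<close>, whereas \<open>Ck_on\<close> speaks of
  fixed directions. Expanding the direction in \<open>Basis\<close> repairs this, hence the
  Euclidean type in the middle.\<close>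

lemma Ck_on_compose:
  fixes g :: "'e::real_normed_vector \<Rightarrow> 'f::euclidean_space"
    and f :: "'f \<Rightarrow> 'h::real_normed_vector"
  assumes "open U" "Ck_on k U g" "open W" "Ck_on k W f" "\<And>x. x \<in> U \<Longrightarrow> g x \<in> W"
  shows "Ck_on k U (\<lambda>x. f (g x))"
  using assms(2,4)
proof (induction k arbitrary: f)
  case 0
  then show ?case using assms(5) by (auto intro: continuous_on_compose2)
next
  case (Suc k)
  let ?f' = "\<lambda>x. frechet_derivative f (at x)" and ?g' = "\<lambda>x. frechet_derivative g (at x)"
  have lin: "linear (?f' (g x))" if "x \<in> U" for x
    using Suc.prems(2) assms(5)[OF that] by (auto intro: linear_frechet_derivative)
  have eq: "?f' (g x) (?g' x v) = (\<Sum>b\<in>Basis. (?g' x v \<bullet> b) *\<^sub>R ?f' (g x) b)" if "x \<in> U" for x v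
  proof -
    interpret linear "?f' (g x)" by (rule lin[OF that])
    have "?f' (g x) (\<Sum>b\<in>Basis. (?g' x v \<bullet> b) *\<^sub>R b) = (\<Sum>b\<in>Basis. (?g' x v \<bullet> b) *\<^sub>R ?f' (g x) b)"
      by (simp add: sum scaleR)
    then show ?thesis by (simp add: euclidean_representation)
  qed
  show ?case
  proof (rule Ck_on_SucI[OF assms(1)])
    show "((\<lambda>x. f (g x)) has_derivative (\<lambda>v. ?f' (g x) (?g' x v))) (at x)" if "x \<in> U" for x
      using has_derivative_compose[OF Ck_on_SucD[OF Suc.prems(1) that]
          Ck_on_SucD[OF Suc.prems(2) assms(5)[OF that]]] .
    have "Ck_on k U (\<lambda>x. \<Sum>b\<in>Basis. (?g' x v \<bullet> b) *\<^sub>R ?f' (g x) b)" for v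
    proof (intro Ck_on_sum Ck_on_scaleR assms(1))
      fix b :: 'f assume "b \<in> Basis"
      show "Ck_on k U (\<lambda>x. ?g' x v \<bullet> b)"
        using Suc.prems(1)
        by (intro Ck_on_bounded_linear_compose[OF assms(1) bounded_linear_inner_left]) simp
      show "Ck_on k U (\<lambda>x. ?f' (g x) b)"
        by (rule Suc.IH[OF Ck_on_Suc_imp[OF Suc.prems(1)]]) (use Suc.prems(2) in simp)
    qed
    then show "Ck_on k U (\<lambda>x. ?f' (g x) (?g' x v))" for v
      by (rule Ck_on_cong[OF assms(1), rotated]) (simp add: eq)
  qed
qed

lemma Ck_on_local:
  assumes "\<And>x. x \<in> U \<Longrightarrow> \<exists>W. open W \<and> x \<in> W \<and> Ck_on k W f"
  shows "Ck_on k U f"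
  using assms
proof (induction k arbitrary: f)
  case 0
  have "isCont f x" if "x \<in> U" for x
    using 0[OF that] by (auto simp: continuous_on_eq_continuous_at)
  then show ?case by (simp add: continuous_at_imp_continuous_on)
next
  case (Suc k)
  have "f differentiable at x" if "x \<in> U" for x using Suc.prems[OF that] by auto
  moreover have "Ck_on k U (\<lambda>x. frechet_derivative f (at x) v)" for v
    using Suc.prems by (intro Suc.IH) fastforce
  ultimately show ?case by simp
qed

definition Cinf_on :: "'e::real_normed_vector set \<Rightarrow> ('e \<Rightarrow> 'f::real_normed_vector) \<Rightarrow> bool" where
  "Cinf_on U f \<longleftrightarrow> (\<forall>k. Ck_on k U f)"

lemma Cinf_on_subset: "Cinf_on U f \<Longrightarrow> W \<subseteq> U \<Longrightarrow> Cinf_on W f"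
  unfolding Cinf_on_def using Ck_on_subset by blast

lemma Cinf_on_cong: "open U \<Longrightarrow> (\<And>x. x \<in> U \<Longrightarrow> f x = g x) \<Longrightarrow> Cinf_on U f \<Longrightarrow> Cinf_on U g"
  unfolding Cinf_on_def by (metis Ck_on_cong)

lemma Cinf_on_const: "Cinf_on U (\<lambda>x. c)"
  by (simp add: Cinf_on_def Ck_on_const)

lemma Cinf_on_id: "open U \<Longrightarrow> Cinf_on U (\<lambda>x. x)"
  by (simp add: Cinf_on_def Ck_on_id)

lemma Cinf_on_bounded_linear_compose:
  "open U \<Longrightarrow> bounded_linear L \<Longrightarrow> Cinf_on U f \<Longrightarrow> Cinf_on U (\<lambda>x. L (f x))"
  by (simp add: Cinf_on_def Ck_on_bounded_linear_compose)

lemma Cinf_on_bounded_linear: "open U \<Longrightarrow> bounded_linear L \<Longrightarrow> Cinf_on U L"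
  by (rule Cinf_on_bounded_linear_compose[OF _ _ Cinf_on_id])

lemma Cinf_on_add: "open U \<Longrightarrow> Cinf_on U f \<Longrightarrow> Cinf_on U g \<Longrightarrow> Cinf_on U (\<lambda>x. f x + g x)"
  by (simp add: Cinf_on_def Ck_on_add)

lemma Cinf_on_sum:
  "open U \<Longrightarrow> (\<And>i. i \<in> I \<Longrightarrow> Cinf_on U (f i)) \<Longrightarrow> Cinf_on U (\<lambda>x. \<Sum>i\<in>I. f i x)"
  by (simp add: Cinf_on_def Ck_on_sum)

lemma Cinf_on_scaleR:
  "open U \<Longrightarrow> Cinf_on U f \<Longrightarrow> Cinf_on U g \<Longrightarrow> Cinf_on U (\<lambda>x. f x *\<^sub>R g x)"
  by (simp add: Cinf_on_def Ck_on_scaleR)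

lemma Cinf_on_mult:
  fixes f g :: "'e::real_normed_vector \<Rightarrow> real"
  shows "open U \<Longrightarrow> Cinf_on U f \<Longrightarrow> Cinf_on U g \<Longrightarrow> Cinf_on U (\<lambda>x. f x * g x)"
  using Cinf_on_scaleR[of U f g] by simp

lemma Cinf_on_minus: "open U \<Longrightarrow> Cinf_on U f \<Longrightarrow> Cinf_on U (\<lambda>x. - f x)"
  by (rule Cinf_on_bounded_linear_compose[OF _ bounded_linear_minus[OF bounded_linear_ident]])

lemma Cinf_on_diff: "open U \<Longrightarrow> Cinf_on U f \<Longrightarrow> Cinf_on U g \<Longrightarrow> Cinf_on U (\<lambda>x. f x - g x)"
  using Cinf_on_add[of U f "\<lambda>x. - g x"] Cinf_on_minus[of U g] by simp

lemma Cinf_on_compose: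
  fixes g :: "'e::real_normed_vector \<Rightarrow> 'f::euclidean_space"
  assumes "open U" "Cinf_on U g" "open W" "Cinf_on W f" "\<And>x. x \<in> U \<Longrightarrow> g x \<in> W"
  shows "Cinf_on U (\<lambda>x. f (g x))"
  unfolding Cinf_on_def
proof
  show "Ck_on k U (\<lambda>x. f (g x))" for k
    using assms by (intro Ck_on_compose[of U k g W f]) (auto simp: Cinf_on_def)
qed

lemma Cinf_on_Pair:
  fixes f :: "'e::real_normed_vector \<Rightarrow> 'f::real_normed_vector" and g :: "'e \<Rightarrow> 'h::real_normed_vector"
  assumes "open U" "Cinf_on U f" "Cinf_on U g"
  shows "Cinf_on U (\<lambda>x. (f x, g x))"
proof -
  have "bounded_linear (\<lambda>x. (x, 0) :: 'f \<times> 'h)" "bounded_linear (\<lambda>x. (0, x) :: 'f \<times> 'h)"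
    by (auto intro: bounded_linear_Pair bounded_linear_ident bounded_linear_zero)
  then have "Cinf_on U (\<lambda>x. (f x, 0) + (0 :: 'f, g x))"
    using assms(2,3) by (intro Cinf_on_add assms(1) Cinf_on_bounded_linear_compose[OF assms(1), of "\<lambda>x. (x, 0)" f]
      Cinf_on_bounded_linear_compose[OF assms(1), of "\<lambda>x. (0, x)" g])
  then show ?thesis by simp
qed

lemma Cinf_on_local:
  assumes "\<And>x. x \<in> U \<Longrightarrow> \<exists>W. open W \<and> x \<in> W \<and> Cinf_on W f"
  shows "Cinf_on U f"
  unfolding Cinf_on_def using assms by (intro allI Ck_on_local) (meson Cinf_on_def)

lemma Cinf_on_frechet_derivative:
  "Cinf_on U f \<Longrightarrow> Cinf_on U (\<lambda>x. frechet_derivative f (at x) v)"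
  unfolding Cinf_on_def by (metis Ck_on.simps(2))

lemma Cinf_on_has_derivative:
  "Cinf_on U f \<Longrightarrow> x \<in> U \<Longrightarrow> (f has_derivative frechet_derivative f (at x)) (at x)"
  by (rule Ck_on_SucD[of 0 U]) (auto simp only: Cinf_on_def)

lemma Cinf_on_imp_continuous: "Cinf_on U f \<Longrightarrow> continuous_on U f"
  by (rule Ck_on_imp_continuous[of 0]) (auto simp only: Cinf_on_def)

lemma Cinf_on_inverse_pos:
  fixes f :: "'e::real_normed_vector \<Rightarrow> real"
  assumes "open U" "Cinf_on U f" "\<And>x. x \<in> U \<Longrightarrow> f x > 0"
  shows "Cinf_on U (\<lambda>x. inverse (f x))"
proof -
  \<comment> \<open>The family of all \<open>c * inverse x ^ n\<close> is closed under
    differentiation, so the induction runs for the family; \<open>inverse\<close> is the member with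
    \<open>c = 1\<close> and \<open>n = 1\<close>.\<close>
  have "Ck_on k {0<..} (\<lambda>x::real. c * inverse x ^ n)" for k n c
  proof (induction k arbitrary: n c)
    case 0
    then show ?case by (auto intro!: continuous_intros)
  next
    case (Suc k)
    show ?case
    proof (rule Ck_on_SucI)
      show "((\<lambda>x. c * inverse x ^ n) has_derivative
          (\<lambda>v. (- v * c * real n) * inverse x ^ (n + 1))) (at x)" if "x \<in> {0<..}" for x :: real
        using that
        by (auto intro!: derivative_eq_intros) (cases n; simp add: field_simps fun_eq_iff)
      show "Ck_on k {0<..} (\<lambda>x. (- v * c * real n) * inverse x ^ (n + 1))" for v
        by (rule Suc)
    qed simp
  qed
  from this[of _ 1 1] have "Cinf_on {0<..} (inverse :: real \<Rightarrow> real)"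
    unfolding Cinf_on_def by simp
  then show ?thesis using Cinf_on_compose[OF assms(1,2), of "{0<..}" inverse] assms(3) by auto
qed

subsection \<open>Plateau functions\<close>

text \<open>\<open>flat 0\<close> is the classical smooth function that is zero on one half line and
  positive on the other. The powers of \<open>inverse x\<close> occur in its derivatives: the family
  over \<open>n\<close> is closed under differentiation up to linear combinations.\<close>

definition flat :: "nat \<Rightarrow> real \<Rightarrow> real" where
  "flat n x = (if x \<le> 0 then 0 else inverse x ^ n * exp (- inverse x))"

text \<open>A quadratic bound makes the difference quotient at 0 tend to 0, which settles the only
  point where the formula for the derivative is not plain calculus.\<close>

lemma flat_le: "\<exists>c\<ge>0. \<forall>x. \<bar>flat n x\<bar> \<le> c * x\<^sup>2"
proof (intro exI conjI allI)
  \<comment> \<open>A single term of the exponential series gives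
    \<open>?u ^ (n + 2) / fact (n + 2) \<le> exp ?u\<close> for \<open>?u = inverse x\<close>; the
    two surplus powers pay for the factor \<open>x\<^sup>2\<close>.\<close>
  define c :: real where "c = fact (n + 2)"
  show "c \<ge> 0" by (simp add: c_def)
  fix x
  show "\<bar>flat n x\<bar> \<le> c * x\<^sup>2"
  proof (cases "x > 0")
    case True
    let ?u = "inverse x"
    have "?u ^ (n + 2) / c \<le> exp ?u"
      using sum_le_suminf[OF summable_exp_generic, of "{n + 2}" ?u] True
      by (simp add: exp_def c_def divide_inverse mult.commute)
    then have "?u ^ (n + 2) \<le> c * exp ?u" by (simp add: c_def divide_le_eq mult.commute)
    then have "?u ^ (n + 2) * exp (- ?u) \<le> c * exp ?u * exp (- ?u)"
      by (intro mult_right_mono) auto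
    then have "?u ^ (n + 2) * exp (- ?u) \<le> c" by (simp add: exp_minus mult.assoc)
    then have "x\<^sup>2 * (?u ^ (n + 2) * exp (- ?u)) \<le> x\<^sup>2 * c"
      by (intro mult_left_mono) auto
    moreover have "x\<^sup>2 * (?u ^ (n + 2) * exp (- ?u)) = flat n x"
      using True by (simp add: flat_def power_add field_simps power2_eq_square)
    moreover have "\<bar>flat n x\<bar> = flat n x" using True by (simp add: flat_def)
    ultimately show ?thesis by (simp only: mult.commute)
  qed (use \<open>c \<ge> 0\<close> in \<open>simp add: flat_def\<close>)
qed

lemma flat_has_derivative:
  "(flat n has_real_derivative flat (n + 2) x - n * flat (n + 1) x) (at x)"
proof -
  consider "x < 0" | "x > 0" | "x = 0" by linarith
  then show ?thesis
  proof cases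
    case 1
    have "((\<lambda>_. 0) has_real_derivative 0) (at x)" by simp
    then have "(flat n has_real_derivative 0) (at x)"
      by (rule has_field_derivative_transform_within_open[of _ _ _ "{..<0}"])
        (use 1 in \<open>auto simp: flat_def\<close>)
    then show ?thesis using 1 by (simp add: flat_def)
  next
    case 2
    have "((\<lambda>x. inverse x ^ n * exp (- inverse x)) has_real_derivative
        inverse x ^ (n + 2) * exp (- inverse x) - n * (inverse x ^ (n + 1) * exp (- inverse x))) (at x)"
    proof (cases n)
      case (Suc m)
      show ?thesis unfolding Suc using 2
        by (auto intro!: derivative_eq_intros) (cases m; simp add: algebra_simps)
    qed (use 2 in \<open>auto intro!: derivative_eq_intros\<close>)
    then have "((\<lambda>x. inverse x ^ n * exp (- inverse x)) has_real_derivative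
        flat (n + 2) x - n * flat (n + 1) x) (at x)"
      using 2 by (simp add: flat_def)
    then show ?thesis
      by (rule has_field_derivative_transform_within_open[of _ _ _ "{0<..}"])
        (use 2 in \<open>auto simp: flat_def\<close>)
  next
    case 3
    obtain c where c: "\<And>x. \<bar>flat n x\<bar> \<le> c * x\<^sup>2" using flat_le by blast
    have "\<bar>flat n y / y\<bar> \<le> c * \<bar>y\<bar>" for y
      using c[of y] by (cases "y = 0") (auto simp: abs_if divide_simps power2_eq_square split: if_splits)
    moreover have "((\<lambda>y. c * \<bar>y\<bar>) \<longlongrightarrow> 0) (at (0::real))"
      by (auto intro!: tendsto_eq_intros)
    ultimately have "((\<lambda>y. flat n y / y) \<longlongrightarrow> 0) (at 0)"
      by (intro Lim_null_comparison[of "\<lambda>y. flat n y / y" "\<lambda>y. c * \<bar>y\<bar>"]) (auto simp del: abs_divide)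
    then show ?thesis using 3 by (simp add: has_field_derivative_iff flat_def)
  qed
qed

lemma Cinf_on_flat: "Cinf_on UNIV (flat n)"
proof -
  have "Ck_on k UNIV (flat n)" for k n
  proof (induction k arbitrary: n)
    case 0
    show ?case
      unfolding Ck_on.simps by (rule DERIV_continuous_on[OF flat_has_derivative])
  next
    case (Suc k)
    show ?case
    proof (rule Ck_on_SucI)
      show "(flat n has_derivative (\<lambda>v. v *\<^sub>R (flat (n + 2) x + (- real n) *\<^sub>R flat (n + 1) x))) (at x)" for x
        using flat_has_derivative[of n x] by (simp add: has_field_derivative_def mult_commute_abs)
      show "Ck_on k UNIV (\<lambda>x. v *\<^sub>R (flat (n + 2) x + (- real n) *\<^sub>R flat (n + 1) x))" for v
        by (rule Ck_on_scaleR[OF open_UNIV Ck_on_const Ck_on_add[OF open_UNIV Suc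
          Ck_on_scaleR[OF open_UNIV Ck_on_const Suc]]])
    qed simp
  qed
  then show ?thesis by (simp add: Cinf_on_def)
qed

lemma plateau_exists:
  fixes z :: "'e::euclidean_space"
  assumes "e > 0"
  obtains \<beta> :: "'e \<Rightarrow> real" where "Cinf_on UNIV \<beta>" "\<And>y. norm (y - z) < e / 2 \<Longrightarrow> \<beta> y = 1"
    "\<And>y. norm (y - z) \<ge> e \<Longrightarrow> \<beta> y = 0"
proof
  let ?s = "\<lambda>y. (y - z) \<bullet> (y - z)"
  \<comment> \<open>\<open>?a\<close> is positive exactly at distance less than \<open>e\<close>
    from \<open>z\<close>, and \<open>?b\<close> exactly at distance greater than
    \<open>e / 2\<close>. The sum never vanishes, and the quotient \<open>?\<beta>\<close> is 1
    where \<open>?b = 0\<close> and 0 where \<open>?a = 0\<close>.\<close>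
  let ?a = "\<lambda>y. flat 0 (e\<^sup>2 - ?s y)" and ?b = "\<lambda>y. flat 0 (?s y - (e / 2)\<^sup>2)"
  let ?\<beta> = "\<lambda>y. ?a y * inverse (?a y + ?b y)"
  have s: "?s y = (norm (y - z))\<^sup>2" for y by (simp add: power2_norm_eq_inner)
  have "Cinf_on UNIV (\<lambda>y. \<Sum>b\<in>Basis. ((y - z) \<bullet> b) * ((y - z) \<bullet> b))"
    by (intro Cinf_on_sum Cinf_on_mult Cinf_on_diff Cinf_on_id Cinf_on_const
        Cinf_on_bounded_linear_compose[OF open_UNIV bounded_linear_inner_left]) auto
  then have S: "Cinf_on UNIV ?s" by (subst euclidean_inner) simp
  have A: "Cinf_on UNIV ?a" "Cinf_on UNIV ?b"
    by (rule Cinf_on_compose[OF _ _ open_UNIV Cinf_on_flat], auto intro!: Cinf_on_diff S Cinf_on_const)+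
  have "e\<^sup>2 - ?s y > 0 \<or> ?s y - (e / 2)\<^sup>2 > 0" for y
    using assms by (auto simp: power2_eq_square) (smt (verit) assms mult_pos_pos field_sum_of_halves)
  then have "?a y + ?b y > 0" for y
    using flat_def[of 0] by (smt (verit) exp_gt_zero mult_pos_pos power_0 zero_less_one)
  then show "Cinf_on UNIV ?\<beta>"
    by (intro Cinf_on_mult Cinf_on_inverse_pos Cinf_on_add A) auto
  show "?\<beta> y = 1" if "norm (y - z) < e / 2" for y
  proof -
    have "?s y < (e / 2)\<^sup>2" using that by (simp add: s power_strict_mono)
    moreover have "(e/2)\<^sup>2 < e\<^sup>2" using assms by (simp add: power_strict_mono)
    ultimately show ?thesis by (simp add: flat_def)
  qed
  show "?\<beta> y = 0" if "norm (y - z) \<ge> e" for y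
  proof -
    have "?s y \<ge> e\<^sup>2" using that assms by (simp add: s power_mono)
    then show ?thesis by (simp add: flat_def)
  qed
qed

subsection \<open>Hadamard's lemma\<close>

text \<open>Differentiation in \<open>x\<close> produces another factor \<open>t\<close>; the weight \<open>t ^ m\<close> makes the class of these
  integrals closed under it.\<close>

lemma Ck_on_segment_integral:
  fixes f :: "'e::euclidean_space \<Rightarrow> real"
  assumes U: "open U" "convex U" "z \<in> U" and f: "\<And>k. Ck_on k U f"
  shows "Ck_on k U (\<lambda>x. integral {0..1} (\<lambda>t. t ^ m * f (z + t *\<^sub>R (x - z))))"
  using f
proof (induction k arbitrary: m f)
  case (0 m f)
  let ?s = "\<lambda>x t. z + t *\<^sub>R (x - z)"
  have in_U: "?s x t \<in> U" if "x \<in> U" "t \<in> {0..1}" for x t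
    using convexD_alt[OF U(2,3) that(1), of t] that by (simp add: algebra_simps)
  have "continuous_on (U \<times> cbox 0 1) (\<lambda>(x, t). t ^ m * f (?s x t))"
    using Ck_on_imp_continuous[OF 0] in_U
    by (auto simp: split_beta intro!: continuous_intros continuous_on_compose2[of U f])
  from integral_continuous_on_param[OF this] show ?case by simp
next
  case (Suc k m f)
  let ?s = "\<lambda>x t. z + t *\<^sub>R (x - z)" and ?f' = "\<lambda>x. frechet_derivative f (at x)"
  have in_U: "?s x t \<in> U" if "x \<in> U" "t \<in> {0..1}" for x t
    using convexD_alt[OF U(2,3) that(1), of t] that by (simp add: algebra_simps)
  \<comment> \<open>\<open>leibniz_rule\<close> expects the derivative as a bounded linear function.
    \<open>Blinfun\<close> has the intended values only where its argument is bounded linear, hence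
    the restriction to \<open>x \<in> U\<close> and \<open>t \<in> {0..1}\<close> in the fact
    \<open>D\<close>.\<close>
  define D where "D = (\<lambda>x t. Blinfun (\<lambda>v. t ^ (m + 1) * ?f' (?s x t) v))"
  have f': "(f has_derivative ?f' x) (at x)" if "x \<in> U" for x
    using Ck_on_SucD[OF Suc.prems that] .
  have bl: "bounded_linear (?f' x)" if "x \<in> U" for x
    using f'[OF that] has_derivative_bounded_linear by blast
  have D: "D x t v = t ^ (m + 1) * ?f' (?s x t) v" if "x \<in> U" "t \<in> {0..1}" for x t v
    unfolding D_def using bl[OF in_U[OF that]]
    by (subst bounded_linear_Blinfun_apply) (auto intro: bounded_linear_const_mult)
  have f'C: "Ck_on j U (\<lambda>x. ?f' x v)" for j v
    using Suc.prems[of "Suc j"] by simp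
  have contD: "continuous_on (U \<times> {0..1}) (\<lambda>(x, t). D x t v)" for v
  proof -
    have "continuous_on (U \<times> {0..1}) (\<lambda>p. ?f' (?s (fst p) (snd p)) v)"
      by (rule continuous_on_compose2[OF Ck_on_imp_continuous[OF f'C[of 0]]])
        (use in_U in \<open>auto intro!: continuous_intros\<close>)
    then have "continuous_on (U \<times> {0..1}) (\<lambda>p. snd p ^ (m + 1) * ?f' (?s (fst p) (snd p)) v)"
      by (rule continuous_on_mult[rotated]) (intro continuous_intros)
    then show ?thesis by (rule continuous_on_eq) (auto simp: D)
  qed
  have cont: "continuous_on (U \<times> cbox 0 1) (\<lambda>(x, t). D x t)"
    using contD by (auto intro!: continuous_on_blinfun_componentwise simp: split_beta)
  have contf: "continuous_on {0..1} (\<lambda>t. t ^ m * f (?s x t))" if "x \<in> U" for x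
  proof (rule continuous_on_mult)
    show "continuous_on {0..1} (\<lambda>t. f (?s x t))"
      by (rule continuous_on_compose2[OF Ck_on_imp_continuous[OF Suc.prems[of 0]]])
        (use in_U[OF that] in \<open>auto intro!: continuous_intros\<close>)
  qed (intro continuous_intros)
  have intD: "(\<lambda>t. D x t) integrable_on {0..1}" if "x \<in> U" for x
  proof (rule integrable_continuous_real)
    have "continuous_on {0..1} (\<lambda>t. case (x, t) of (x, t) \<Rightarrow> D x t)"
      by (rule continuous_on_compose2[OF cont]) (use that in \<open>auto intro!: continuous_intros\<close>)
    then show "continuous_on {0..1} (D x)" by simp
  qed
  have der: "((\<lambda>x. integral (cbox 0 1) (\<lambda>t. t ^ m * f (?s x t))) has_derivative
      integral (cbox 0 1) (D x)) (at x within U)" if "x \<in> U" for x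
  proof (rule leibniz_rule[OF _ _ cont that U(2)])
    fix x :: 'e and t :: real assume x: "x \<in> U" "t \<in> cbox 0 1"
    then have "(f has_derivative ?f' (?s x t)) (at (?s x t))" using f' in_U by auto
    then have "((\<lambda>x. t ^ m * f (?s x t)) has_derivative (\<lambda>v. t ^ m * ?f' (?s x t) (t *\<^sub>R v))) (at x within U)"
      by (intro has_derivative_mult_right)
        (rule has_derivative_compose[where f = "\<lambda>x. ?s x t"], auto intro!: derivative_eq_intros)
    moreover have "t ^ m * ?f' (?s x t) (t *\<^sub>R v) = D x t v" for v
      using x bl[OF in_U[of x t]] by (simp add: D linear_simps)
    ultimately show "((\<lambda>x. t ^ m * f (?s x t)) has_derivative D x t) (at x within U)" by simp
  qed (use contf integrable_continuous_real in auto)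
  show ?case
  proof (rule Ck_on_SucI[OF U(1)])
    show "((\<lambda>x. integral {0..1} (\<lambda>t. t ^ m * f (?s x t))) has_derivative
        (\<lambda>v. integral {0..1} (\<lambda>t. t ^ (m + 1) * ?f' (?s x t) v))) (at x)" if "x \<in> U" for x
    proof -
      have "blinfun_apply (integral {0..1} (D x)) = (\<lambda>v. integral {0..1} (\<lambda>t. t ^ (m + 1) * ?f' (?s x t) v))"
      proof
        fix v
        have "integral {0..1} (D x) v = integral {0..1} (\<lambda>t. D x t v)"
          using blinfun_apply_integral[OF intD[OF that]] .
        also have "\<dots> = integral {0..1} (\<lambda>t. t ^ (m + 1) * ?f' (?s x t) v)"
          by (rule integral_cong) (use that D in auto)
        finally show "integral {0..1} (D x) v = integral {0..1} (\<lambda>t. t ^ (m + 1) * ?f' (?s x t) v)" .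
      qed
      moreover have "((\<lambda>x. integral {0..1} (\<lambda>t. t ^ m * f (?s x t))) has_derivative
          integral {0..1} (D x)) (at x)"
        using der[OF that] unfolding at_within_open[OF that U(1)] box_real .
      ultimately show ?thesis by simp
    qed
    show "Ck_on k U (\<lambda>x. integral {0..1} (\<lambda>t. t ^ (m + 1) * ?f' (?s x t) v))" for v
      by (rule Suc.IH[OF f'C])
  qed
qed

text \<open>The fundamental theorem of calculus along the segment from \<open>z\<close> to
  \<open>x\<close>: \<open>g b\<close> is the mean of the partial derivative in direction
  \<open>b\<close> over the segment. The products of a factor vanishing at \<open>z\<close> with a
  smooth factor are what the Leibniz rule of a derivation can evaluate.\<close>

lemma hadamard:
  fixes f :: "'e::euclidean_space \<Rightarrow> real"
  assumes U: "open U" "convex U" "z \<in> U" and f: "Cinf_on U f"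
  obtains g where "\<And>b. Cinf_on U (g b)"
    "\<And>x. x \<in> U \<Longrightarrow> f x = f z + (\<Sum>b\<in>Basis. ((x - z) \<bullet> b) * g b x)"
    "\<And>b. g b z = frechet_derivative f (at z) b"
proof
  let ?s = "\<lambda>x t. z + t *\<^sub>R (x - z)" and ?f' = "\<lambda>x. frechet_derivative f (at x)"
  let ?g = "\<lambda>b x. integral {0..1} (\<lambda>t. t ^ 0 * ?f' (?s x t) b)"
  show "Cinf_on U (?g b)" for b
    using Ck_on_segment_integral[OF U] Cinf_on_frechet_derivative[OF f, of b] unfolding Cinf_on_def by blast
  show "?g b z = ?f' z b" for b by simp
  show "f x = f z + (\<Sum>b\<in>Basis. ((x - z) \<bullet> b) * ?g b x)" if "x \<in> U" for x
  proof -
    have in_U: "?s x t \<in> U" if "t \<in> {0..1}" for t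
      using convexD_alt[OF U(2,3) \<open>x \<in> U\<close>, of t] that by (simp add: algebra_simps)
    have f': "(f has_derivative ?f' y) (at y)" if "y \<in> U" for y
      using Cinf_on_has_derivative[OF f that] .
    have lin: "?f' (?s x t) (x - z) = (\<Sum>b\<in>Basis. ((x - z) \<bullet> b) * ?f' (?s x t) b)" if "t \<in> {0..1}" for t
    proof -
      interpret linear "?f' (?s x t)" using f'[OF in_U[OF that]] by (rule has_derivative_linear)
      have "?f' (?s x t) (\<Sum>b\<in>Basis. ((x - z) \<bullet> b) *\<^sub>R b) = (\<Sum>b\<in>Basis. ((x - z) \<bullet> b) * ?f' (?s x t) b)"
        by (simp add: sum scaleR)
      then show ?thesis by (simp add: euclidean_representation)
    qed
    have "((\<lambda>t. ?f' (?s x t) (x - z)) has_integral f (?s x 1) - f (?s x 0)) {0..1}"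
    proof (rule fundamental_theorem_of_calculus)
      fix t :: real assume t: "t \<in> {0..1}"
      have "((\<lambda>t. f (?s x t)) has_derivative (\<lambda>r. ?f' (?s x t) (r *\<^sub>R (x - z)))) (at t within {0..1})"
        by (rule has_derivative_compose[where f = "?s x", OF _ f'[OF in_U[OF t]]])
          (auto intro!: derivative_eq_intros)
      then show "((\<lambda>t. f (?s x t)) has_vector_derivative ?f' (?s x t) (x - z)) (at t within {0..1})"
        using has_derivative_linear[OF f'[OF in_U[OF t]]]
        by (simp add: has_vector_derivative_def linear_scale)
    qed simp
    then have "f x - f z = integral {0..1} (\<lambda>t. ?f' (?s x t) (x - z))"
      by (simp add: integral_unique)
    also have "\<dots> = integral {0..1} (\<lambda>t. \<Sum>b\<in>Basis. ((x - z) \<bullet> b) * ?f' (?s x t) b)"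
      by (rule integral_cong) (use lin in auto)
    also have "\<dots> = (\<Sum>b\<in>Basis. integral {0..1} (\<lambda>t. ((x - z) \<bullet> b) * ?f' (?s x t) b))"
    proof (rule integral_sum)
      fix b :: 'e
      have "continuous_on U (\<lambda>y. ?f' y b)"
        using Cinf_on_imp_continuous[OF Cinf_on_frechet_derivative[OF f]] .
      then have "continuous_on {0..1} (\<lambda>t. ?f' (?s x t) b)"
        by (rule continuous_on_compose2) (use in_U in \<open>auto intro!: continuous_intros\<close>)
      then show "(\<lambda>t. ((x - z) \<bullet> b) * ?f' (?s x t) b) integrable_on {0..1}"
        by (intro integrable_continuous_real continuous_on_mult continuous_on_const)
    qed simp
    finally show ?thesis by simp
  qed
qed


section \<open>Charts, smooth functions and tangent vectors\<close>

text \<open>Smoothness at one point in one chart. \<open>F\<close> lives on an open set of the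
  ambient Euclidean space, while the chart image is relatively open in a subspace only; so
  \<open>F\<close> is an extension, and derivatives of \<open>F\<close> make sense without
  mentioning the subspace.\<close>

definition local_rep ::
  "'a set \<Rightarrow> ('a \<Rightarrow> 'e::euclidean_space) \<Rightarrow> ('a \<Rightarrow> 'f::real_normed_vector) \<Rightarrow> 'a \<Rightarrow> bool" where
  "local_rep U c f p \<longleftrightarrow>
     (\<exists>S F. open S \<and> c p \<in> S \<and> Cinf_on S F \<and> (\<forall>q\<in>U. c q \<in> S \<longrightarrow> f q = F (c q)))"

text \<open>The topological part of being a chart around \<open>p\<close>; the last clause is
  continuity of the inverse at \<open>c p\<close>. Unlike membership in an atlas, it passes directly
  to products of charts.\<close>

definition chart_at :: "'a::topological_space set \<Rightarrow> ('a \<Rightarrow> 'e::euclidean_space) \<Rightarrow> 'a \<Rightarrow> bool" where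
  "chart_at U c p \<longleftrightarrow> open U \<and> p \<in> U \<and> inj_on c U \<and> continuous_on U c \<and>
     (\<forall>N. open N \<longrightarrow> p \<in> N \<longrightarrow> (\<exists>S. open S \<and> c p \<in> S \<and> (\<forall>q\<in>U. c q \<in> S \<longrightarrow> q \<in> N)))"

lemma chart_atE:
  assumes "chart_at U c p" "open N" "p \<in> N"
  obtains S where "open S" "c p \<in> S" "\<And>q. q \<in> U \<Longrightarrow> c q \<in> S \<Longrightarrow> q \<in> N"
  using assms unfolding chart_at_def by blast

lemma local_repI:
  "open S \<Longrightarrow> c p \<in> S \<Longrightarrow> Cinf_on S F \<Longrightarrow> (\<And>q. q \<in> U \<Longrightarrow> c q \<in> S \<Longrightarrow> f q = F (c q)) \<Longrightarrow> local_rep U c f p"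
  unfolding local_rep_def by blast

lemma local_repE:
  assumes "local_rep U c f p"
  obtains S F where "open S" "c p \<in> S" "Cinf_on S F" "\<And>q. q \<in> U \<Longrightarrow> c q \<in> S \<Longrightarrow> f q = F (c q)"
  using assms unfolding local_rep_def by blast

lemma local_rep_const: "local_rep U c (\<lambda>_. k) p"
  by (rule local_repI[of UNIV _ _ "\<lambda>_. k"]) (auto intro: Cinf_on_const)

lemma local_rep_chart: "local_rep U c c p"
  by (rule local_repI[of UNIV _ _ "\<lambda>x. x"]) (auto intro: Cinf_on_id)

lemma local_rep_Pair:
  assumes "local_rep U c f p" "local_rep U c g p"
  shows "local_rep U c (\<lambda>q. (f q, g q)) p"
proof -
  obtain S F where S: "open S" "c p \<in> S" "Cinf_on S F" "\<And>q. q \<in> U \<Longrightarrow> c q \<in> S \<Longrightarrow> f q = F (c q)"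
    using local_repE[OF assms(1)] by blast
  obtain T G where T: "open T" "c p \<in> T" "Cinf_on T G" "\<And>q. q \<in> U \<Longrightarrow> c q \<in> T \<Longrightarrow> g q = G (c q)"
    using local_repE[OF assms(2)] by blast
  have "Cinf_on (S \<inter> T) (\<lambda>x. (F x, G x))"
    using S T by (intro Cinf_on_Pair) (auto intro: Cinf_on_subset)
  then show ?thesis
    by (intro local_repI[of "S \<inter> T" _ _ "\<lambda>x. (F x, G x)"]) (use S T in auto)
qed

lemma local_rep_Cinf_compose:
  fixes f :: "'a \<Rightarrow> 'f::euclidean_space"
  assumes "local_rep U c f p" "p \<in> U" "open W" "Cinf_on W G" "f p \<in> W"
  shows "local_rep U c (\<lambda>q. G (f q)) p"
proof -
  obtain S F where S: "open S" "c p \<in> S" "Cinf_on S F" "\<And>q. q \<in> U \<Longrightarrow> c q \<in> S \<Longrightarrow> f q = F (c q)"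
    using local_repE[OF assms(1)] by blast
  have o: "open (S \<inter> F -` W)"
    using continuous_open_preimage[OF Cinf_on_imp_continuous[OF S(3)] S(1) assms(3)] by simp
  have "Cinf_on (S \<inter> F -` W) (\<lambda>x. G (F x))"
    by (rule Cinf_on_compose[OF o Cinf_on_subset[OF S(3)] assms(3,4)]) auto
  then show ?thesis
    by (intro local_repI[OF o]) (use S assms in auto)
qed

lemma local_rep_bilinear:
  fixes f g :: "'a \<Rightarrow> real"
  assumes "local_rep U c f p" "local_rep U c g p" "p \<in> U"
  shows "local_rep U c (\<lambda>q. f q + g q) p" "local_rep U c (\<lambda>q. f q * g q) p"
proof -
  have "Cinf_on UNIV (\<lambda>z. fst z + snd z :: real)" "Cinf_on UNIV (\<lambda>z. fst z * snd z :: real)"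
    by (intro Cinf_on_add Cinf_on_mult Cinf_on_bounded_linear bounded_linear_fst bounded_linear_snd open_UNIV)+
  from this[THEN local_rep_Cinf_compose[OF local_rep_Pair[OF assms(1,2)] assms(3) open_UNIV]]
  show "local_rep U c (\<lambda>q. f q + g q) p" "local_rep U c (\<lambda>q. f q * g q) p" by simp_all
qed

lemma local_rep_sum:
  fixes f :: "'i \<Rightarrow> 'a \<Rightarrow> real"
  assumes "\<And>i. i \<in> I \<Longrightarrow> local_rep U c (f i) p" "p \<in> U"
  shows "local_rep U c (\<lambda>q. \<Sum>i\<in>I. f i q) p"
  using assms(1)
proof (induction I rule: infinite_finite_induct)
  case (insert i I)
  then show ?case using local_rep_bilinear(1)[of U c "f i" p "\<lambda>q. \<Sum>i\<in>I. f i q"] assms(2) by simp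
qed (simp_all add: local_rep_const)

lemma local_rep_transform:
  assumes "local_rep U c f p" "chart_at U c p" "open N" "p \<in> N" "\<And>q. q \<in> N \<Longrightarrow> f q = g q"
  shows "local_rep U c g p"
proof -
  obtain S F where S: "open S" "c p \<in> S" "Cinf_on S F" "\<And>q. q \<in> U \<Longrightarrow> c q \<in> S \<Longrightarrow> f q = F (c q)"
    using local_repE[OF assms(1)] by blast
  obtain T where T: "open T" "c p \<in> T" "\<And>q. q \<in> U \<Longrightarrow> c q \<in> T \<Longrightarrow> q \<in> N"
    using chart_atE[OF assms(2-4)] by blast
  show ?thesis
    by (rule local_repI[of "S \<inter> T" _ _ F])
      (use S T Cinf_on_subset[OF S(3), of "S \<inter> T"] in \<open>auto simp flip: assms(5)\<close>)
qed

lemma local_rep_isCont: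
  assumes "local_rep U c f p" "chart_at U c p"
  shows "isCont f p"
proof -
  obtain S F where S: "open S" "c p \<in> S" "Cinf_on S F" "\<And>q. q \<in> U \<Longrightarrow> c q \<in> S \<Longrightarrow> f q = F (c q)"
    using local_repE[OF assms(1)] by blast
  have c: "open U" "p \<in> U" "continuous_on U c" using assms(2) by (auto simp: chart_at_def)
  have o: "open (U \<inter> c -` S)" using continuous_open_preimage[OF c(3,1) S(1)] .
  have "continuous_on (U \<inter> c -` S) (\<lambda>q. F (c q))"
    by (rule continuous_on_compose2[OF Cinf_on_imp_continuous[OF S(3)] continuous_on_subset[OF c(3)]]) auto
  then have "continuous_on (U \<inter> c -` S) f"
    by (rule continuous_on_eq) (use S in auto)
  then show ?thesis using o c S(2) by (auto simp: continuous_on_eq_continuous_at)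
qed

lemma smooth_onD:
  assumes "smooth_on S f" "x \<in> S"
  obtains U F where "open U" "x \<in> U" "Cinf_on U F" "\<And>y. y \<in> S \<Longrightarrow> y \<in> U \<Longrightarrow> F y = f y"
  using assms unfolding smooth_on_def Cinf_on_def by (metis IntI)

text \<open>The representative is \<open>F \<circ> \<Phi>\<close>, where \<open>\<Phi>\<close>
  extends the coordinate expression of \<open>\<phi>\<close>. Its domain is cut down by
  \<open>T2\<close>, on which continuity keeps \<open>\<phi>\<close> inside \<open>W\<close>, so
  that \<open>\<Phi>\<close> really computes \<open>d \<circ> \<phi>\<close>.\<close>

lemma local_rep_compose:
  fixes d :: "'b::topological_space \<Rightarrow> 'f::euclidean_space"
  assumes c: "chart_at U c p" and \<phi>: "continuous_on UNIV \<phi>" and W: "open W" "\<phi> p \<in> W"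
    and s: "smooth_on (c ` (U \<inter> \<phi> -` W)) (d \<circ> \<phi> \<circ> inv_into U c)"
    and f: "local_rep W d f (\<phi> p)"
  shows "local_rep U c (\<lambda>q. f (\<phi> q)) p"
proof -
  have inj: "inj_on c U" "p \<in> U" using c by (auto simp: chart_at_def)
  obtain T \<Phi> where T: "open T" "c p \<in> T" "Cinf_on T \<Phi>"
    "\<And>y. y \<in> c ` (U \<inter> \<phi> -` W) \<Longrightarrow> y \<in> T \<Longrightarrow> \<Phi> y = (d \<circ> \<phi> \<circ> inv_into U c) y"
    using smooth_onD[OF s, of "c p"] W inj by blast
  have T': "\<Phi> (c q) = d (\<phi> q)" if "q \<in> U" "\<phi> q \<in> W" "c q \<in> T" for q
    using T(4)[of "c q"] that inj by auto
  have "open (\<phi> -` W)" using \<phi> W by (simp add: continuous_on_open_vimage)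
  then obtain T2 where T2: "open T2" "c p \<in> T2" "\<And>q. q \<in> U \<Longrightarrow> c q \<in> T2 \<Longrightarrow> \<phi> q \<in> W"
    using chart_atE[OF c, of "\<phi> -` W"] W by (metis vimage_eq)
  have "local_rep U c (\<lambda>q. d (\<phi> q)) p"
    by (rule local_repI[of "T \<inter> T2" _ _ \<Phi>]) (use T T2 T' in \<open>auto intro: Cinf_on_subset\<close>)
  obtain S F where S: "open S" "d (\<phi> p) \<in> S" "Cinf_on S F" "\<And>q. q \<in> W \<Longrightarrow> d q \<in> S \<Longrightarrow> f q = F (d q)"
    using local_repE[OF f] by blast
  have o: "open (T \<inter> \<Phi> -` S)"
    using continuous_open_preimage[OF Cinf_on_imp_continuous[OF T(3)] T(1) S(1)] by simp
  have "Cinf_on (T \<inter> \<Phi> -` S) (\<lambda>x. F (\<Phi> x))"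
    by (rule Cinf_on_compose[OF o Cinf_on_subset[OF T(3)] S(1,3)]) auto
  then have "Cinf_on (T \<inter> \<Phi> -` S \<inter> T2) (\<lambda>x. F (\<Phi> x))"
    by (rule Cinf_on_subset) auto
  then show ?thesis
    by (rule local_repI[OF open_Int[OF o T2(1)], rotated]) (use T T2 S T' W inj in auto)
qed

section \<open>Smooth functions on a manifold\<close>

locale manifold =
  fixes A :: "('a::{t2_space, second_countable_topology}, 'e::euclidean_space) atlas"
  assumes A: "smooth_manifold A"
begin

lemma chart_at: "(U, c) \<in> A \<Longrightarrow> p \<in> U \<Longrightarrow> chart_at U c p"
proof -
  assume U: "(U, c) \<in> A" and p: "p \<in> U"
  then have o: "open U" and h: "homeomorphism U (c ` U) c (inv_into U c)"
    using A unfolding smooth_manifold_def by auto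
  have "\<exists>S. open S \<and> c p \<in> S \<and> (\<forall>q\<in>U. c q \<in> S \<longrightarrow> q \<in> N)" if N: "open N" "p \<in> N" for N
  proof -
    have "openin (top_of_set (c ` U)) (c ` U \<inter> inv_into U c -` N)"
      using h N by (intro continuous_openin_preimage_gen) (auto simp: homeomorphism_def)
    then obtain S where S: "open S" "c ` U \<inter> inv_into U c -` N = c ` U \<inter> S"
      by (auto simp: openin_open)
    have inv: "inv_into U c (c q) = q" if "q \<in> U" for q using h that by (auto simp: homeomorphism_def)
    have eq: "q \<in> N \<longleftrightarrow> c q \<in> S" if "q \<in> U" for q
      using S(2) inv[OF that] that by (metis IntD2 IntI imageI vimage_eq)
    show ?thesis using S(1) eq N p by blast
  qed
  moreover have "inj_on c U" using h by (metis homeomorphism_def inj_on_inverseI)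
  ultimately show ?thesis using o p h unfolding chart_at_def homeomorphism_def by blast
qed

lemma chart_exists: obtains U c where "(U, c) \<in> A" "p \<in> U"
proof -
  have "p \<in> \<Union> (fst ` A)" using A by (simp add: smooth_manifold_def)
  then show ?thesis using that by auto
qed

lemma chart_open: "(U, c) \<in> A \<Longrightarrow> open U"
  using A by (auto simp: smooth_manifold_def)

lemma local_rep_change:
  assumes "(U, c) \<in> A" "(W, d) \<in> A" "p \<in> U" "p \<in> W" "local_rep W d f p"
  shows "local_rep U c f p"
proof (rule local_rep_compose[OF chart_at[OF assms(1,3)] continuous_on_id chart_open[OF assms(2)] assms(4) _ assms(5)])
  have "smooth_on (c ` (U \<inter> W)) (d \<circ> inv_into U c)"
    using A assms(1,2) unfolding smooth_manifold_def by blast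
  then show "smooth_on (c ` (U \<inter> (\<lambda>x. x) -` W)) (d \<circ> (\<lambda>x. x) \<circ> inv_into U c)"
    by (simp add: o_def)
qed

lemma smooth_funD:
  assumes "smooth_fun A f" "(U, c) \<in> A" "p \<in> U"
  shows "local_rep U c f p"
proof -
  have "smooth_on (c ` (U \<inter> f -` UNIV)) ((\<lambda>x. x) \<circ> f \<circ> inv_into U c)" "continuous_on UNIV f"
    using assms by (auto simp: smooth_fun_def smooth_map_def)
  from local_rep_compose[OF chart_at[OF assms(2,3)] this(2) open_UNIV UNIV_I this(1) local_rep_chart]
  show ?thesis .
qed

text \<open>One chart around each point suffices, because the transition maps carry a representation
  to every other chart, as \<open>smooth_map\<close> demands.\<close>

lemma smooth_funI:
  assumes "\<And>p. \<exists>U c. (U, c) \<in> A \<and> p \<in> U \<and> local_rep U c f p"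
  shows "smooth_fun A f"
proof -
  have L: "local_rep U c f p" if "(U, c) \<in> A" "p \<in> U" for U c p
    using assms[of p] local_rep_change that by blast
  have "isCont f p" for p
    using assms[of p] chart_at local_rep_isCont by blast
  then have "continuous_on UNIV f" by (simp add: continuous_at_imp_continuous_on)
  moreover have "smooth_on (c ` U) (f \<circ> inv_into U c)" if U: "(U, c) \<in> A" for U c
    unfolding smooth_on_def
  proof
    fix x assume "x \<in> c ` U"
    then obtain p where p: "p \<in> U" "x = c p" by auto
    obtain S F where S: "open S" "c p \<in> S" "Cinf_on S F" "\<And>q. q \<in> U \<Longrightarrow> c q \<in> S \<Longrightarrow> f q = F (c q)"
      using local_repE[OF L[OF U p(1)]] by blast
    have "inj_on c U" using chart_at[OF U p(1)] by (simp add: chart_at_def)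
    then show "\<exists>Ua F. open Ua \<and> x \<in> Ua \<and> (\<forall>k. Ck_on k Ua F) \<and> (\<forall>y\<in>c ` U \<inter> Ua. F y = (f \<circ> inv_into U c) y)"
      using S p by (intro exI[of _ S] exI[of _ F]) (auto simp: Cinf_on_def)
  qed
  ultimately show ?thesis by (auto simp: smooth_fun_def smooth_map_def o_def)
qed

lemma smooth_funI_chart:
  assumes "\<And>U c p. (U, c) \<in> A \<Longrightarrow> p \<in> U \<Longrightarrow> local_rep U c f p"
  shows "smooth_fun A f"
proof (rule smooth_funI)
  fix p
  obtain U c where "(U, c) \<in> A" "p \<in> U" by (rule chart_exists)
  then show "\<exists>U c. (U, c) \<in> A \<and> p \<in> U \<and> local_rep U c f p" using assms by blast
qed

lemma smooth_fun_const: "smooth_fun A (\<lambda>_. k)"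
  by (rule smooth_funI_chart) (rule local_rep_const)

lemma smooth_fun_add: "smooth_fun A f \<Longrightarrow> smooth_fun A k \<Longrightarrow> smooth_fun A (\<lambda>x. f x + k x)"
  by (rule smooth_funI_chart) (intro local_rep_bilinear smooth_funD)

lemma smooth_fun_mult: "smooth_fun A f \<Longrightarrow> smooth_fun A k \<Longrightarrow> smooth_fun A (\<lambda>x. f x * k x)"
  by (rule smooth_funI_chart) (intro local_rep_bilinear smooth_funD)

lemma smooth_fun_minus: "smooth_fun A f \<Longrightarrow> smooth_fun A (\<lambda>x. - f x)"
  using smooth_fun_mult[OF smooth_fun_const[of "-1"]] by simp

lemma smooth_fun_diff: "smooth_fun A f \<Longrightarrow> smooth_fun A k \<Longrightarrow> smooth_fun A (\<lambda>x. f x - k x)"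
  using smooth_fun_add[OF _ smooth_fun_minus, of f k] by simp

lemma smooth_fun_sum:
  "(\<And>i. i \<in> I \<Longrightarrow> smooth_fun A (f i)) \<Longrightarrow> smooth_fun A (\<lambda>x. \<Sum>i\<in>I. f i x)"
  by (induction I rule: infinite_finite_induct) (auto intro: smooth_fun_const smooth_fun_add)

text \<open>The source of global smooth functions: a function of the coordinates is multiplied by a
  plateau and extended by zero. Bumps and globally defined coordinates are both obtained from
  it.\<close>

lemma smooth_fun_extension:
  fixes F :: "'e \<Rightarrow> real"
  assumes W: "(W, d) \<in> A" "q \<in> W" and S: "open S" "d q \<in> S" "Cinf_on S F"
  obtains f N where "smooth_fun A f" "open N" "q \<in> N" "\<And>x. x \<in> N \<Longrightarrow> x \<in> W \<and> d x \<in> S \<and> f x = F (d x)"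
    "\<And>x. f x \<noteq> 0 \<Longrightarrow> x \<in> W \<and> d x \<in> S"
proof -
  obtain V where V: "subspace V" "openin (top_of_set V) (d ` W)"
    and h: "homeomorphism W (d ` W) d (inv_into W d)" and oW: "open W"
    using A W unfolding smooth_manifold_def by fast
  obtain T where T: "open T" "d ` W = V \<inter> T" using V by (auto simp: openin_open)
  have "open (T \<inter> S)" "d q \<in> T \<inter> S" using T S W by auto
  then obtain e where e: "e > 0" "cball (d q) e \<subseteq> T \<inter> S" by (meson open_contains_cball)
  obtain \<beta> :: "'e \<Rightarrow> real" where \<beta>: "Cinf_on UNIV \<beta>" "\<And>y. norm (y - d q) < e / 2 \<Longrightarrow> \<beta> y = 1"
    "\<And>y. norm (y - d q) \<ge> e \<Longrightarrow> \<beta> y = 0"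
    using plateau_exists[OF e(1), of "d q"] by blast
  have \<beta>0: "\<beta> y = 0" if "y \<notin> cball (d q) e" for y
    using \<beta>(3)[of y] that by (simp add: dist_norm norm_minus_commute)
  \<comment> \<open>\<open>S\<close> and the complement of the closed ball are open and cover the
    space; \<open>H\<close> is a smooth product on the former and zero on the latter.\<close>
  define H where "H = (\<lambda>y. if y \<in> S then \<beta> y * F y else 0)"
  have "Cinf_on S (\<lambda>y. \<beta> y * F y)"
    using S \<beta>(1) by (intro Cinf_on_mult) (auto intro: Cinf_on_subset)
  then have H1: "Cinf_on S H" by (rule Cinf_on_cong[OF S(1), rotated]) (simp add: H_def)
  have H2: "Cinf_on (- cball (d q) e) H"
    by (rule Cinf_on_cong[OF _ _ Cinf_on_const[of _ 0]]) (auto simp: H_def \<beta>0)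
  have H: "Cinf_on UNIV H"
  proof (rule Cinf_on_local)
    fix x show "\<exists>W. open W \<and> x \<in> W \<and> Cinf_on W H"
      using H1 H2 S(1) e by (cases "x \<in> S") (blast, metis IntD2 ComplI closed_cball open_Compl subsetD)
  qed
  define f where "f = (\<lambda>x. if x \<in> W then H (d x) else 0)"
  \<comment> \<open>\<open>V\<close> is closed, so \<open>V \<inter> cball (d q) e\<close> is
    compact, and its image under the inverse chart is closed by the Hausdorff property. Hence a
    point outside \<open>W\<close> has a neighbourhood on which \<open>f\<close> vanishes.\<close>
  define C where "C = inv_into W d ` (V \<inter> cball (d q) e)"
  have sub: "V \<inter> cball (d q) e \<subseteq> d ` W" using T e by auto
  have "compact (V \<inter> cball (d q) e)"
    using closed_subspace[OF V(1)] by (simp add: closed_Int_compact)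
  then have "compact C"
    unfolding C_def using h sub
    by (intro compact_continuous_image) (auto simp: homeomorphism_def intro: continuous_on_subset)
  then have cl: "open (- C)" by (simp add: compact_imp_closed open_Compl)
  have CW: "C \<subseteq> W" using sub h by (auto simp: C_def inv_into_into)
  have f0: "f x = 0" if "x \<notin> C" for x
  proof (cases "x \<in> W \<and> d x \<in> cball (d q) e")
    case True
    then have "d x \<in> V \<inter> cball (d q) e" "inv_into W d (d x) = x"
      using T h by (auto simp: homeomorphism_def)
    then have "x \<in> C" by (metis C_def imageI)
    then show ?thesis using that by simp
  qed (auto simp: f_def H_def \<beta>0)
  have sm: "smooth_fun A f"
  proof (rule smooth_funI)
    fix p
    obtain U c where U: "(U, c) \<in> A" "p \<in> U" using chart_exists by blast
    show "\<exists>U c. (U, c) \<in> A \<and> p \<in> U \<and> local_rep U c f p"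
    proof (cases "p \<in> W")
      case True
      have "local_rep W d f p" by (rule local_repI[OF open_UNIV _ H]) (auto simp: f_def)
      then show ?thesis using W True by blast
    next
      case False
      then have "p \<in> - C" using CW by auto
      then have "local_rep U c f p"
        by (intro local_rep_transform[OF local_rep_const[of _ _ 0] chart_at[OF U] cl]) (auto simp: f0)
      then show ?thesis using U by blast
    qed
  qed
  let ?N = "W \<inter> d -` ball (d q) (e / 2)"
  have N: "open ?N" using h oW by (intro continuous_open_preimage) (auto simp: homeomorphism_def)
  have Nf: "x \<in> W \<and> d x \<in> S \<and> f x = F (d x)" if "x \<in> ?N" for x
  proof -
    have "norm (d x - d q) < e / 2" using that by (simp add: dist_norm norm_minus_commute)
    moreover from this have "d x \<in> cball (d q) e" using e(1) by (simp add: dist_norm norm_minus_commute)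
    ultimately show ?thesis using that e(2) \<beta>(2) by (auto simp: f_def H_def)
  qed
  show ?thesis
    by (rule that[OF sm N _ Nf]) (use W e(1) in \<open>auto simp: f_def H_def split: if_splits\<close>)
qed

lemma smooth_bump:
  assumes "open N" "p \<in> N"
  obtains k0 where "smooth_fun A k0" "k0 p = 1" "\<And>x. x \<notin> N \<Longrightarrow> k0 x = 0"
proof -
  obtain U c where U: "(U, c) \<in> A" "p \<in> U" using chart_exists by blast
  obtain S where S: "open S" "c p \<in> S" "\<And>q. q \<in> U \<Longrightarrow> c q \<in> S \<Longrightarrow> q \<in> N"
    using chart_atE[OF chart_at[OF U] assms] by blast
  show ?thesis
    by (rule smooth_fun_extension[OF U S(1,2) Cinf_on_const[of _ 1]]) (use that S(3) in metis)
qed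

section \<open>Tangent vectors as derivations: locality and coordinates\<close>

lemma tangent_rules:
  assumes "v \<in> tangent_space A p"
  shows tangent_non_smooth: "\<not> smooth_fun A f \<Longrightarrow> v f = 0"
    and tangent_add: "smooth_fun A f \<Longrightarrow> smooth_fun A k \<Longrightarrow> v (\<lambda>x. f x + k x) = v f + v k"
    and tangent_cmult: "smooth_fun A f \<Longrightarrow> v (\<lambda>x. r * f x) = r * v f"
    and tangent_mult: "smooth_fun A f \<Longrightarrow> smooth_fun A k \<Longrightarrow> v (\<lambda>x. f x * k x) = f p * v k + k p * v f"
  using assms by (auto simp: tangent_space_def)

lemma tangent_const: "v \<in> tangent_space A p \<Longrightarrow> v (\<lambda>_. k) = 0"
proof -
  assume v: "v \<in> tangent_space A p"
  have "v (\<lambda>_. 1) = 0" using tangent_mult[OF v smooth_fun_const[of 1] smooth_fun_const[of 1]] by simp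
  then show ?thesis using tangent_cmult[OF v smooth_fun_const[of 1], of k] by simp
qed

lemma tangent_minus: "v \<in> tangent_space A p \<Longrightarrow> smooth_fun A f \<Longrightarrow> v (\<lambda>x. - f x) = - v f"
  using tangent_cmult[of v p f "-1"] by simp

lemma tangent_diff:
  "v \<in> tangent_space A p \<Longrightarrow> smooth_fun A f \<Longrightarrow> smooth_fun A k \<Longrightarrow> v (\<lambda>x. f x - k x) = v f - v k"
  using tangent_add[of v p f "\<lambda>x. - k x"] tangent_minus smooth_fun_minus by simp

lemma tangent_sum:
  assumes v: "v \<in> tangent_space A p"
  shows "(\<And>i. i \<in> I \<Longrightarrow> smooth_fun A (f i)) \<Longrightarrow> v (\<lambda>x. \<Sum>i\<in>I. f i x) = (\<Sum>i\<in>I. v (f i))"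
  by (induction I rule: infinite_finite_induct)
    (auto simp: tangent_const[OF v] tangent_add[OF v] smooth_fun_sum)

text \<open>With a bump \<open>k0\<close> supported in \<open>N\<close>, the product
  \<open>k0 x * (f x - k x)\<close> is identically zero, and the Leibniz rule at \<open>p\<close>
  leaves \<open>v f - v k\<close> of it.\<close>

lemma tangent_local:
  assumes v: "v \<in> tangent_space A p" and fk: "smooth_fun A f" "smooth_fun A k"
    and N: "open N" "p \<in> N" "\<And>x. x \<in> N \<Longrightarrow> f x = k x"
  shows "v f = v k"
proof -
  obtain k0 where k0: "smooth_fun A k0" "k0 p = 1" "\<And>x. x \<notin> N \<Longrightarrow> k0 x = 0"
    using smooth_bump[OF N(1,2)] by blast
  have "k0 x * (f x - k x) = 0" for x using k0(3)[of x] N(3)[of x] by auto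
  then have "(\<lambda>x. k0 x * (f x - k x)) = (\<lambda>_. 0)" by blast
  then have "v (\<lambda>x. k0 x * (f x - k x)) = 0" using tangent_const[OF v] by simp
  moreover have "v (\<lambda>x. k0 x * (f x - k x)) = v f - v k"
    using tangent_mult[OF v k0(1) smooth_fun_diff[OF fk]] N k0(2) tangent_diff[OF v fk] by simp
  ultimately show ?thesis by simp
qed

text \<open>Hadamard's lemma turns \<open>k\<close> near \<open>q\<close> into a constant plus
  products of functions vanishing at \<open>q\<close> with smooth functions. Locality and the
  Leibniz rule reduce each product to \<open>v (y b)\<close> times the partial derivative. Any
  smooth extension \<open>K\<close> of the coordinate expression gives the same value.\<close>

lemma tangent_chart_derivative:
  assumes v: "v \<in> tangent_space A q" and W: "(W, d) \<in> A" "q \<in> W"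
    and y: "\<And>b. b \<in> Basis \<Longrightarrow> smooth_fun A (y b)"
    and N: "open N" "q \<in> N" "\<And>b x. b \<in> Basis \<Longrightarrow> x \<in> N \<Longrightarrow> y b x = d x \<bullet> b"
    and k: "smooth_fun A k" and S: "open S" "d q \<in> S" "Cinf_on S K"
    "\<And>x. x \<in> W \<Longrightarrow> d x \<in> S \<Longrightarrow> k x = K (d x)"
  shows "v k = (\<Sum>b\<in>Basis. v (y b) * frechet_derivative K (at (d q)) b)"
proof -
  obtain e where e: "e > 0" "ball (d q) e \<subseteq> S" using S by (meson open_contains_ball)
  obtain g where g: "\<And>b. Cinf_on (ball (d q) e) (g b)"
    "\<And>x. x \<in> ball (d q) e \<Longrightarrow> K x = K (d q) + (\<Sum>b\<in>Basis. ((x - d q) \<bullet> b) * g b x)"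
    "\<And>b. g b (d q) = frechet_derivative K (at (d q)) b"
    using hadamard[of "ball (d q) e" "d q" K] e Cinf_on_subset[OF S(3) e(2)] by auto
  have "\<exists>f N. smooth_fun A f \<and> open N \<and> q \<in> N \<and>
      (\<forall>x\<in>N. x \<in> W \<and> d x \<in> ball (d q) e \<and> f x = g b (d x))" for b
    by (rule smooth_fun_extension[OF W open_ball _ g(1)]) (use e in auto)
  then obtain f M where f: "\<And>b. smooth_fun A (f b)" "\<And>b. open (M b)" "\<And>b. q \<in> M b"
    "\<And>b x. x \<in> M b \<Longrightarrow> x \<in> W \<and> d x \<in> ball (d q) e \<and> f b x = g b (d x)"
    by metis
  define N' where "N' = N \<inter> (\<Inter>b\<in>Basis. M b)"
  have N': "open N'" "q \<in> N'" using N f by (auto simp: N'_def intro!: open_INT)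
  have yd: "smooth_fun A (\<lambda>x. y b x - d q \<bullet> b)" if "b \<in> Basis" for b
    using that y by (intro smooth_fun_diff smooth_fun_const)
  have sm: "smooth_fun A (\<lambda>x. (y b x - d q \<bullet> b) * f b x)" if "b \<in> Basis" for b
    using that yd f by (intro smooth_fun_mult)
  have "v k = v (\<lambda>x. K (d q) + (\<Sum>b\<in>Basis. (y b x - d q \<bullet> b) * f b x))"
  proof (rule tangent_local[OF v k _ N'])
    show "smooth_fun A (\<lambda>x. K (d q) + (\<Sum>b\<in>Basis. (y b x - d q \<bullet> b) * f b x))"
      by (intro smooth_fun_add smooth_fun_const smooth_fun_sum sm)
    fix x assume x: "x \<in> N'"
    have xW: "x \<in> W" "d x \<in> ball (d q) e" using x f(4) nonempty_Basis unfolding N'_def by blast+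
    then have "k x = K (d x)" using S(4) e by auto
    also have "\<dots> = K (d q) + (\<Sum>b\<in>Basis. ((d x - d q) \<bullet> b) * g b (d x))"
      by (rule g(2)[OF xW(2)])
    also have "\<dots> = K (d q) + (\<Sum>b\<in>Basis. (y b x - d q \<bullet> b) * f b x)"
      using x f(4) N(3) by (intro arg_cong2[where f="(+)"] sum.cong) (auto simp: N'_def inner_diff_left)
    finally show "k x = K (d q) + (\<Sum>b\<in>Basis. (y b x - d q \<bullet> b) * f b x)" .
  qed
  also have "\<dots> = (\<Sum>b\<in>Basis. v (\<lambda>x. (y b x - d q \<bullet> b) * f b x))"
    using sm tangent_const[OF v]
    by (subst tangent_add[OF v]) (auto simp: tangent_sum[OF v] intro: smooth_fun_const smooth_fun_sum)
  also have "\<dots> = (\<Sum>b\<in>Basis. v (y b) * frechet_derivative K (at (d q)) b)"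
  proof (rule sum.cong[OF refl])
    fix b :: 'e assume b: "b \<in> Basis"
    have "f b q = frechet_derivative K (at (d q)) b" using f(3,4) g(3) by metis
    then show "v (\<lambda>x. (y b x - d q \<bullet> b) * f b x) = v (y b) * frechet_derivative K (at (d q)) b"
      using b y tangent_mult[OF v yd[OF b] f(1)] tangent_diff[OF v y[OF b] smooth_fun_const]
        tangent_const[OF v] N by simp
  qed
  finally show ?thesis .
qed

lemma chart_coordinates_exist:
  assumes W: "(W, d) \<in> A" "q \<in> W"
  obtains y N where "\<And>b. smooth_fun A (y b)" "open N" "q \<in> N"
    "\<And>b x. b \<in> Basis \<Longrightarrow> x \<in> N \<Longrightarrow> x \<in> W \<and> y b x = d x \<bullet> b"
proof -
  have "\<exists>f N. smooth_fun A f \<and> open N \<and> q \<in> N \<and> (\<forall>x\<in>N. x \<in> W \<and> f x = d x \<bullet> b)" for b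
    by (rule smooth_fun_extension[OF W open_UNIV UNIV_I, of "\<lambda>x. x \<bullet> b"])
      (use Cinf_on_bounded_linear[OF open_UNIV bounded_linear_inner_left] in auto)
  then obtain f M where f: "\<And>b. smooth_fun A (f b)" "\<And>b. open (M b)" "\<And>b. q \<in> M b"
    "\<And>b x. x \<in> M b \<Longrightarrow> x \<in> W \<and> f b x = d x \<bullet> b"
    by metis
  show ?thesis
    by (rule that[of f "\<Inter>b\<in>Basis. M b"]) (use f in \<open>auto intro!: open_INT\<close>)
qed

text \<open>A finite family of evaluations is injective on the tangent space. This is the form in
  which finite dimensionality is used.\<close>

lemma tangent_coordinates:
  obtains y where "\<And>b::'e. smooth_fun A (y b)"
    "\<And>v. v \<in> tangent_space A q \<Longrightarrow> (\<And>b. b \<in> Basis \<Longrightarrow> v (y b) = 0) \<Longrightarrow> v = 0"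
proof -
  obtain W d where W: "(W, d) \<in> A" "q \<in> W" using chart_exists by blast
  obtain y N where y: "\<And>b. smooth_fun A (y b)" "open N" "q \<in> N"
    "\<And>b x. b \<in> Basis \<Longrightarrow> x \<in> N \<Longrightarrow> x \<in> W \<and> y b x = d x \<bullet> b"
    using chart_coordinates_exist[OF W] by blast
  show ?thesis
  proof (rule that[OF y(1)])
    fix v assume v: "v \<in> tangent_space A q" "\<And>b. b \<in> Basis \<Longrightarrow> v (y b) = 0"
    have "v k = 0" for k
    proof (cases "smooth_fun A k")
      case True
      obtain S K where S: "open S" "d q \<in> S" "Cinf_on S K" "\<And>x. x \<in> W \<Longrightarrow> d x \<in> S \<Longrightarrow> k x = K (d x)"
        using local_repE[OF smooth_funD[OF True W]] by blast
      show ?thesis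
        using tangent_chart_derivative[OF v(1) W, of y N k S K] y True S v(2) by auto
    qed (use tangent_non_smooth v in blast)
    then show "v = 0" by (simp add: fun_eq_iff)
  qed
qed

lemma subspace_tangent_space: "subspace (tangent_space A p)"
  by (rule subspaceI)
    (auto simp: tangent_space_def scaleR_fun_def algebra_simps)

end

lemma smooth_map_local_rep:
  assumes "manifold A" "manifold B" "smooth_map A B \<phi>" "(U, c) \<in> A" "p \<in> U" "(W, d) \<in> B" "\<phi> p \<in> W"
    "local_rep W d f (\<phi> p)"
  shows "local_rep U c (\<lambda>q. f (\<phi> q)) p"
  by (rule local_rep_compose[OF manifold.chart_at[OF assms(1,4,5)], of \<phi> W d])
    (use assms manifold.chart_open in \<open>auto simp: smooth_map_def\<close>)

lemma smooth_fun_compose: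
  assumes "manifold A" "manifold B" "smooth_map A B \<phi>" "smooth_fun B f"
  shows "smooth_fun A (\<lambda>p. f (\<phi> p))"
proof (rule manifold.smooth_funI[OF assms(1)])
  fix p
  obtain U c where U: "(U, c) \<in> A" "p \<in> U" using manifold.chart_exists[OF assms(1)] by blast
  obtain W d where W: "(W, d) \<in> B" "\<phi> p \<in> W" using manifold.chart_exists[OF assms(2)] by blast
  show "\<exists>U c. (U, c) \<in> A \<and> p \<in> U \<and> local_rep U c (\<lambda>p. f (\<phi> p)) p"
    using smooth_map_local_rep[OF assms(1-3) U W manifold.smooth_funD[OF assms(2,4) W]] U by blast
qed

lemma smooth_map_const:
  fixes A :: "('a::{t2_space, second_countable_topology}, 'e::euclidean_space) atlas"
    and B :: "('b::{t2_space, second_countable_topology}, 'f::euclidean_space) atlas"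
  assumes "manifold A" "manifold B"
  shows "smooth_map A B (\<lambda>_. q)"
proof -
  have "smooth_on S (d \<circ> (\<lambda>_. q) \<circ> i)" for S :: "'e set" and d :: "'b \<Rightarrow> 'f" and i :: "'e \<Rightarrow> 'a"
    unfolding smooth_on_def
  proof
    fix x assume "x \<in> S"
    show "\<exists>U F. open U \<and> x \<in> U \<and> (\<forall>k. Ck_on k U F) \<and> (\<forall>y\<in>S \<inter> U. F y = (d \<circ> (\<lambda>_. q) \<circ> i) y)"
      by (rule exI[of _ UNIV], rule exI[of _ "\<lambda>_. d q"]) (simp add: Ck_on_const)
  qed
  then show ?thesis by (auto simp: smooth_map_def)
qed

lemma smooth_map_ident:
  assumes "manifold A"
  shows "smooth_map A A (\<lambda>p. p)"
proof -
  have "smooth_on (c ` (U \<inter> W)) (d \<circ> inv_into U c)" if "(U, c) \<in> A" "(W, d) \<in> A" for U c W d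
    using assms that unfolding manifold_def smooth_manifold_def by blast
  then show ?thesis by (auto simp: smooth_map_def o_def)
qed

text \<open>The function fed to \<open>V p\<close> changes with \<open>p\<close>. In charts,
  \<open>V p (F p)\<close> is the sum of the smooth functions \<open>V p (y b)\<close> times the
  partial derivatives of the joint representative \<open>\<Phi>\<close> in its second argument,
  taken at \<open>(c p, d (\<phi> p))\<close>.\<close>

lemma section_apply_smooth:
  fixes A :: "('a::{t2_space, second_countable_topology}, 'e::euclidean_space) atlas"
    and B :: "('b::{t2_space, second_countable_topology}, 'f::euclidean_space) atlas"
  assumes A: "manifold A" and B: "manifold B" and \<phi>: "smooth_map A B \<phi>"
    and V: "section_along A B \<phi> V"
    and F: "\<And>p. smooth_fun B (F p)"
    and loc: "\<And>p. \<exists>U c W d. (U, c) \<in> A \<and> (W, d) \<in> B \<and> p \<in> U \<and> \<phi> p \<in> W \<and>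
      local_rep (U \<times> W) (map_prod c d) (\<lambda>(p, x). F p x) (p, \<phi> p)"
  shows "smooth_fun A (\<lambda>p. V p (F p))"
proof (rule manifold.smooth_funI[OF A])
  fix p0
  interpret A: manifold A by (rule A)
  interpret B: manifold B by (rule B)
  obtain U c W d where U: "(U, c) \<in> A" "p0 \<in> U" and W: "(W, d) \<in> B" "\<phi> p0 \<in> W"
    and rep: "local_rep (U \<times> W) (map_prod c d) (\<lambda>(p, x). F p x) (p0, \<phi> p0)"
    using loc by blast
  obtain S \<Phi> where S0: "open S" "map_prod c d (p0, \<phi> p0) \<in> S" "Cinf_on S \<Phi>"
    "\<And>q. q \<in> U \<times> W \<Longrightarrow> map_prod c d q \<in> S \<Longrightarrow> (case q of (p, x) \<Rightarrow> F p x) = \<Phi> (map_prod c d q)"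
    using local_repE[OF rep] by blast
  have S: "open S" "(c p0, d (\<phi> p0)) \<in> S" "Cinf_on S \<Phi>" using S0 by auto
  have S': "F p x = \<Phi> (c p, d x)" if "p \<in> U" "x \<in> W" "(c p, d x) \<in> S" for p x
    using S0(4)[of "(p, x)"] that by auto
  obtain y N where y: "\<And>b. smooth_fun B (y b)" "open N" "\<phi> p0 \<in> N"
    "\<And>b x. b \<in> Basis \<Longrightarrow> x \<in> N \<Longrightarrow> x \<in> W \<and> y b x = d x \<bullet> b"
    using B.chart_coordinates_exist[OF W] by blast
  have NW: "N \<subseteq> W" using y(4) nonempty_Basis by blast
  let ?D = "\<lambda>b z. frechet_derivative \<Phi> (at z) (0, b)"
  let ?z = "\<lambda>p. (c p, d (\<phi> p))"
  have rz: "local_rep U c ?z p0"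
    by (intro local_rep_Pair local_rep_chart smooth_map_local_rep[OF A B \<phi> U W])
  have "local_rep U c (\<lambda>p. V p (y b) * ?D b (?z p)) p0" for b
    using V y(1) S Cinf_on_frechet_derivative[OF S(3)]
    by (intro local_rep_bilinear U A.smooth_funD[OF _ U] local_rep_Cinf_compose[OF rz U(2) S(1)])
      (auto simp: section_along_def)
  then have R: "local_rep U c (\<lambda>p. \<Sum>b\<in>Basis. V p (y b) * ?D b (?z p)) p0"
    by (rule local_rep_sum[OF _ U(2)])
  have c\<phi>: "continuous_on UNIV \<phi>" using \<phi> by (simp add: smooth_map_def)
  \<comment> \<open>At the points of \<open>M\<close> the slice of \<open>\<Phi>\<close> over
    \<open>c p\<close> represents \<open>F p\<close> and the \<open>y b\<close> are chart
    coordinates around \<open>\<phi> p\<close>, so \<open>tangent_chart_derivative\<close> applies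
    pointwise.\<close>
  define M where "M = U \<inter> \<phi> -` N \<inter> {p \<in> U \<inter> \<phi> -` W. ?z p \<in> S}"
  have oM: "open M"
  proof -
    have oN: "open (\<phi> -` N)" "open (\<phi> -` W)"
      using c\<phi> y(2) B.chart_open[OF W(1)] by (auto simp: continuous_on_open_vimage)
    have "continuous_on U c" "continuous_on W d"
      using A.chart_at[OF U] B.chart_at[OF W] by (auto simp: chart_at_def)
    then have "continuous_on (U \<inter> \<phi> -` W) ?z"
      by (intro continuous_on_Pair continuous_on_compose2[of W d _ \<phi>] continuous_on_subset[OF c\<phi>])
        (auto intro: continuous_on_subset)
    then have "open ((U \<inter> \<phi> -` W) \<inter> ?z -` S)"
      by (rule continuous_open_preimage[OF _ open_Int[OF A.chart_open[OF U(1)] oN(2)] S(1)])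
    moreover have "M = (U \<inter> \<phi> -` N) \<inter> ((U \<inter> \<phi> -` W) \<inter> ?z -` S)" by (auto simp: M_def)
    ultimately show ?thesis using A.chart_open[OF U(1)] oN by auto
  qed
  have "local_rep U c (\<lambda>p. V p (F p)) p0"
  proof (rule local_rep_transform[OF R A.chart_at[OF U] oM])
    show "p0 \<in> M" using U W S y by (auto simp: M_def)
    fix p assume p: "p \<in> M"
    let ?S = "{x. (c p, x) \<in> S}"
    have pS: "open ?S" "d (\<phi> p) \<in> ?S"
      using p S(1) continuous_open_vimage[of S "\<lambda>x. (c p, x)"]
      by (auto simp: M_def vimage_def intro!: continuous_intros)
    have K: "Cinf_on ?S (\<lambda>x. \<Phi> (c p, x))"
      by (rule Cinf_on_compose[OF pS(1) _ S(1,3)]) (auto intro!: Cinf_on_Pair Cinf_on_const Cinf_on_id pS)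
    have "(\<Phi> has_derivative frechet_derivative \<Phi> (at (?z p))) (at (?z p))"
      using Cinf_on_has_derivative[OF S(3)] pS by simp
    then have "((\<lambda>x. \<Phi> (c p, x)) has_derivative (\<lambda>b. ?D b (?z p))) (at (d (\<phi> p)))"
      by (rule has_derivative_compose[where f = "\<lambda>x. (c p, x)", rotated]) (auto intro!: derivative_eq_intros)
    then have D: "frechet_derivative (\<lambda>x. \<Phi> (c p, x)) (at (d (\<phi> p))) = (\<lambda>b. ?D b (?z p))"
      using frechet_derivative_at by metis
    have "V p (F p) = (\<Sum>b\<in>Basis. V p (y b) * frechet_derivative (\<lambda>x. \<Phi> (c p, x)) (at (d (\<phi> p))) b)"
    proof (rule B.tangent_chart_derivative[OF _ W(1) _ y(1) y(2) _ _ F pS K])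
      show "V p \<in> tangent_space B (\<phi> p)" using V by (simp add: section_along_def)
    qed (use p y NW S' in \<open>auto simp: M_def\<close>)
    then show "(\<Sum>b\<in>Basis. V p (y b) * ?D b (?z p)) = V p (F p)" by (simp add: D)
  qed
  then show "\<exists>U c. (U, c) \<in> A \<and> p0 \<in> U \<and> local_rep U c (\<lambda>p. V p (F p)) p0" using U by blast
qed


section \<open>Euclidean Lie algebras\<close>

lemma orthonormal_expansion:
  fixes ip :: "'v::real_vector \<Rightarrow> 'v \<Rightarrow> real"
  assumes "bilinear ip" "finite E"
    "\<And>e e'. e \<in> E \<Longrightarrow> e' \<in> E \<Longrightarrow> ip e e' = (if e = e' then 1 else 0)" "v \<in> span E"
  shows "v = (\<Sum>e\<in>E. ip v e *\<^sub>R e)"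
  using assms(4)
proof (induction rule: span_induct_alt)
  case base
  show ?case using bilinear_lzero[OF assms(1)] by simp
next
  case (step c x y)
  have "(\<Sum>e\<in>E. ip x e *\<^sub>R e) = (\<Sum>e\<in>E. if e = x then x else 0)"
    using step assms(3) by (intro sum.cong) auto
  then have "(\<Sum>e\<in>E. ip x e *\<^sub>R e) = x" using step assms(2) by simp
  then show ?case
    using step bilinear_ladd[OF assms(1)] bilinear_lmul[OF assms(1)]
    by (simp add: scaleR_add_left sum.distrib flip: scaleR_scaleR scaleR_sum_right)
qed

text \<open>\<open>trace_on\<close> uses an unknown basis \<open>B\<close>. Expanding
  \<open>e\<close> in \<open>B\<close> on one side, and \<open>T b\<close> in the orthonormal
  \<open>E\<close> on the other, turns both traces into the same double sum.\<close>

lemma trace_on_orthonormal: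
  fixes ip :: "'v::real_vector \<Rightarrow> 'v \<Rightarrow> real"
  assumes ip: "bilinear ip" and E: "finite E"
    "\<And>e e'. e \<in> E \<Longrightarrow> e' \<in> E \<Longrightarrow> ip e e' = (if e = e' then 1 else 0)"
    and T: "linear T" "\<And>v. v \<in> span E \<Longrightarrow> T v \<in> span E"
  shows "trace_on (span E) T = (\<Sum>e\<in>E. ip (T e) e)"
proof -
  define B where "B = (SOME B. independent B \<and> span B = span E)"
  have "\<exists>B. independent B \<and> span B = span E"
    using maximal_independent_subset[of E] by (metis span_minimal span_mono span_span subset_antisym subspace_span)
  then have B: "independent B" "span B = span E" unfolding B_def by (metis (mono_tags, lifting) someI_ex)+
  have "B \<subseteq> span E" using B span_superset by metis
  then have fB: "finite B" using independent_span_bound[OF E(1) B(1)] by simp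
  let ?r = "representation B"
  have rep: "v = (\<Sum>b\<in>B. ?r v b *\<^sub>R b)" if "v \<in> span E" for v
    using real_vector.sum_representation_eq[OF B(1) _ fB order_refl, of v] that B(2) by simp
  have lin: "linear (\<lambda>v. ip v e)" for e using ip by (simp add: bilinear_def)
  have "(\<Sum>e\<in>E. ip (T e) e) = (\<Sum>e\<in>E. \<Sum>b\<in>B. ?r e b * ip (T b) e)"
  proof (rule sum.cong[OF refl])
    fix e assume e: "e \<in> E"
    have "T e = (\<Sum>b\<in>B. ?r e b *\<^sub>R T b)"
      using rep[OF span_base[OF e]] T(1) by (metis (no_types, lifting) linear_scale linear_sum sum.cong)
    then show "ip (T e) e = (\<Sum>b\<in>B. ?r e b * ip (T b) e)"
      by (simp add: linear_sum[OF lin] linear_scale[OF lin])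
  qed
  also have "\<dots> = (\<Sum>b\<in>B. \<Sum>e\<in>E. ip (T b) e * ?r e b)"
    by (subst sum.swap) (simp add: mult.commute)
  also have "\<dots> = (\<Sum>b\<in>B. ?r (T b) b)"
  proof (rule sum.cong[OF refl])
    fix b assume b: "b \<in> B"
    then have Tb: "T b \<in> span E" using T \<open>B \<subseteq> span E\<close> by blast
    have s: "x *\<^sub>R e \<in> span B" if "e \<in> E" for e x using that B by (simp add: span_base span_scale)
    have "?r (\<Sum>e\<in>E. ip (T b) e *\<^sub>R e) = (\<lambda>x. \<Sum>e\<in>E. ?r (ip (T b) e *\<^sub>R e) x)"
      by (rule real_vector.representation_sum[OF B(1)]) (use s in auto)
    moreover have "?r (ip (T b) e *\<^sub>R e) b = ip (T b) e * ?r e b" if "e \<in> E" for e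
      using real_vector.representation_scale[OF B(1)] that B span_base by metis
    ultimately show "(\<Sum>e\<in>E. ip (T b) e * ?r e b) = ?r (T b) b"
      using orthonormal_expansion[OF ip E Tb] by simp
  qed
  finally show ?thesis by (simp add: trace_on_def B_def Let_def)
qed

text \<open>A metric is constrained on tangent spaces only, so its values elsewhere are arbitrary
  and \<open>linear_sum\<close> does not apply; the induction stays inside \<open>V\<close>.\<close>

lemma form_sum:
  fixes s :: "'v::real_vector \<Rightarrow> 'v \<Rightarrow> real"
  assumes V: "subspace V"
    and add: "\<And>u v x. u \<in> V \<Longrightarrow> v \<in> V \<Longrightarrow> x \<in> V \<Longrightarrow> s (u + x) v = s u v + s x v"
    and scale: "\<And>u v r. u \<in> V \<Longrightarrow> v \<in> V \<Longrightarrow> s (r *\<^sub>R u) v = r * s u v"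
    and E: "finite E" "E \<subseteq> V" and v: "v \<in> V"
  shows "s (\<Sum>e\<in>E. a e *\<^sub>R e) v = (\<Sum>e\<in>E. a e * s e v)"
  using E
proof (induction E)
  case empty
  show ?case using scale[of 0 v 0] v subspace_0[OF V] by simp
next
  case (insert x F)
  then have "(\<Sum>e\<in>F. a e *\<^sub>R e) \<in> V" using V by (intro subspace_sum subspace_scale) auto
  then show ?case using insert V v by (simp add: add scale subspace_scale)
qed

lemma form_independent:
  fixes s :: "'v::real_vector \<Rightarrow> 'v \<Rightarrow> real"
  assumes V: "subspace V"
    and add: "\<And>u v x. u \<in> V \<Longrightarrow> v \<in> V \<Longrightarrow> x \<in> V \<Longrightarrow> s (u + x) v = s u v + s x v"
    and scale: "\<And>u v r. u \<in> V \<Longrightarrow> v \<in> V \<Longrightarrow> s (r *\<^sub>R u) v = r * s u v"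
    and E: "finite E" "E \<subseteq> V"
    and orth: "\<And>e e'. e \<in> E \<Longrightarrow> e' \<in> E \<Longrightarrow> s e e' = (if e = e' then 1 else 0)"
  shows "independent E"
proof (rule independent_if_scalars_zero[OF E(1)])
  fix a x assume a: "(\<Sum>x\<in>E. a x *\<^sub>R x) = 0" and x: "x \<in> E"
  have x': "x \<in> V" using x E(2) by blast
  have "0 = s (\<Sum>e\<in>E. a e *\<^sub>R e) x" using scale[of 0 x 0] x' subspace_0[OF V] a by simp
  also have "\<dots> = (\<Sum>e\<in>E. a e * s e x)" by (rule form_sum[OF V add scale E x'])
  also have "\<dots> = (\<Sum>e\<in>E. if e = x then a e else 0)"
    using x by (intro sum.cong) (auto simp: orth)
  finally show "a x = 0" using x E(1) by simp
qed

text \<open>Orthonormal sets in \<open>V\<close> are independent and \<open>w\<close> embeds their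
  span into a Euclidean space, so their sizes are bounded. One of maximal size spans
  \<open>V\<close>, as otherwise a Gram-Schmidt step would enlarge it.\<close>

lemma orthonormal_basis_exists:
  fixes s :: "'v::real_vector \<Rightarrow> 'v \<Rightarrow> real" and w :: "'v \<Rightarrow> 'e::euclidean_space"
  assumes V: "subspace V" and w: "linear w" "\<And>v. v \<in> V \<Longrightarrow> w v = 0 \<Longrightarrow> v = 0"
    and sym: "\<And>u v. u \<in> V \<Longrightarrow> v \<in> V \<Longrightarrow> s u v = s v u"
    and add: "\<And>u v x. u \<in> V \<Longrightarrow> v \<in> V \<Longrightarrow> x \<in> V \<Longrightarrow> s (u + x) v = s u v + s x v"
    and scale: "\<And>u v r. u \<in> V \<Longrightarrow> v \<in> V \<Longrightarrow> s (r *\<^sub>R u) v = r * s u v"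
    and pos: "\<And>u. u \<in> V \<Longrightarrow> u \<noteq> 0 \<Longrightarrow> s u u > 0"
  obtains E where "finite E" "E \<subseteq> V" "span E = V"
    "\<And>e e'. e \<in> E \<Longrightarrow> e' \<in> E \<Longrightarrow> s e e' = (if e = e' then 1 else 0)"
proof -
  define P where "P = (\<lambda>E. finite E \<and> E \<subseteq> V \<and> (\<forall>e\<in>E. \<forall>e'\<in>E. s e e' = (if e = e' then 1 else 0)))"
  note sum = form_sum[OF V add scale]
  have bound: "card E \<le> DIM('e)" if "P E" for E
  proof -
    have E: "finite E" "E \<subseteq> V" using that by (auto simp: P_def)
    have ind: "independent E"
      by (rule form_independent[OF V add scale E]) (use that in \<open>auto simp: P_def\<close>)
    have "span E \<subseteq> V" using E V by (simp add: span_minimal)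
    then have inj: "inj_on w (span E)"
      using w linear_inj_on_span_iff_independent_image by (metis linear_inj_on_iff_eq_0 subset_eq subspace_span)
    then have "independent (w ` E)" using linear_independent_injective_image[OF w(1) ind] by blast
    moreover have "card (w ` E) = card E" using inj_on_subset[OF inj] span_superset card_image by blast
    ultimately show ?thesis using independent_bound by metis
  qed
  have "P {}" by (simp add: P_def)
  \<comment> \<open>\<open>Suc\<close> appears because the existence of a greatest value is stated
    for a strict bound.\<close>
  then obtain E where E: "P E" and max: "\<And>F. P F \<Longrightarrow> card F \<le> card E"
    using ex_has_greatest_nat[of P "{}" card "Suc (DIM('e))"] bound le_imp_less_Suc by blast
  have E': "finite E" "E \<subseteq> V" "\<And>e e'. e \<in> E \<Longrightarrow> e' \<in> E \<Longrightarrow> s e e' = (if e = e' then 1 else 0)"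
    using E by (auto simp: P_def)
  have "V \<subseteq> span E"
  proof
    fix v assume v: "v \<in> V"
    define p where "p = (\<Sum>e\<in>E. s v e *\<^sub>R e)"
    have p: "p \<in> V" "p \<in> span E"
      using E'(2) subspace_scale[OF V]
      by (auto simp: p_def intro!: subspace_sum[OF V] span_sum span_scale[OF span_base])
    define u where "u = v - p"
    have u: "u \<in> V" using v p V by (simp add: u_def subspace_diff)
    have ue: "s u e = 0" if e: "e \<in> E" for e
    proof -
      have "s p e = (\<Sum>e'\<in>E. s v e' * s e' e)"
        unfolding p_def using E' e by (intro sum) auto
      also have "\<dots> = (\<Sum>e'\<in>E. if e' = e then s v e' else 0)"
        using E' e by (intro sum.cong) auto
      finally have "s p e = s v e" using e E'(1) by (simp add: sum.delta')
      moreover have "s (u + p) e = s u e + s p e" using add u p e E'(2) by blast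
      ultimately show ?thesis by (simp add: u_def)
    qed
    have "u = 0"
    proof (rule ccontr)
      assume "u \<noteq> 0"
      then have su: "s u u > 0" using pos u by blast
      define n where "n = inverse (sqrt (s u u)) *\<^sub>R u"
      have n: "n \<in> V" using u V by (simp add: n_def subspace_scale)
      have cc: "inverse (sqrt (s u u)) * inverse (sqrt (s u u)) = inverse (s u u)"
        using su by (simp flip: inverse_mult_distrib)
      have "s n n = inverse (sqrt (s u u)) * s u n"
        unfolding n_def using scale[OF u] u V by (simp add: subspace_scale)
      also have "s u n = s n u" using sym u n by blast
      also have "s n u = inverse (sqrt (s u u)) * s u u" unfolding n_def using scale[OF u u] .
      finally have nn: "s n n = 1" using cc su by (simp flip: mult.assoc)
      have ne: "s n e = 0" "s e n = 0" if "e \<in> E" for e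
      proof -
        show "s n e = 0" unfolding n_def using scale[OF u] ue that E'(2) by auto
        then show "s e n = 0" using sym[of e n] n that E'(2) by auto
      qed
      then have "n \<notin> E" using nn E'(3)[of n n] by fastforce
      moreover have "P (insert n E)"
        using E' n nn ne \<open>n \<notin> E\<close> by (auto simp: P_def)
      ultimately show False using max[of "insert n E"] E'(1) by simp
    qed
    then show "v \<in> span E" using p by (simp add: u_def)
  qed
  then have "span E = V" using E'(2) V by (simp add: span_minimal subset_antisym)
  then show ?thesis using that[of E] E' by blast
qed

text \<open>The operations are total on a type of which only \<open>span E\<close> carries geometry.
  \<open>parseval\<close> says that \<open>ip\<close> sees only components along \<open>E\<close>;
  in the extension \<open>euclid_lie\<close>, \<open>br_expansion\<close> says the same for
  \<open>br\<close>. Thus algebraic identities hold for all arguments, and membership in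
  \<open>span E\<close> matters only when an equation is recovered from inner products, as in
  \<open>ip_eqI\<close>.\<close>

locale euclid =
  fixes ip :: "'v::real_vector \<Rightarrow> 'v \<Rightarrow> real" and E :: "'v set"
  assumes bil_ip: "bilinear ip" and ip_sym: "ip u v = ip v u" and fin: "finite E"
    and orth: "e \<in> E \<Longrightarrow> e' \<in> E \<Longrightarrow> ip e e' = (if e = e' then 1 else 0)"
    and parseval: "ip u v = (\<Sum>e\<in>E. ip u e * ip e v)"
begin

lemmas ip_simps = bilinear_ladd[OF bil_ip] bilinear_radd[OF bil_ip] bilinear_lmul[OF bil_ip]
  bilinear_rmul[OF bil_ip] bilinear_lneg[OF bil_ip] bilinear_rneg[OF bil_ip]
  bilinear_lsub[OF bil_ip] bilinear_rsub[OF bil_ip] bilinear_lzero[OF bil_ip] bilinear_rzero[OF bil_ip]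

lemma ip_sum_left: "ip (\<Sum>i\<in>I. f i) v = (\<Sum>i\<in>I. ip (f i) v)"
  using bil_ip by (simp add: bilinear_def linear_sum[of "\<lambda>u. ip u v"])

lemma ip_sum_right: "ip v (\<Sum>i\<in>I. f i) = (\<Sum>i\<in>I. ip v (f i))"
  using bil_ip by (simp add: bilinear_def linear_sum[of "\<lambda>u. ip v u"])

lemma expansion: "v \<in> span E \<Longrightarrow> (\<Sum>e\<in>E. ip v e *\<^sub>R e) = v"
  using orthonormal_expansion[OF bil_ip fin orth] by metis

lemma linear_expansion: "linear L \<Longrightarrow> v \<in> span E \<Longrightarrow> L v = (\<Sum>e\<in>E. ip v e *\<^sub>R L e)"
  using arg_cong[OF expansion[of v], of L] by (simp add: linear_sum linear_scale)

lemma ip_eqI: "u \<in> span E \<Longrightarrow> v \<in> span E \<Longrightarrow> (\<And>w. ip u w = ip v w) \<Longrightarrow> u = v"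
proof -
  assume u: "u \<in> span E" and v: "v \<in> span E" and eq: "\<And>w. ip u w = ip v w"
  have "u = (\<Sum>e\<in>E. ip u e *\<^sub>R e)" by (rule expansion[OF u, symmetric])
  also have "\<dots> = (\<Sum>e\<in>E. ip v e *\<^sub>R e)" by (simp only: eq)
  also have "\<dots> = v" by (rule expansion[OF v])
  finally show "u = v" .
qed

text \<open>Expanding \<open>x\<close> in \<open>E\<close> produces the coefficients
  \<open>\<Sum>x\<in>F. ip e x * ip x e'\<close>, which are the Kronecker symbol because
  \<open>F\<close> is orthonormal with the same span.\<close>

lemma bilinear_trace:
  fixes \<beta> :: "'v \<Rightarrow> 'v \<Rightarrow> 'w::real_vector"
  assumes \<beta>: "bilinear \<beta>" and F: "finite F" "span F = span E"
    "\<And>e e'. e \<in> F \<Longrightarrow> e' \<in> F \<Longrightarrow> ip e e' = (if e = e' then 1 else 0)"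
  shows "(\<Sum>x\<in>F. \<beta> x x) = (\<Sum>e\<in>E. \<beta> e e)"
proof -
  have l: "linear (\<lambda>u. \<beta> u v)" "linear (\<beta> v)" for v using \<beta> by (auto simp: bilinear_def)
  have x: "\<beta> x x = (\<Sum>e\<in>E. \<Sum>e'\<in>E. (ip e x * ip x e') *\<^sub>R \<beta> e e')" if "x \<in> F" for x
  proof -
    have "x \<in> span E" using F that span_base by metis
    then have "\<beta> x x = (\<Sum>e\<in>E. ip x e *\<^sub>R \<beta> e x)" "\<beta> e x = (\<Sum>e'\<in>E. ip x e' *\<^sub>R \<beta> e e')" for e
      using linear_expansion[OF l(1)[of x]] linear_expansion[OF l(2)[of e]] by auto
    then show ?thesis by (simp add: scaleR_sum_right ip_sym)
  qed
  have p: "(\<Sum>x\<in>F. ip e x * ip x e') = ip e e'" if "e \<in> E" for e e'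
  proof -
    have "e = (\<Sum>x\<in>F. ip e x *\<^sub>R x)"
      using orthonormal_expansion[OF bil_ip F(1,3)] F(2) that span_base by metis
    from arg_cong[OF this, of "\<lambda>u. ip u e'"] show ?thesis by (simp add: ip_sum_left ip_simps)
  qed
  have "(\<Sum>x\<in>F. \<beta> x x) = (\<Sum>e\<in>E. \<Sum>e'\<in>E. (\<Sum>x\<in>F. ip e x * ip x e') *\<^sub>R \<beta> e e')"
    by (simp add: x scaleR_sum_left sum.swap[of _ F])
  also have "\<dots> = (\<Sum>e\<in>E. \<Sum>e'\<in>E. if e' = e then \<beta> e e' else 0)"
    using p orth by (intro sum.cong) auto
  finally show ?thesis using fin by simp
qed

end

section \<open>The Koszul product and the algebraic bitension\<close>

locale euclid_lie = euclid +
  fixes br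
  assumes bil_br: "bilinear br" and br_span: "br u v \<in> span E" and br_anti: "br u v = - br v u"
    and jacobi: "br u (br v w) = br (br u v) w + br v (br u w)"
    and br_expansion: "br u v = (\<Sum>e\<in>E. ip u e *\<^sub>R br e v)"
begin

lemmas br_simps = bilinear_ladd[OF bil_br] bilinear_radd[OF bil_br] bilinear_lmul[OF bil_br]
  bilinear_rmul[OF bil_br] bilinear_lneg[OF bil_br] bilinear_rneg[OF bil_br]
  bilinear_lsub[OF bil_br] bilinear_rsub[OF bil_br] bilinear_lzero[OF bil_br] bilinear_rzero[OF bil_br]

lemma br_self: "br u u = 0"
proof -
  have "2 *\<^sub>R br u u = 0" using br_anti[of u u] by (metis add.right_inverse scaleR_2)
  then show ?thesis by simp
qed

text \<open>The Koszul formula for left invariant fields solved for components: inner products of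
  such fields are constant, so only the bracket terms survive.\<close>

definition nab :: "'a \<Rightarrow> 'a \<Rightarrow> 'a" where
  "nab u v = (\<Sum>e\<in>E. ((ip (br u v) e + ip (br e u) v + ip (br e v) u) / 2) *\<^sub>R e)"

lemma nab_span: "nab u v \<in> span E"
  unfolding nab_def by (intro span_sum span_scale span_base)

lemma koszul: "2 * ip (nab u v) w = ip (br u v) w + ip (br w u) v + ip (br w v) u"
proof -
  \<comment> \<open>The tested vector \<open>e\<close> stands in the first slot of the bracket,
    where \<open>br_expansion\<close> resums it to \<open>w\<close>.\<close>
  have r: "(\<Sum>e\<in>E. ip (br e x) y * ip e w) = ip (br w x) y" for x y
    by (subst (2) br_expansion) (simp add: ip_sum_left ip_simps ip_sym[of w] mult.commute)
  have "2 * ip (nab u v) w =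
      (\<Sum>e\<in>E. 2 * ((ip (br u v) e + ip (br e u) v + ip (br e v) u) / 2 * ip e w))"
    by (simp only: nab_def ip_sum_left ip_simps sum_distrib_left real_scaleR_def)
  also have "\<dots> = (\<Sum>e\<in>E. ip (br u v) e * ip e w + ip (br e u) v * ip e w + ip (br e v) u * ip e w)"
    by (rule sum.cong) (auto simp: field_simps)
  finally have "2 * ip (nab u v) w =
      (\<Sum>e\<in>E. ip (br u v) e * ip e w + ip (br e u) v * ip e w + ip (br e v) u * ip e w)" .
  then show ?thesis using parseval[of "br u v" w] by (simp add: sum.distrib r)
qed

lemma bilinear_nab: "bilinear nab"
proof -
  have k: "ip (nab u v) w = (ip (br u v) w + ip (br w u) v + ip (br w v) u) / 2" for u v w
    using koszul[of u v w] by simp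
  have "nab (u + u') v = nab u v + nab u' v" for u u' v
    by (rule ip_eqI[OF nab_span span_add[OF nab_span nab_span]])
      (simp add: k ip_simps br_simps field_simps)
  moreover have "nab v (u + u') = nab v u + nab v u'" for u u' v
    by (rule ip_eqI[OF nab_span span_add[OF nab_span nab_span]])
      (simp add: k ip_simps br_simps field_simps)
  moreover have "nab (r *\<^sub>R u) v = r *\<^sub>R nab u v" for r u v
    by (rule ip_eqI[OF nab_span span_scale[OF nab_span]])
      (simp add: k ip_simps br_simps field_simps)
  moreover have "nab v (r *\<^sub>R u) = r *\<^sub>R nab v u" for r u v
    by (rule ip_eqI[OF nab_span span_scale[OF nab_span]])
      (simp add: k ip_simps br_simps field_simps)
  ultimately show ?thesis unfolding bilinear_def by (auto intro!: linearI)
qed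

lemmas nab_simps = bilinear_ladd[OF bilinear_nab] bilinear_radd[OF bilinear_nab] bilinear_lmul[OF bilinear_nab]
  bilinear_rmul[OF bilinear_nab] bilinear_lneg[OF bilinear_nab] bilinear_rneg[OF bilinear_nab]
  bilinear_lsub[OF bilinear_nab] bilinear_rsub[OF bilinear_nab] bilinear_lzero[OF bilinear_nab]
  bilinear_rzero[OF bilinear_nab]

lemma nab_torsion: "nab u v - nab v u = br u v"
proof (rule ip_eqI)
  fix w
  have "ip (br v u) w = - ip (br u v) w" by (subst br_anti) (simp add: ip_simps)
  then show "ip (nab u v - nab v u) w = ip (br u v) w"
    using koszul[of u v w] koszul[of v u w] by (simp add: ip_simps)
qed (auto intro: span_diff nab_span br_span)

lemma nab_skew: "ip (nab u v) w = - ip v (nab u w)"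
proof -
  have "ip (br v u) w = - ip (br u v) w" "ip (br w u) v = - ip (br u w) v" "ip (br w v) u = - ip (br v w) u"
    by (subst br_anti, simp add: ip_simps)+
  then show ?thesis using koszul[of u v w] koszul[of u w v] by (simp add: ip_sym[of v])
qed

definition curv :: "'a \<Rightarrow> 'a \<Rightarrow> 'a \<Rightarrow> 'a" where
  "curv u v w = nab u (nab v w) - nab v (nab u w) - nab (br u v) w"

definition ctr :: 'a where "ctr = (\<Sum>e\<in>E. nab e e)"

lemma ip_ctr: "ip ctr v = (\<Sum>e\<in>E. ip (br v e) e)"
proof -
  have "2 * ip (nab e e) v = 2 * ip (br v e) e" for e
    using koszul[of e e v] by (simp add: br_self ip_simps)
  then show ?thesis by (simp add: ctr_def ip_sum_left)
qed

lemma ctr_span: "ctr \<in> span E"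
  unfolding ctr_def by (intro span_sum nab_span)

text \<open>The correction term comes from the derivatives along the frame of the source. These add
  up to the image of its trace vector, which for a submersion with tension \<open>t\<close> is
  \<open>ctr - t\<close> by \<open>tau_ctr\<close>.\<close>

definition bitension :: "'a \<Rightarrow> 'a" where
  "bitension t = (\<Sum>e\<in>E. nab e (nab e t) + curv t e e) - nab (ctr - t) t"

text \<open>Both sides are the Lie derivative of the metric along the left invariant field of
  \<open>t\<close>. In the two Koszul formulas the terms pairing the bracket of \<open>u\<close> and
  \<open>v\<close> with \<open>t\<close> cancel by antisymmetry.\<close>

lemma nab_ad_sym:
  "ip (nab u t) v + ip (nab v t) u = - (ip (br t u) v + ip (br t v) u)"
proof -
  have "ip (br v u) t = - ip (br u v) t" "ip (br u t) v = - ip (br t u) v" "ip (br v t) u = - ip (br t v) u"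
    by (subst br_anti, simp add: ip_simps)+
  then show ?thesis using koszul[of u t v] koszul[of v t u] by simp
qed

lemma ip_bitension:
  "ip (bitension t) t =
    - (\<Sum>e\<in>E. \<Sum>f\<in>E. (ip (br t e) f + ip (br t f) e)\<^sup>2) / 2 - ip ctr (nab t t)"
proof -
  let ?S = "\<lambda>e f. ip (br t e) f" and ?T = "\<lambda>e f. ip (nab e t) f"
  have t0: "ip (nab v t) t = 0" for v using nab_skew[of v t t] by (simp add: ip_sym)
  \<comment> \<open>Skewness turns the first term into minus the squared norm of
    \<open>nab e t\<close>. The same square arises with the opposite sign from the curvature, once
    torsion freeness rewrites \<open>nab t e\<close> as \<open>nab e t + br t e\<close>. What is
    left is linear in \<open>br t\<close>.\<close>
  have e: "ip (nab e (nab e t) + curv t e e) t =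
      - ip (nab e e) (nab t t) + (\<Sum>f\<in>E. ?S e f * ?T e f) + (\<Sum>f\<in>E. ?S e f * ?T f e)" for e
  proof -
    have 1: "ip (nab e (nab e t)) t = - ip (nab e t) (nab e t)"
      "ip (nab t (nab e e)) t = - ip (nab e e) (nab t t)"
      "ip (nab e (nab t e)) t = - ip (nab t e) (nab e t)"
      "ip (nab (br t e) e) t = - ip e (nab (br t e) t)"
      by (rule nab_skew)+
    have 2: "ip (nab t e) (nab e t) = ip (nab e t) (nab e t) + ip (br t e) (nab e t)"
      using nab_torsion[of t e] by (metis add.commute diff_add_cancel ip_simps(1))
    have 3: "ip (br t e) (nab e t) = (\<Sum>f\<in>E. ?S e f * ?T e f)"
      by (subst parseval) (simp add: ip_sym[of _ "nab e t"])
    have "nab (br t e) t = (\<Sum>f\<in>E. ?S e f *\<^sub>R nab f t)"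
      using bilinear_nab by (intro linear_expansion br_span) (simp add: bilinear_def)
    then have 4: "ip e (nab (br t e) t) = (\<Sum>f\<in>E. ?S e f * ?T f e)"
      by (simp add: ip_sum_right ip_simps ip_sym[of e])
    show ?thesis by (simp add: curv_def ip_simps 1 2 3 4)
  qed
  have "(\<Sum>e\<in>E. \<Sum>f\<in>E. ?S e f * ?T e f) + (\<Sum>e\<in>E. \<Sum>f\<in>E. ?S e f * ?T f e)
      = (\<Sum>e\<in>E. \<Sum>f\<in>E. ?S e f * (?T e f + ?T f e))"
    by (simp add: sum.distrib distrib_left)
  also have "\<dots> = - (\<Sum>e\<in>E. \<Sum>f\<in>E. ?S e f * (?S e f + ?S f e))"
    by (simp only: nab_ad_sym mult_minus_right sum_negf)
  \<comment> \<open>Exchanging \<open>e\<close> and \<open>f\<close> shows that the sum of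
    \<open>?S e f * (?S e f + ?S f e)\<close> is half the sum of the squares.\<close>
  also have "\<dots> = - (\<Sum>e\<in>E. \<Sum>f\<in>E. (?S e f + ?S f e)\<^sup>2) / 2"
  proof -
    have "(\<Sum>e\<in>E. \<Sum>f\<in>E. ?S f e * (?S e f + ?S f e)) = (\<Sum>e\<in>E. \<Sum>f\<in>E. ?S e f * (?S e f + ?S f e))"
      by (subst sum.swap) (simp add: add.commute)
    moreover have "(\<Sum>e\<in>E. \<Sum>f\<in>E. (?S e f + ?S f e)\<^sup>2) =
        (\<Sum>e\<in>E. \<Sum>f\<in>E. ?S e f * (?S e f + ?S f e)) + (\<Sum>e\<in>E. \<Sum>f\<in>E. ?S f e * (?S e f + ?S f e))"
      by (simp add: power2_eq_square distrib_right sum.distrib)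
    ultimately show ?thesis by simp
  qed
  finally have "(\<Sum>e\<in>E. ip (nab e (nab e t) + curv t e e) t) =
      - ip ctr (nab t t) - (\<Sum>e\<in>E. \<Sum>f\<in>E. (?S e f + ?S f e)\<^sup>2) / 2"
    by (simp add: e sum.distrib ctr_def ip_sum_left sum_negf sum_subtractf)
  then show ?thesis by (simp add: bitension_def ip_simps ip_sum_left nab_simps t0)
qed

text \<open>The Killing condition for the left invariant field of \<open>t\<close>, see
  \<open>killing_lf_iff\<close>.\<close>

definition skew_ad :: "'a \<Rightarrow> bool" where
  "skew_ad t \<longleftrightarrow> (\<forall>u v. ip (br t u) v + ip (br t v) u = 0)"

lemma skew_adI:
  assumes "\<And>e f. e \<in> E \<Longrightarrow> f \<in> E \<Longrightarrow> ip (br t e) f + ip (br t f) e = 0"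
  shows "skew_ad t"
proof -
  have "br t u = (\<Sum>e\<in>E. ip u e *\<^sub>R br t e)" for u
  proof -
    have "br t u = - (\<Sum>e\<in>E. ip u e *\<^sub>R br e t)" using br_anti[of t u] br_expansion[of u t] by simp
    also have "\<dots> = (\<Sum>e\<in>E. ip u e *\<^sub>R br t e)"
      by (subst br_anti) (simp add: sum_negf)
    finally show ?thesis .
  qed
  then have "ip (br t u) v = ip (\<Sum>e\<in>E. ip u e *\<^sub>R br t e) v" for u v by (rule arg_cong2) (rule refl)
  then have left: "ip (br t u) v = (\<Sum>e\<in>E. ip u e * ip (br t e) v)" for u v
    unfolding ip_sum_left ip_simps real_scaleR_def .
  have right: "ip (br t e) v = (\<Sum>f\<in>E. ip (br t e) f * ip v f)" for e v
    by (subst parseval) (simp only: ip_sym[of _ v])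
  have x: "ip (br t u) v = (\<Sum>e\<in>E. \<Sum>f\<in>E. ip u e * (ip (br t e) f * ip v f))" for u v
  proof -
    have "(\<Sum>e\<in>E. ip u e * ip (br t e) v) = (\<Sum>e\<in>E. ip u e * (\<Sum>f\<in>E. ip (br t e) f * ip v f))"
      by (rule sum.cong[OF refl]) (rule arg_cong[OF right])
    then show ?thesis using left[of u v] by (simp add: sum_distrib_left)
  qed
  have "ip (br t u) v + ip (br t v) u =
      (\<Sum>e\<in>E. \<Sum>f\<in>E. ip u e * ip v f * (ip (br t e) f + ip (br t f) e))" for u v :: 'a
  proof -
    have "ip (br t v) u = (\<Sum>e\<in>E. \<Sum>f\<in>E. ip v f * (ip (br t f) e * ip u e))"
      unfolding x[of v u] by (rule sum.swap)
    then show ?thesis unfolding x[of u v] by (simp add: algebra_simps flip: sum.distrib)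
  qed
  then show ?thesis using assms by (simp add: skew_ad_def)
qed

text \<open>Pairing with \<open>t\<close> leaves a sum of squares, so each entry of the symmetrised
  matrix of \<open>br t\<close> vanishes.\<close>

lemma bitension_zero_imp_skew:
  assumes "bitension t = 0" "ip ctr (nab t t) = 0"
  shows "skew_ad t"
proof (rule skew_adI)
  fix e f assume ef: "e \<in> E" "f \<in> E"
  have "(\<Sum>e\<in>E. \<Sum>f\<in>E. (ip (br t e) f + ip (br t f) e)\<^sup>2) = 0"
    using ip_bitension[of t] assms by (simp add: ip_simps)
  then have "(ip (br t e) f + ip (br t f) e)\<^sup>2 = 0"
    using ef fin by (simp add: sum_nonneg_eq_0_iff sum_nonneg)
  then show "ip (br t e) f + ip (br t f) e = 0" by simp
qed

lemma skew_imp_bitension_zero: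
  assumes "skew_ad t"
  shows "bitension t = 0"
proof -
  have sk: "ip (br t u) v = - ip (br t v) u" for u v using assms by (simp add: skew_ad_def eq_neg_iff_add_eq_0)
  have tt: "nab t t = 0"
  proof (rule ip_eqI[OF nab_span span_zero])
    fix w
    have "ip (br w t) t = - ip (br t w) t" by (subst br_anti) (simp add: ip_simps)
    then show "ip (nab t t) w = ip 0 w"
      using koszul[of t t w] sk[of w t] by (simp add: br_self ip_simps)
  qed
  \<comment> \<open>The Jacobi identity makes \<open>br t\<close> a derivation of \<open>br\<close>,
    and skewness makes it an infinitesimal isometry of \<open>ip\<close>. As \<open>nab\<close> is
    determined by \<open>br\<close> and \<open>ip\<close>, it is respected as well.\<close>
  have der: "br t (nab u v) = nab (br t u) v + nab u (br t v)" for u v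
  proof (rule ip_eqI[OF br_span span_add[OF nab_span nab_span]])
    fix w
    have j: "ip (br t (br x y)) z = ip (br (br t x) y) z + ip (br x (br t y)) z" for x y z
      by (subst jacobi) (simp add: ip_simps)
    have "ip (br t (nab u v)) w = - ip (nab u v) (br t w)" using sk by (simp add: ip_sym)
    moreover have "ip (br u v) (br t w) = - ip (br t (br u v)) w" using sk[of "br u v" w] by (simp add: ip_sym)
    moreover have "ip (br w u) (br t v) = - ip (br t (br w u)) v" using sk[of "br w u" v] by (simp add: ip_sym)
    moreover have "ip (br w v) (br t u) = - ip (br t (br w v)) u" using sk[of "br w v" u] by (simp add: ip_sym)
    ultimately show "ip (br t (nab u v)) w = ip (nab (br t u) v + nab u (br t v)) w"
      using koszul[of u v "br t w"] koszul[of "br t u" v w] koszul[of u "br t v" w]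
        j[of u v w] j[of w u v] j[of w v u]
      by (simp add: ip_simps)
  qed
  \<comment> \<open>After replacing \<open>nab e t\<close> by \<open>nab t e - br t e\<close>, the
    terms \<open>nab e (nab t e)\<close> cancel. The rest is
    \<open>nab t (nab e e) - nab e (br t e) - nab (br t e) e\<close>, which by \<open>der\<close> is
    \<open>nab t (nab e e) - br t (nab e e)\<close>. Summed over \<open>E\<close>, only
    \<open>nab t t = 0\<close> remains of the bitension.\<close>
  have "nab e (nab e t) + curv t e e = nab (nab e e) t" for e
  proof -
    have "nab e t = nab t e - br t e" using nab_torsion[of t e] by (simp add: algebra_simps)
    moreover have "nab (nab e e) t = nab t (nab e e) - br t (nab e e)"
      using nab_torsion[of t "nab e e"] by (simp add: algebra_simps)
    ultimately show ?thesis by (simp add: curv_def nab_simps der)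
  qed
  moreover have "(\<Sum>e\<in>E. nab (nab e e) t) = nab ctr t"
    using bilinear_nab by (simp add: ctr_def bilinear_def linear_sum[of "\<lambda>u. nab u t"])
  ultimately show ?thesis by (simp add: bitension_def nab_simps tt)
qed

lemma parallel_imp_skew:
  assumes "\<And>v. v \<in> span E \<Longrightarrow> nab v t = 0"
  shows "skew_ad t"
proof (rule skew_adI)
  fix e f assume "e \<in> E" "f \<in> E"
  then show "ip (br t e) f + ip (br t f) e = 0"
    using nab_ad_sym[of e t f] assms span_base[of _ E] by (simp add: ip_simps)
qed

lemma bitension_zero_iff_parallel:
  assumes "\<And>u v. ip (br u v) t = 0"
  shows "bitension t = 0 \<longleftrightarrow> (\<forall>v\<in>span E. nab v t = 0)"
proof
  assume b: "bitension t = 0"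
  \<comment> \<open>In the Koszul formula one term contains \<open>br t t\<close>, and the other two
    pair a bracket with \<open>t\<close>.\<close>
  have "nab t t = 0"
    by (rule ip_eqI[OF nab_span span_zero]) (use koszul[of t t] assms in \<open>simp add: br_self ip_simps\<close>)
  then have s: "skew_ad t" using bitension_zero_imp_skew[OF b] by (simp add: ip_simps)
  \<comment> \<open>The Koszul term pairing a bracket with \<open>t\<close> vanishes by assumption;
    the other two form the symmetrised \<open>br t\<close>, which vanishes by skewness.\<close>
  have "nab v t = 0" for v
  proof (rule ip_eqI[OF nab_span span_zero])
    fix w
    have "ip (br v t) w = - ip (br t v) w" "ip (br w t) v = - ip (br t w) v"
      by (subst br_anti, simp add: ip_simps)+
    moreover have "ip (br t v) w + ip (br t w) v = 0" using s by (simp add: skew_ad_def)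
    ultimately show "ip (nab v t) w = ip 0 w"
      using koszul[of v t w] assms[of w v] by (simp add: ip_simps)
  qed
  then show "\<forall>v\<in>span E. nab v t = 0" by blast
qed (use parallel_imp_skew skew_imp_bitension_zero in blast)

lemma bitension_zero_iff_skew: "ctr = 0 \<Longrightarrow> bitension t = 0 \<longleftrightarrow> skew_ad t"
  using bitension_zero_imp_skew[of t] skew_imp_bitension_zero by (auto simp: ip_simps)

end


section \<open>Left invariant fields on Riemannian Lie groups\<close>

text \<open>Since \<open>local_rep_compose\<close> asks of its source chart only that it satisfies
  \<open>chart_at\<close>, this gives access to the group multiplication as a smooth map on the
  product atlas.\<close>

lemma chart_at_prod:
  assumes "chart_at U c p" "chart_at W d x"
  shows "chart_at (U \<times> W) (map_prod c d) (p, x)"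
proof -
  have U: "open U" "p \<in> U" "inj_on c U" "continuous_on U c" using assms(1) by (auto simp: chart_at_def)
  have W: "open W" "x \<in> W" "inj_on d W" "continuous_on W d" using assms(2) by (auto simp: chart_at_def)
  have cont: "continuous_on (U \<times> W) (\<lambda>z. (c (fst z), d (snd z)))"
    by (intro continuous_on_Pair continuous_on_compose2[OF U(4)] continuous_on_compose2[OF W(4)]
        continuous_on_fst continuous_on_snd continuous_on_id) auto
  have "\<exists>S. open S \<and> (c p, d x) \<in> S \<and> (\<forall>q\<in>U \<times> W. map_prod c d q \<in> S \<longrightarrow> q \<in> N)"
    if N: "open N" "(p, x) \<in> N" for N
  proof -
    obtain N1 N2 where N12: "open N1" "open N2" "p \<in> N1" "x \<in> N2" "N1 \<times> N2 \<subseteq> N"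
      using open_prod_elim[OF N] by (metis mem_Sigma_iff)
    obtain S where S: "open S" "c p \<in> S" "\<And>q. q \<in> U \<Longrightarrow> c q \<in> S \<Longrightarrow> q \<in> N1"
      using chart_atE[OF assms(1) N12(1,3)] by blast
    obtain T where T: "open T" "d x \<in> T" "\<And>q. q \<in> W \<Longrightarrow> d q \<in> T \<Longrightarrow> q \<in> N2"
      using chart_atE[OF assms(2) N12(2,4)] by blast
    show ?thesis
      by (rule exI[of _ "S \<times> T"]) (use S T N12(5) in \<open>auto intro: open_Times\<close>)
  qed
  moreover have "inj_on (map_prod c d) (U \<times> W)" using map_prod_inj_on[OF U(3) W(3)] .
  moreover have "continuous_on (U \<times> W) (map_prod c d)" using cont by (simp add: map_prod_def case_prod_beta')
  ultimately show ?thesis using U W by (simp add: chart_at_def open_Times)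
qed

lemma local_rep_slice:
  assumes "local_rep (U \<times> W) (map_prod c d) (\<lambda>(p, x). F p x) (p, x)" "p \<in> U"
  shows "local_rep W d (F p) x"
proof -
  obtain S \<Phi> where S: "open S" "map_prod c d (p, x) \<in> S" "Cinf_on S \<Phi>"
    "\<And>q. q \<in> U \<times> W \<Longrightarrow> map_prod c d q \<in> S \<Longrightarrow> (case q of (p, x) \<Rightarrow> F p x) = \<Phi> (map_prod c d q)"
    using local_repE[OF assms(1)] by blast
  let ?S = "{y. (c p, y) \<in> S}"
  have o: "open ?S"
    using continuous_open_vimage[of S "\<lambda>y. (c p, y)"] S(1)
    by (auto simp: vimage_def intro!: continuous_intros)
  show ?thesis
  proof (rule local_repI[OF o])
    show "Cinf_on ?S (\<lambda>y. \<Phi> (c p, y))"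
      by (rule Cinf_on_compose[OF o _ S(1,3)]) (auto intro!: Cinf_on_Pair Cinf_on_const Cinf_on_id o)
    show "F p q = \<Phi> (c p, d q)" if "q \<in> W" "d q \<in> ?S" for q
      using S(4)[of "(p, q)"] that assms(2) by auto
  qed (use S in auto)
qed

text \<open>Smoothness of a map phrased through \<open>local_rep\<close>, so that a composite like
  inversion after \<open>\<phi>\<close> can be checked at a point by chaining
  representations.\<close>

definition smooth_into ::
  "('a::topological_space, 'e::euclidean_space) atlas \<Rightarrow> ('b::topological_space, 'f::euclidean_space) atlas \<Rightarrow> ('a \<Rightarrow> 'b) \<Rightarrow> bool" where
  "smooth_into A B \<psi> \<longleftrightarrow> continuous_on UNIV \<psi> \<and>
    (\<forall>U c W d p. (U, c) \<in> A \<longrightarrow> (W, d) \<in> B \<longrightarrow> p \<in> U \<longrightarrow> \<psi> p \<in> W \<longrightarrow> local_rep U c (\<lambda>q. d (\<psi> q)) p)"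

lemma smooth_map_into:
  assumes "manifold A" "manifold B" "smooth_map A B \<phi>"
  shows "smooth_into A B \<phi>"
  unfolding smooth_into_def
proof (intro conjI allI impI)
  show "continuous_on UNIV \<phi>" using assms(3) by (simp add: smooth_map_def)
  show "local_rep U c (\<lambda>q. d (\<phi> q)) p" if "(U, c) \<in> A" "(W, d) \<in> B" "p \<in> U" "\<phi> p \<in> W" for U c W d p
    by (rule smooth_map_local_rep[OF assms that(1,3,2,4) local_rep_chart])
qed

text \<open>Joint smoothness is kept when the parameter \<open>q\<close> is replaced by
  \<open>\<psi> q\<close>: the representative becomes \<open>\<Phi> (\<Psi> a, b)\<close>, on the
  open set \<open>?R\<close> where this is defined.\<close>

lemma local_rep_subst_fst:
  fixes d :: "'b \<Rightarrow> 'd::euclidean_space"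
  assumes c: "chart_at U c p" and \<psi>: "continuous_on UNIV \<psi>" and U': "open U'" "\<psi> p \<in> U'"
    and r: "local_rep U c (\<lambda>q. c' (\<psi> q)) p"
    and F: "local_rep (U' \<times> W) (map_prod c' d) (\<lambda>(q, x). F q x) (\<psi> p, x)"
  shows "local_rep (U \<times> W) (map_prod c d) (\<lambda>(q, x). F (\<psi> q) x) (p, x)"
proof -
  obtain S \<Phi> where S: "open S" "map_prod c' d (\<psi> p, x) \<in> S" "Cinf_on S \<Phi>"
    "\<And>q. q \<in> U' \<times> W \<Longrightarrow> map_prod c' d q \<in> S \<Longrightarrow> (case q of (p, x) \<Rightarrow> F p x) = \<Phi> (map_prod c' d q)"
    using local_repE[OF F] by blast
  obtain T \<Psi> where T: "open T" "c p \<in> T" "Cinf_on T \<Psi>" "\<And>q. q \<in> U \<Longrightarrow> c q \<in> T \<Longrightarrow> c' (\<psi> q) = \<Psi> (c q)"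
    using local_repE[OF r] by blast
  have "open (\<psi> -` U')" using \<psi> U' by (simp add: continuous_on_open_vimage)
  then obtain T2 where T2: "open T2" "c p \<in> T2" "\<And>q. q \<in> U \<Longrightarrow> c q \<in> T2 \<Longrightarrow> \<psi> q \<in> U'"
    using chart_atE[OF c, of "\<psi> -` U'"] U' by (metis vimage_eq)
  let ?R = "(T \<inter> T2) \<times> UNIV \<inter> (\<lambda>z. (\<Psi> (fst z), snd z)) -` S"
  have oT: "open ((T \<inter> T2) \<times> (UNIV :: 'd set))" using T T2 by (intro open_Times open_Int) auto
  have "continuous_on ((T \<inter> T2) \<times> (UNIV :: 'd set)) (\<lambda>z. (\<Psi> (fst z), snd z))"
    by (intro continuous_on_Pair continuous_on_compose2[OF Cinf_on_imp_continuous[OF T(3)]]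
        continuous_on_fst continuous_on_snd continuous_on_id) auto
  then have oR: "open ?R" using oT S(1) by (rule continuous_open_preimage)
  have f: "Cinf_on ?R fst" "Cinf_on ?R snd"
    by (rule Cinf_on_bounded_linear[OF oR bounded_linear_fst], rule Cinf_on_bounded_linear[OF oR bounded_linear_snd])
  have "Cinf_on ?R (\<lambda>z. \<Psi> (fst z))"
    by (rule Cinf_on_compose[OF oR f(1) T(1,3)]) auto
  then have "Cinf_on ?R (\<lambda>z. (\<Psi> (fst z), snd z))"
    using f(2) by (rule Cinf_on_Pair[OF oR])
  then have R: "Cinf_on ?R (\<lambda>z. \<Phi> (\<Psi> (fst z), snd z))"
    by (rule Cinf_on_compose[OF oR _ S(1,3)]) auto
  have p: "p \<in> U" using c by (simp add: chart_at_def)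
  show ?thesis
  proof (rule local_repI[OF oR _ R])
    show "map_prod c d (p, x) \<in> ?R" using S(2) T T2 p by auto
    fix q assume q: "q \<in> U \<times> W" "map_prod c d q \<in> ?R"
    obtain a b where ab: "q = (a, b)" by (cases q)
    then show "(case q of (q, x) \<Rightarrow> F (\<psi> q) x) = \<Phi> (\<Psi> (fst (map_prod c d q)), snd (map_prod c d q))"
      using S(4)[of "(\<psi> a, b)"] T(4)[of a] T2(3)[of a] q by auto
  qed
qed

lemma differential_add: "differential B \<phi> (u + v) = differential B \<phi> u + differential B \<phi> v"
  by (auto simp: differential_def fun_eq_iff)

lemma differential_scale: "differential B \<phi> (r *\<^sub>R u) = r *\<^sub>R differential B \<phi> u"
  by (auto simp: differential_def fun_eq_iff scaleR_fun_def)

lemma linear_differential: "linear (differential B \<phi>)"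
  by (rule linearI) (rule differential_add, rule differential_scale)

lemma sum_fun_apply: "(\<Sum>i\<in>I. f i) x = (\<Sum>i\<in>I. f i x)" for f :: "'i \<Rightarrow> 'a \<Rightarrow> 'b::comm_monoid_add"
  by (induction I rule: infinite_finite_induct) auto

lemma scaleR_fun_apply: "(r *\<^sub>R f) x = r *\<^sub>R f x" for f :: "'a \<Rightarrow> 'b::real_vector"
  by (simp add: scaleR_fun_def)

text \<open>Smoothness of the map enters as the assumption \<open>pull\<close> on pulled-back
  functions, the form in which it is known for left translations by
  \<open>smooth_fun_translate\<close>.\<close>

lemma differential_tangent:
  assumes A: "manifold A" and pull: "\<And>f. smooth_fun B f \<Longrightarrow> smooth_fun A (\<lambda>p. f (\<phi> p))"
    and B: "manifold B" and v: "v \<in> tangent_space A p"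
  shows "differential B \<phi> v \<in> tangent_space B (\<phi> p)"
proof -
  interpret A: manifold A by (rule A)
  interpret B: manifold B by (rule B)
  show ?thesis
    using A.tangent_add[OF v] A.tangent_cmult[OF v] A.tangent_mult[OF v] pull
      B.smooth_fun_add B.smooth_fun_mult B.smooth_fun_mult[OF B.smooth_fun_const]
    by (auto simp: tangent_space_def differential_def o_def)
qed

context manifold begin

lemma vector_fieldD:
  assumes "vector_field A X"
  shows "X p \<in> tangent_space A p" "smooth_fun A f \<Longrightarrow> smooth_fun A (\<lambda>p. X p f)"
  using assms by (auto simp: vector_field_def section_along_def)

lemma vector_fieldI:
  "(\<And>p. X p \<in> tangent_space A p) \<Longrightarrow> (\<And>f. smooth_fun A f \<Longrightarrow> smooth_fun A (\<lambda>p. X p f)) \<Longrightarrow> vector_field A X"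
  by (auto simp: vector_field_def section_along_def)

lemma lie_bracket_tangent:
  assumes X: "vector_field A X" and Y: "vector_field A Y"
  shows "lie_bracket X Y p \<in> tangent_space A p"
  unfolding tangent_space_def
proof (intro CollectI conjI allI impI)
  note XT = vector_fieldD(1)[OF X] and YT = vector_fieldD(1)[OF Y]
  note XS = vector_fieldD(2)[OF X] and YS = vector_fieldD(2)[OF Y]
  show "lie_bracket X Y p f = 0" if "\<not> smooth_fun A f" for f
    using tangent_non_smooth[OF XT that] tangent_non_smooth[OF YT that] tangent_const[OF XT] tangent_const[OF YT]
    by (simp add: lie_bracket_def)
  show "lie_bracket X Y p (\<lambda>x. f x + k x) = lie_bracket X Y p f + lie_bracket X Y p k"
    if "smooth_fun A f" "smooth_fun A k" for f k
    using that by (simp add: lie_bracket_def tangent_add[OF XT] tangent_add[OF YT] XS YS)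
  show "lie_bracket X Y p (\<lambda>x. r * f x) = r * lie_bracket X Y p f" if "smooth_fun A f" for r f
    using that by (simp add: lie_bracket_def tangent_cmult[OF XT] tangent_cmult[OF YT] XS YS algebra_simps)
  show "lie_bracket X Y p (\<lambda>x. f x * k x) = f p * lie_bracket X Y p k + k p * lie_bracket X Y p f"
    if "smooth_fun A f" "smooth_fun A k" for f k
    using that
    by (simp add: lie_bracket_def tangent_mult[OF XT] tangent_mult[OF YT] tangent_add[OF XT] tangent_add[OF YT]
        XS YS smooth_fun_mult algebra_simps)
qed

lemma vector_field_lie_bracket:
  assumes X: "vector_field A X" and Y: "vector_field A Y"
  shows "vector_field A (lie_bracket X Y)"
  by (rule vector_fieldI[OF lie_bracket_tangent[OF assms]])
    (simp add: lie_bracket_def smooth_fun_diff vector_fieldD(2)[OF X] vector_fieldD(2)[OF Y])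

lemma lie_bracket_jacobi:
  assumes X: "vector_field A X" and Y: "vector_field A Y" and Z: "vector_field A Z"
  shows "lie_bracket X (lie_bracket Y Z) p =
    lie_bracket (lie_bracket X Y) Z p + lie_bracket Y (lie_bracket X Z) p"
proof
  note T = vector_fieldD(1)[OF X] vector_fieldD(1)[OF Y] vector_fieldD(1)[OF Z]
  note S = vector_fieldD(2)[OF X] vector_fieldD(2)[OF Y] vector_fieldD(2)[OF Z]
  note D = tangent_diff[OF T(1)] tangent_diff[OF T(2)] tangent_diff[OF T(3)]
  fix f
  show "lie_bracket X (lie_bracket Y Z) p f =
    (lie_bracket (lie_bracket X Y) Z p + lie_bracket Y (lie_bracket X Z) p) f"
  proof (cases "smooth_fun A f")
    case True
    then show ?thesis by (simp add: lie_bracket_def D S)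
  next
    case False
    note B = vector_field_lie_bracket
    show ?thesis
      using tangent_non_smooth[OF lie_bracket_tangent[OF X B[OF Y Z]] False]
        tangent_non_smooth[OF lie_bracket_tangent[OF B[OF X Y] Z] False]
        tangent_non_smooth[OF lie_bracket_tangent[OF Y B[OF X Z]] False] by simp
  qed
qed

lemma metric_simps:
  assumes "riemannian_metric A g" "u \<in> tangent_space A p" "v \<in> tangent_space A p"
  shows "g p u v = g p v u" "g p (r *\<^sub>R u) v = r * g p u v"
    "w \<in> tangent_space A p \<Longrightarrow> g p (u + w) v = g p u v + g p w v" "u \<noteq> 0 \<Longrightarrow> g p u u > 0"
  using assms by (auto simp: riemannian_metric_def)

text \<open>Evaluation at finitely many functions. It is linear on the whole function type and, for
  suitable \<open>y\<close>, injective on a given tangent space, so dimension arguments can be moved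
  to Euclidean space.\<close>

definition coord_map :: "('e \<Rightarrow> 'a \<Rightarrow> real) \<Rightarrow> 'a tangent \<Rightarrow> 'e" where
  "coord_map y v = (\<Sum>b\<in>Basis. v (y b) *\<^sub>R b)"

lemma linear_coord_map: "linear (coord_map y)"
  by (rule linearI) (simp_all add: coord_map_def scaleR_fun_apply scaleR_add_left sum.distrib scaleR_sum_right)

lemma coord_map_embedding:
  "\<exists>y. (\<forall>b. smooth_fun A (y b)) \<and> (\<forall>v\<in>tangent_space A p. coord_map y v = 0 \<longrightarrow> v = 0)"
proof -
  obtain y where y: "\<And>b::'e. smooth_fun A (y b)"
    "\<And>v. v \<in> tangent_space A p \<Longrightarrow> (\<And>b. b \<in> Basis \<Longrightarrow> v (y b) = 0) \<Longrightarrow> v = 0"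
    using tangent_coordinates by blast
  have "v = 0" if "v \<in> tangent_space A p" "coord_map y v = 0" for v
  proof (rule y(2)[OF that(1)])
    fix b :: 'e assume b: "b \<in> Basis"
    have "coord_map y v \<bullet> b = v (y b)" unfolding coord_map_def using b by (rule inner_sum_left_Basis)
    then show "v (y b) = 0" using that by simp
  qed
  then show ?thesis using y(1) by blast
qed

lemma orthonormal_subspace_basis:
  assumes g: "riemannian_metric A g" and V: "subspace V" "V \<subseteq> tangent_space A p"
  obtains E where "finite E" "E \<subseteq> V" "span E = V"
    "\<And>e e'. e \<in> E \<Longrightarrow> e' \<in> E \<Longrightarrow> g p e e' = (if e = e' then 1 else 0)"
proof -
  obtain y where y: "\<forall>v\<in>tangent_space A p. coord_map y v = 0 \<longrightarrow> v = 0"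
    using coord_map_embedding by blast
  show ?thesis
  proof (rule orthonormal_basis_exists[OF V(1) linear_coord_map[of y], of "g p"])
    show "v = 0" if "v \<in> V" "coord_map y v = 0" for v using y that V(2) by blast
    show "g p u v = g p v u" if "u \<in> V" "v \<in> V" for u v
      using metric_simps(1)[OF g] that V(2) by blast
    show "g p (u + x) v = g p u v + g p x v" if "u \<in> V" "v \<in> V" "x \<in> V" for u v x
      using metric_simps(3)[OF g] that V(2) by blast
    show "g p (r *\<^sub>R u) v = r * g p u v" if "u \<in> V" "v \<in> V" for u v r
      using metric_simps(2)[OF g] that V(2) by blast
    show "g p u u > 0" if "u \<in> V" "u \<noteq> 0" for u
      using metric_simps(4)[OF g] that V(2) by blast
  qed (rule that)
qed

end

section \<open>Left translations and the left trivialisation\<close>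

locale riem_lie_group = manifold A
  for G :: "('a::{t2_space, second_countable_topology}, 'm) monoid_scheme" (structure)
    and A :: "('a, 'e::euclidean_space) atlas" +
  fixes g :: "'a metric"
  assumes rlg: "riemannian_lie_group G A g"
begin

lemma G_group: "group G" and G_carrier: "carrier G = UNIV"
  and mult_smooth: "smooth_map (prod_atlas A A) A (\<lambda>(x, y). x \<otimes> y)"
  and inv_smooth: "smooth_map A A (m_inv G)"
  and metric: "riemannian_metric A g"
  using rlg by (auto simp: riemannian_lie_group_def connected_lie_group_def)

lemma group_simps [simp]:
  "inv a \<otimes> (a \<otimes> x) = x" "a \<otimes> (inv a \<otimes> x) = x" "\<one> \<otimes> x = x" "x \<otimes> \<one> = x" "inv a \<otimes> a = \<one>"
  "(a \<otimes> b) \<otimes> x = a \<otimes> (b \<otimes> x)"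
proof -
  interpret group G by (rule G_group)
  show "inv a \<otimes> (a \<otimes> x) = x" "a \<otimes> (inv a \<otimes> x) = x" "\<one> \<otimes> x = x" "x \<otimes> \<one> = x" "inv a \<otimes> a = \<one>"
    "(a \<otimes> b) \<otimes> x = a \<otimes> (b \<otimes> x)"
    using G_carrier by (auto simp: m_assoc[symmetric])
qed

lemma local_rep_mult:
  assumes f: "smooth_fun A f" and U: "(U, c) \<in> A" "p \<in> U" and W: "(W, d) \<in> A" "x \<in> W"
  shows "local_rep (U \<times> W) (map_prod c d) (\<lambda>(p, x). f (p \<otimes> x)) (p, x)"
proof -
  obtain W' d' where W': "(W', d') \<in> A" "p \<otimes> x \<in> W'" using chart_exists by blast
  have "(U \<times> W, map_prod c d) \<in> prod_atlas A A" using U W by (auto simp: prod_atlas_def)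
  then have s: "smooth_on (map_prod c d ` ((U \<times> W) \<inter> (\<lambda>(x, y). x \<otimes> y) -` W'))
      (d' \<circ> (\<lambda>(x, y). x \<otimes> y) \<circ> inv_into (U \<times> W) (map_prod c d))"
    and cont: "continuous_on UNIV (\<lambda>(x, y). x \<otimes> y)"
    using mult_smooth W'(1) unfolding smooth_map_def by blast+
  have "local_rep (U \<times> W) (map_prod c d) (\<lambda>z. f (case z of (x, y) \<Rightarrow> x \<otimes> y)) (p, x)"
    by (rule local_rep_compose[OF chart_at_prod[OF chart_at[OF U] chart_at[OF W]] cont
          chart_open[OF W'(1)] _ s])
      (use W'(2) smooth_funD[OF f W'] in auto)
  then show ?thesis by (simp add: case_prod_beta')
qed

lemma smooth_fun_translate:
  assumes f: "smooth_fun A f"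
  shows "smooth_fun A (\<lambda>x. f (a \<otimes> x))"
proof (rule smooth_funI_chart)
  fix W d x assume W: "(W, d) \<in> A" "x \<in> W"
  obtain U c where U: "(U, c) \<in> A" "a \<in> U" using chart_exists by blast
  show "local_rep W d (\<lambda>x. f (a \<otimes> x)) x"
    using local_rep_slice[OF local_rep_mult[OF f U W] U(2)] .
qed

text \<open>Used twice: a constant section with \<open>\<psi>\<close> the identity yields smoothness
  of left invariant fields, and \<open>\<psi> p = inv (\<phi> p)\<close> yields smoothness of
  trivialised sections.\<close>

lemma section_translate_smooth:
  assumes M: "manifold M" and \<phi>: "smooth_map M A \<phi>" and V: "section_along M A \<phi> V"
    and \<psi>: "smooth_into M A \<psi>" and f: "smooth_fun A f"
  shows "smooth_fun M (\<lambda>p. V p (\<lambda>x. f (\<psi> p \<otimes> x)))"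
proof (rule section_apply_smooth[OF M manifold_axioms \<phi> V])
  interpret M: manifold M by (rule M)
  show "smooth_fun A (\<lambda>x. f (\<psi> p \<otimes> x))" for p using smooth_fun_translate[OF f] .
  fix p
  obtain U c where U: "(U, c) \<in> M" "p \<in> U" using M.chart_exists by blast
  obtain W d where W: "(W, d) \<in> A" "\<phi> p \<in> W" using chart_exists by blast
  obtain U' c' where U': "(U', c') \<in> A" "\<psi> p \<in> U'" using chart_exists by blast
  have "local_rep (U \<times> W) (map_prod c d) (\<lambda>(q, x). f (\<psi> q \<otimes> x)) (p, \<phi> p)"
    by (rule local_rep_subst_fst[where F = "\<lambda>q x. f (q \<otimes> x)" and c' = c' and \<psi> = \<psi>,
          OF M.chart_at[OF U] _ chart_open[OF U'(1)] U'(2) _ local_rep_mult[OF f U' W]])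
      (use \<psi> U U' in \<open>auto simp: smooth_into_def\<close>)
  then show "\<exists>U c W d. (U, c) \<in> M \<and> (W, d) \<in> A \<and> p \<in> U \<and> \<phi> p \<in> W \<and>
      local_rep (U \<times> W) (map_prod c d) (\<lambda>(p, x). f (\<psi> p \<otimes> x)) (p, \<phi> p)"
    using U W by blast
qed

abbreviation "T \<equiv> tangent_space A \<one>"
abbreviation "lf \<equiv> left_invariant_field G A"

text \<open>The left trivialisation: it carries the tangent space at \<open>p\<close> to the Lie
  algebra and inverts \<open>lf\<close> there.\<close>

definition hat :: "'a \<Rightarrow> 'a tangent \<Rightarrow> 'a tangent" where
  "hat p v = differential A (\<lambda>x. inv p \<otimes> x) v"

lemma lf_apply: "smooth_fun A f \<Longrightarrow> lf u p f = u (\<lambda>x. f (p \<otimes> x))"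
  by (simp add: left_invariant_field_def differential_def o_def)

lemma lf_non_smooth: "\<not> smooth_fun A f \<Longrightarrow> lf u p f = 0"
  by (simp add: left_invariant_field_def differential_def)

lemma hat_apply: "smooth_fun A f \<Longrightarrow> hat p v f = v (\<lambda>x. f (inv p \<otimes> x))"
  by (simp add: hat_def differential_def o_def)

lemma linear_lf: "linear (\<lambda>u. lf u p)"
  unfolding left_invariant_field_def by (rule linear_differential)

lemma linear_hat: "linear (hat p)"
  using linear_differential unfolding hat_def linear_iff by blast

lemmas lf_simps = linear_add[OF linear_lf] linear_scale[OF linear_lf] linear_diff[OF linear_lf]
  linear_sum[OF linear_lf] linear_0[OF linear_lf]

lemmas hat_simps = linear_add[OF linear_hat] linear_scale[OF linear_hat] linear_diff[OF linear_hat]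
  linear_sum[OF linear_hat] linear_0[OF linear_hat]

lemma lf_tangent: "u \<in> T \<Longrightarrow> lf u p \<in> tangent_space A p"
  using differential_tangent[where \<phi> = "\<lambda>x. p \<otimes> x" and A = A and B = A and v = u and p = \<one>]
  by (simp add: left_invariant_field_def manifold_axioms smooth_fun_translate)

lemma hat_tangent: "v \<in> tangent_space A p \<Longrightarrow> hat p v \<in> T"
  using differential_tangent[where \<phi> = "\<lambda>x. inv p \<otimes> x" and A = A and B = A and v = v and p = p]
  by (simp add: hat_def manifold_axioms smooth_fun_translate)

lemma hat_lf [simp]: "u \<in> T \<Longrightarrow> hat p (lf u p) = u"
proof
  fix f assume u: "u \<in> T"
  show "hat p (lf u p) f = u f"
  proof (cases "smooth_fun A f")
    case False
    then show ?thesis using tangent_non_smooth[OF u] by (simp add: hat_def differential_def)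
  qed (simp add: hat_apply lf_apply smooth_fun_translate)
qed

lemma lf_hat [simp]: "v \<in> tangent_space A p \<Longrightarrow> lf (hat p v) p = v"
proof
  fix f assume v: "v \<in> tangent_space A p"
  show "lf (hat p v) p f = v f"
  proof (cases "smooth_fun A f")
    case False
    then show ?thesis using tangent_non_smooth[OF v] by (simp add: left_invariant_field_def differential_def)
  qed (simp add: hat_apply lf_apply smooth_fun_translate)
qed

lemma lf_one [simp]: "u \<in> T \<Longrightarrow> lf u \<one> = u"
  using tangent_non_smooth[of u \<one>] by (auto simp: left_invariant_field_def differential_def o_def fun_eq_iff)

lemma metric_lf: "u \<in> T \<Longrightarrow> v \<in> T \<Longrightarrow> g p (lf u p) (lf v p) = g \<one> u v"
  using rlg unfolding riemannian_lie_group_def left_invariant_field_def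
  by (metis group_simps(4))

lemma metric_hat: "u \<in> tangent_space A p \<Longrightarrow> v \<in> tangent_space A p \<Longrightarrow> g \<one> (hat p u) (hat p v) = g p u v"
  using metric_lf[of "hat p u" "hat p v" p] by (simp add: hat_tangent)

lemma vector_field_lf:
  assumes u: "u \<in> T"
  shows "vector_field A (lf u)"
proof (rule vector_fieldI[OF lf_tangent[OF u]])
  fix f assume f: "smooth_fun A f"
  have "smooth_fun A (\<lambda>p. u (\<lambda>x. f (p \<otimes> x)))"
    by (rule section_translate_smooth[OF manifold_axioms smooth_map_const[OF manifold_axioms manifold_axioms] _
          smooth_map_into[OF manifold_axioms manifold_axioms smooth_map_ident[OF manifold_axioms]] f])
      (use u in \<open>simp add: section_along_def smooth_fun_const\<close>)
  then show "smooth_fun A (\<lambda>p. lf u p f)" by (simp add: lf_apply f)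
qed

text \<open>By fact \<open>t\<close> in the proof, left invariant fields commute with composing
  functions with a left translation; hence so does their bracket.\<close>

lemma lie_bracket_lf:
  assumes u: "u \<in> T" and v: "v \<in> T"
  shows "lie_bracket (lf u) (lf v) p = lf (lie_alg_bracket G A u v) p"
proof
  fix f
  note U = vector_field_lf[OF u] and V = vector_field_lf[OF v]
  show "lie_bracket (lf u) (lf v) p f = lf (lie_alg_bracket G A u v) p f"
  proof (cases "smooth_fun A f")
    case True
    have t: "lf w q (\<lambda>x. f (p \<otimes> x)) = lf w (p \<otimes> q) f" for w q
      by (simp add: lf_apply True smooth_fun_translate)
    have s: "smooth_fun A (\<lambda>q. lf u q f)" "smooth_fun A (\<lambda>q. lf v q f)"
      using True vector_fieldD(2) U V by blast+
    have "lie_bracket (lf u) (lf v) \<one> (\<lambda>x. f (p \<otimes> x)) =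
        u (\<lambda>q. lf v (p \<otimes> q) f) - v (\<lambda>q. lf u (p \<otimes> q) f)"
      using u v by (simp add: lie_bracket_def t)
    also have "\<dots> = lie_bracket (lf u) (lf v) p f"
      by (simp add: lie_bracket_def lf_apply[OF s(1), of v] lf_apply[OF s(2), of u])
    finally show ?thesis by (simp add: lie_alg_bracket_def lf_apply[OF True, of "lie_bracket _ _ _"])
  next
    case False
    then show ?thesis
      using tangent_non_smooth[OF lie_bracket_tangent[OF U V] False]
      by (simp add: left_invariant_field_def differential_def)
  qed
qed

lemma lie_alg_bracket_tangent: "u \<in> T \<Longrightarrow> v \<in> T \<Longrightarrow> lie_alg_bracket G A u v \<in> T"
  unfolding lie_alg_bracket_def by (intro lie_bracket_tangent vector_field_lf)

lemma lie_alg_bracket_anti: "lie_alg_bracket G A u v = - lie_alg_bracket G A v u"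
  by (simp add: lie_alg_bracket_def lie_bracket_def fun_eq_iff)

lemma lie_alg_bracket_linear:
  assumes "u \<in> T" "v \<in> T" "w \<in> T"
  shows "lie_alg_bracket G A (u + v) w = lie_alg_bracket G A u w + lie_alg_bracket G A v w"
    and "lie_alg_bracket G A (r *\<^sub>R u) w = r *\<^sub>R lie_alg_bracket G A u w"
proof -
  have T: "u + v \<in> T" "r *\<^sub>R u \<in> T" using assms subspace_tangent_space by (auto simp: subspace_add subspace_scale)
  have s: "smooth_fun A (\<lambda>q. lf x q f)" if "smooth_fun A f" "x \<in> T" for f x
    using vector_fieldD(2)[OF vector_field_lf[OF that(2)] that(1)] .
  show "lie_alg_bracket G A (u + v) w = lie_alg_bracket G A u w + lie_alg_bracket G A v w"
  proof
    fix f show "lie_alg_bracket G A (u + v) w f = (lie_alg_bracket G A u w + lie_alg_bracket G A v w) f"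
      by (cases "smooth_fun A f")
        (use assms T in \<open>auto simp: lie_alg_bracket_def lie_bracket_def lf_simps tangent_add[OF assms(3)] s
          lf_non_smooth tangent_const[OF assms(3)]\<close>)
  qed
  show "lie_alg_bracket G A (r *\<^sub>R u) w = r *\<^sub>R lie_alg_bracket G A u w"
  proof
    fix f show "lie_alg_bracket G A (r *\<^sub>R u) w f = (r *\<^sub>R lie_alg_bracket G A u w) f"
      by (cases "smooth_fun A f")
        (use assms T in \<open>auto simp: lie_alg_bracket_def lie_bracket_def lf_simps tangent_cmult[OF assms(3)] s
          scaleR_fun_apply algebra_simps lf_non_smooth tangent_const[OF assms(3)]\<close>)
  qed
qed

lemma lie_alg_bracket_jacobi:
  assumes "u \<in> T" "v \<in> T" "w \<in> T"
  shows "lie_alg_bracket G A u (lie_alg_bracket G A v w) =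
    lie_alg_bracket G A (lie_alg_bracket G A u v) w + lie_alg_bracket G A v (lie_alg_bracket G A u w)"
proof -
  have l: "lf (lie_alg_bracket G A x y) = lie_bracket (lf x) (lf y)" if "x \<in> T" "y \<in> T" for x y
    using lie_bracket_lf[OF that] by (simp add: fun_eq_iff)
  show ?thesis
    using lie_bracket_jacobi[OF assms[THEN vector_field_lf], of \<one>] l assms
    by (simp add: lie_alg_bracket_def[of G A u "lie_alg_bracket G A v w"]
        lie_alg_bracket_def[of G A "lie_alg_bracket G A u v" w] lie_alg_bracket_def[of G A v "lie_alg_bracket G A u w"])
qed

end

section \<open>An orthonormal basis of the Lie algebra and total operations on it\<close>

locale riem_lie_group_onb = riem_lie_group G A g
  for G :: "('a::{t2_space, second_countable_topology}, 'm) monoid_scheme" (structure)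
    and A :: "('a, 'e::euclidean_space) atlas" and g +
  fixes E :: "'a tangent set"
  assumes E_finite: "finite E" and E_span: "span E = T"
    and E_orth: "e \<in> E \<Longrightarrow> e' \<in> E \<Longrightarrow> g \<one> e e' = (if e = e' then 1 else 0)"
begin

lemma E_T: "e \<in> E \<Longrightarrow> e \<in> T"
  using E_span span_base by blast

lemma metric_sum: "v \<in> T \<Longrightarrow> g \<one> (\<Sum>e\<in>E. a e *\<^sub>R e) v = (\<Sum>e\<in>E. a e * g \<one> e v)"
  by (rule form_sum[where s = "g \<one>", OF subspace_tangent_space])
    (use metric_simps(2,3)[OF metric] E_finite E_T in auto)

lemma E_independent: "independent E"
  by (rule form_independent[where s = "g \<one>", OF subspace_tangent_space])
    (use metric_simps(2,3)[OF metric] E_finite E_T E_orth in auto)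

text \<open>The coordinates of \<open>v \<in> T\<close> are the values \<open>v (dual e)\<close>. As evaluations they are linear on the whole
  function type, which makes \<open>proj\<close>, \<open>ip\<close> and \<open>br\<close> below total linear and bilinear maps.\<close>

definition dual :: "'a tangent \<Rightarrow> 'a \<Rightarrow> real" where
  "dual e = (SOME y. smooth_fun A y \<and> (\<forall>e'\<in>E. e' y = (if e' = e then 1 else 0)))"

lemma dual: "smooth_fun A (dual e)" "e' \<in> E \<Longrightarrow> e' (dual e) = (if e' = e then 1 else 0)"
proof -
  obtain y where y: "\<forall>b. smooth_fun A (y b)" "\<forall>v\<in>T. coord_map y v = 0 \<longrightarrow> v = 0"
    using coord_map_embedding[of "\<one>"] by blast
  let ?w = "coord_map y"
  have inj: "inj_on ?w (span E)"
    unfolding linear_inj_on_iff_eq_0[OF linear_coord_map subspace_span] unfolding E_span by (rule y(2))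
  then have ind: "independent (?w ` E)"
    by (rule linear_independent_injective_image[OF linear_coord_map E_independent])
  \<comment> \<open>The embedded basis is independent, so a linear functional takes the value 1 on
    the image of \<open>e\<close> and 0 on the images of the other basis vectors. Combining the
    coordinate functions with the coefficients of \<open>l\<close> gives the dual function.\<close>
  obtain l :: "'e \<Rightarrow> real" where l: "linear l" "\<forall>x\<in>?w ` E. l x = (if x = ?w e then 1 else 0)"
    using linear_independent_extend[OF ind, of "\<lambda>x. if x = ?w e then 1 else 0"] by blast
  let ?y = "\<lambda>x. \<Sum>b\<in>Basis. l b * y b x"
  have s: "smooth_fun A (\<lambda>x. l b * y b x)" for b using y(1) by (intro smooth_fun_mult smooth_fun_const) blast
  have "e' ?y = (if e' = e then 1 else 0)" if e': "e' \<in> E" and "e \<in> E" for e'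
  proof -
    have "e' ?y = (\<Sum>b\<in>Basis. l b * e' (y b))"
      using tangent_sum[OF E_T[OF e'] s] tangent_cmult[OF E_T[OF e']] y(1) by simp
    also have "\<dots> = l (?w e')"
      unfolding coord_map_def using l(1) by (simp add: linear_sum linear_scale mult.commute)
    also have "\<dots> = (if ?w e' = ?w e then 1 else 0)" using l(2) e' by blast
    also have "?w e' = ?w e \<longleftrightarrow> e' = e"
      by (rule inj_on_eq_iff[OF inj span_base[OF e'] span_base[OF that(2)]])
    finally show ?thesis .
  qed
  moreover have "smooth_fun A ?y" by (rule smooth_fun_sum) (rule s)
  \<comment> \<open>For \<open>e\<close> outside \<open>E\<close> the zero function qualifies, which
    makes \<open>dual e\<close> smooth for every \<open>e\<close>.\<close>
  moreover have "e' (\<lambda>_. 0) = (if e' = e then 1 else 0)" if "e' \<in> E" "e \<notin> E" for e'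
    using that tangent_const[OF E_T[OF that(1)]] by auto
  ultimately have "\<exists>y. smooth_fun A y \<and> (\<forall>e'\<in>E. e' y = (if e' = e then 1 else 0))"
    using smooth_fun_const by (cases "e \<in> E") blast+
  from someI_ex[OF this] have *: "smooth_fun A (dual e) \<and> (\<forall>e'\<in>E. e' (dual e) = (if e' = e then 1 else 0))"
    unfolding dual_def .
  show "smooth_fun A (dual e)" using * by (rule conjunct1)
  show "e' (dual e) = (if e' = e then 1 else 0)" if "e' \<in> E"
    using * that by blast
qed

definition proj :: "'a tangent \<Rightarrow> 'a tangent" where
  "proj v = (\<Sum>e\<in>E. v (dual e) *\<^sub>R e)"

lemma linear_proj: "linear proj"
  by (rule linearI) (simp_all add: proj_def scaleR_fun_apply scaleR_add_left sum.distrib scaleR_sum_right)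

lemma proj_T: "proj v \<in> T"
  unfolding E_span[symmetric] proj_def by (intro span_sum span_scale span_base)

lemma proj_id [simp]: "v \<in> T \<Longrightarrow> proj v = v"
proof -
  have "proj e = e" if "e \<in> E" for e
  proof -
    have "proj e = (\<Sum>e'\<in>E. if e' = e then e else 0)"
      unfolding proj_def using that by (intro sum.cong) (auto simp: dual(2))
    then show ?thesis using that E_finite by simp
  qed
  moreover assume "v \<in> T"
  ultimately show "proj v = v"
    using linear_eq_on_span[OF linear_proj linear_ident, of E v] E_span by auto
qed

lemma T_expansion: "v \<in> T \<Longrightarrow> v = (\<Sum>e\<in>E. v (dual e) *\<^sub>R e)"
  using proj_id[of v] by (simp add: proj_def)

definition ip :: "'a tangent \<Rightarrow> 'a tangent \<Rightarrow> real" where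
  "ip u v = (\<Sum>e\<in>E. u (dual e) * v (dual e))"

definition br :: "'a tangent \<Rightarrow> 'a tangent \<Rightarrow> 'a tangent" where
  "br u v = lie_alg_bracket G A (proj u) (proj v)"

lemma ip_E: "e \<in> E \<Longrightarrow> ip v e = v (dual e)"
proof -
  assume e: "e \<in> E"
  have "ip v e = (\<Sum>e'\<in>E. if e' = e then v (dual e') else 0)"
    unfolding ip_def using e by (intro sum.cong) (auto simp: dual)
  then show ?thesis using e E_finite by simp
qed

lemma br_eq: "u \<in> T \<Longrightarrow> v \<in> T \<Longrightarrow> br u v = lie_alg_bracket G A u v"
  by (simp add: br_def)

lemma ip_eq: "u \<in> T \<Longrightarrow> v \<in> T \<Longrightarrow> ip u v = g \<one> u v"
proof -
  assume u: "u \<in> T" and v: "v \<in> T"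
  have e: "g \<one> e v = v (dual e)" if e: "e \<in> E" for e
  proof -
    have "g \<one> e v = g \<one> v e" using metric_simps(1)[OF metric E_T[OF e] v] .
    also have "\<dots> = (\<Sum>e'\<in>E. v (dual e') * g \<one> e' e)"
      by (subst T_expansion[OF v]) (rule metric_sum[OF E_T[OF e]])
    also have "\<dots> = (\<Sum>e'\<in>E. if e' = e then v (dual e') else 0)"
      using e by (intro sum.cong) (auto simp: E_orth)
    finally show ?thesis using e E_finite by simp
  qed
  have "g \<one> u v = (\<Sum>e\<in>E. u (dual e) * g \<one> e v)"
    by (subst T_expansion[OF u]) (rule metric_sum[OF v])
  then show "ip u v = g \<one> u v" by (simp add: ip_def e)
qed

lemma bilinear_br: "bilinear br"
proof -
  have 1: "br (u + v) w = br u w + br v w" "br (r *\<^sub>R u) w = r *\<^sub>R br u w" for u v w r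
    unfolding br_def linear_add[OF linear_proj] linear_scale[OF linear_proj]
    by (rule lie_alg_bracket_linear[OF proj_T proj_T proj_T])+
  have a: "br u v = - br v u" for u v unfolding br_def by (rule lie_alg_bracket_anti)
  have 2: "br w (u + v) = br w u + br w v" "br w (r *\<^sub>R u) = r *\<^sub>R br w u" for u v w r
    using 1(1)[of u v w] 1(2)[of r u w] a[of w] by simp_all
  show ?thesis unfolding bilinear_def using 1 2 by (auto intro!: linearI)
qed

sublocale euclid_lie ip E br
proof
  show "bilinear ip"
    unfolding bilinear_def ip_def
    by (auto intro!: linearI simp: scaleR_fun_apply sum.distrib sum_distrib_left algebra_simps)
  show "ip u v = ip v u" for u v by (simp add: ip_def mult.commute)
  show "finite E" by (rule E_finite)
  show "ip e e' = (if e = e' then 1 else 0)" if "e \<in> E" "e' \<in> E" for e e'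
    using that by (simp add: ip_E dual)
  show "ip u v = (\<Sum>e\<in>E. ip u e * ip e v)" for u v
  proof -
    have "ip e v = v (dual e)" if "e \<in> E" for e using ip_E[OF that, of v] by (simp add: ip_def mult.commute)
    then show ?thesis by (simp add: ip_E) (simp add: ip_def)
  qed
  show "bilinear br" by (rule bilinear_br)
  show span: "br u v \<in> span E" for u v
    unfolding br_def E_span by (intro lie_alg_bracket_tangent proj_T)
  show "br u v = - br v u" for u v unfolding br_def by (rule lie_alg_bracket_anti)
  show "br u (br v w) = br (br u v) w + br v (br u w)" for u v w
  proof -
    have p: "proj (br x y) = lie_alg_bracket G A (proj x) (proj y)" for x y
      using span[of x y] by (simp add: E_span) (simp add: br_def)
    have "lie_alg_bracket G A (proj u) (proj (br v w)) =
        lie_alg_bracket G A (proj (br u v)) (proj w) + lie_alg_bracket G A (proj v) (proj (br u w))"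
      unfolding p by (rule lie_alg_bracket_jacobi[OF proj_T proj_T proj_T])
    then show ?thesis by (simp only: br_def[of u "br v w"] br_def[of "br u v" w] br_def[of v "br u w"])
  qed
  show "br u v = (\<Sum>e\<in>E. ip u e *\<^sub>R br e v)" for u v
  proof -
    have "br u v = br (\<Sum>e\<in>E. u (dual e) *\<^sub>R e) v"
      unfolding br_def proj_def[symmetric] by (simp add: proj_T)
    also have "\<dots> = (\<Sum>e\<in>E. u (dual e) *\<^sub>R br e v)"
      using bilinear_br by (simp add: bilinear_def linear_sum[of "\<lambda>u. br u v"] linear_scale[of "\<lambda>u. br u v"])
    finally show ?thesis by (simp add: ip_E)
  qed
qed

lemma nab_T: "nab u v \<in> T" and curv_T: "curv u v w \<in> T"
  using nab_span E_span by (auto simp: curv_def subspace_diff[OF subspace_tangent_space])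

end


section \<open>Connections in a left invariant frame\<close>

lemma differential_section:
  assumes M: "manifold M" and A: "manifold A" and \<phi>: "smooth_map M A \<phi>" and X: "vector_field M X"
  shows "section_along M A \<phi> (\<lambda>p. differential A \<phi> (X p))"
proof -
  note s = smooth_fun_compose[OF M A \<phi>]
  show ?thesis
    unfolding section_along_def
  proof (intro conjI allI impI)
    show "differential A \<phi> (X p) \<in> tangent_space A (\<phi> p)" for p
      by (rule differential_tangent[OF M s A manifold.vector_fieldD(1)[OF M X]])
    show "smooth_fun M (\<lambda>p. differential A \<phi> (X p) f)" if "smooth_fun A f" for f
      using manifold.vector_fieldD(2)[OF M X s[OF that]] that by (simp add: differential_def o_def)
  qed
qed

lemma (in manifold) differential_ident: "v \<in> tangent_space A p \<Longrightarrow> differential A (\<lambda>x. x) v = v"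
  using tangent_non_smooth[of v p] by (auto simp: differential_def o_def fun_eq_iff)

text \<open>Leibniz rule for a combination of sections. With the left invariant frame as
  \<open>W\<close> it determines a connection from its values on the frame.\<close>

lemma connection_along_sum:
  fixes M :: "('a::{t2_space, second_countable_topology}, 'e::euclidean_space) atlas"
    and B :: "('b::{t2_space, second_countable_topology}, 'f::euclidean_space) atlas"
  assumes D: "connection_along M B \<phi> D" and M: "manifold M" and B: "manifold B" and X: "vector_field M X"
    and W: "\<And>i. i \<in> I \<Longrightarrow> section_along M B \<phi> (W i)" and f: "\<And>i. i \<in> I \<Longrightarrow> smooth_fun M (f i)"
    and I: "finite I"
  shows "section_along M B \<phi> (\<lambda>p. \<Sum>i\<in>I. f i p *\<^sub>R W i p) \<and>
    D X (\<lambda>p. \<Sum>i\<in>I. f i p *\<^sub>R W i p) = (\<lambda>p. \<Sum>i\<in>I. X p (f i) *\<^sub>R W i p + f i p *\<^sub>R D X (W i) p)"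
  using I W f
proof (induction I)
  interpret M: manifold M by (rule M)
  interpret B: manifold B by (rule B)
  case empty
  have z: "section_along M B \<phi> (\<lambda>p. 0)"
    by (simp add: section_along_def subspace_0[OF B.subspace_tangent_space] M.smooth_fun_const)
  \<comment> \<open>The zero section is written as zero times itself, so that the Leibniz clause of
    \<open>connection_along\<close> gives its derivative.\<close>
  have "D X (\<lambda>p. 0 *\<^sub>R (0 :: 'b tangent)) = (\<lambda>p. X p (\<lambda>_. 0) *\<^sub>R 0 + 0 *\<^sub>R D X (\<lambda>p. 0) p)"
    using D X z M.smooth_fun_const[of 0] unfolding connection_along_def by blast
  then have "D X (\<lambda>p. 0) = (\<lambda>p. 0)" by simp
  with z have "section_along M B \<phi> (\<lambda>p. \<Sum>i\<in>{}. f i p *\<^sub>R W i p) \<and>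
    D X (\<lambda>p. \<Sum>i\<in>{}. f i p *\<^sub>R W i p) = (\<lambda>p. \<Sum>i\<in>{}. X p (f i) *\<^sub>R W i p + f i p *\<^sub>R D X (W i) p)"
    unfolding sum.empty by (rule conjI)
  then show ?case .
next
  case (insert i I)
  interpret M: manifold M by (rule M)
  interpret B: manifold B by (rule B)
  let ?V = "\<lambda>p. \<Sum>i\<in>I. f i p *\<^sub>R W i p" and ?U = "\<lambda>p. f i p *\<^sub>R W i p"
  have IH: "section_along M B \<phi> ?V \<and>
      D X ?V = (\<lambda>p. \<Sum>i\<in>I. X p (f i) *\<^sub>R W i p + f i p *\<^sub>R D X (W i) p)"
    by (rule insert.IH) (use insert.prems in blast)+
  note V = IH[THEN conjunct1] and DV = IH[THEN conjunct2]
  have W: "section_along M B \<phi> (W i)" and f: "smooth_fun M (f i)" using insert.prems by auto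
  have U: "section_along M B \<phi> ?U"
    using W f B.subspace_tangent_space
    by (auto simp: section_along_def subspace_scale scaleR_fun_apply M.smooth_fun_mult)
  have "section_along M B \<phi> (\<lambda>p. ?U p + ?V p)"
    using U V B.subspace_tangent_space
    by (auto simp: section_along_def subspace_add M.smooth_fun_add)
  moreover have "D X (\<lambda>p. ?U p + ?V p) = (\<lambda>p. D X ?U p + D X ?V p)"
    using D X U V unfolding connection_along_def by blast
  moreover have "D X ?U = (\<lambda>p. X p (f i) *\<^sub>R W i p + f i p *\<^sub>R D X (W i) p)"
    using D X W f unfolding connection_along_def by blast
  ultimately have "section_along M B \<phi> (\<lambda>p. \<Sum>i\<in>insert i I. f i p *\<^sub>R W i p) \<and>
    D X (\<lambda>p. \<Sum>i\<in>insert i I. f i p *\<^sub>R W i p) =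
      (\<lambda>p. \<Sum>i\<in>insert i I. X p (f i) *\<^sub>R W i p + f i p *\<^sub>R D X (W i) p)"
    unfolding sum.insert[OF insert.hyps] DV by simp
  then show ?case .
qed

text \<open>The usual combination of three instances of metric compatibility, simplified by torsion
  freeness. The right side does not mention \<open>D\<close>, which yields uniqueness.\<close>

lemma levi_civita_koszul:
  assumes A: "manifold A" and g: "riemannian_metric A g" and D: "is_levi_civita A g D"
    and X: "vector_field A X" and Y: "vector_field A Y" and Z: "vector_field A Z"
  shows "2 * g p (D X Y p) (Z p) =
    X p (\<lambda>q. g q (Y q) (Z q)) + Y p (\<lambda>q. g q (X q) (Z q)) - Z p (\<lambda>q. g q (X q) (Y q))
    + g p (lie_bracket X Y p) (Z p) - g p (lie_bracket X Z p) (Y p) - g p (lie_bracket Y Z p) (X p)"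
proof -
  interpret manifold A by (rule A)
  have DT: "D U V p \<in> tangent_space A p" if "vector_field A U" "vector_field A V" for U V
    using D that vector_fieldD(1)
    unfolding is_levi_civita_def connection_along_def vector_field_def by metis
  have m: "U p (\<lambda>q. g q (V q) (W q)) = g p (D U V p) (W p) + g p (V p) (D U W p)"
    if "vector_field A U" "vector_field A V" "vector_field A W" for U V W
    using D that unfolding is_levi_civita_def by blast
  have t: "g p (D V U p) (W p) = g p (D U V p) (W p) - g p (lie_bracket U V p) (W p)"
    if "vector_field A U" "vector_field A V" "vector_field A W" for U V W
  proof -
    have "D U V p - D V U p = lie_bracket U V p"
      using D that unfolding is_levi_civita_def by blast
    then have eq: "D U V p = lie_bracket U V p + D V U p" by (rule diff_eq_eq[THEN iffD1])
    have "g p (lie_bracket U V p + D V U p) (W p) = g p (lie_bracket U V p) (W p) + g p (D V U p) (W p)"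
      by (rule metric_simps(3)[OF g lie_bracket_tangent[OF that(1,2)] vector_fieldD(1)[OF that(3)] DT[OF that(2,1)]])
    then show ?thesis unfolding eq by simp
  qed
  have s: "g p (V p) (D U W p) = g p (D U W p) (V p)"
    if "vector_field A U" "vector_field A V" "vector_field A W" for U V W
    by (rule metric_simps(1)[OF g vector_fieldD(1)[OF that(2)] DT[OF that(1,3)]])
  show ?thesis
    using m[OF X Y Z] m[OF Y X Z] m[OF Z X Y] t[OF X Y Z] t[OF X Z Y] t[OF Y Z X]
      s[OF X Y Z] s[OF Y X Z] s[OF Z X Y] by simp
qed

context riem_lie_group_onb begin

text \<open>The flat derivative of a Lie algebra valued function, taken component by component
  because \<open>v\<close> differentiates real functions only.\<close>

definition dv :: "'c tangent \<Rightarrow> ('c \<Rightarrow> 'a tangent) \<Rightarrow> 'a tangent" where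
  "dv v f = (\<Sum>e\<in>E. v (\<lambda>q. f q (dual e)) *\<^sub>R e)"

definition smooth_T :: "('c::topological_space, 'd::real_normed_vector) atlas \<Rightarrow> ('c \<Rightarrow> 'a tangent) \<Rightarrow> bool" where
  "smooth_T M f \<longleftrightarrow> (\<forall>p. f p \<in> T) \<and> (\<forall>e\<in>E. smooth_fun M (\<lambda>p. f p (dual e)))"

lemma smooth_TD: "smooth_T M f \<Longrightarrow> f p \<in> T" "smooth_T M f \<Longrightarrow> e \<in> E \<Longrightarrow> smooth_fun M (\<lambda>p. f p (dual e))"
  by (auto simp: smooth_T_def)

lemma sum_E_dual: "e \<in> E \<Longrightarrow> (\<Sum>e'\<in>E. a e' *\<^sub>R e') (dual e) = a e"
proof -
  assume e: "e \<in> E"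
  have "(\<Sum>e'\<in>E. a e' *\<^sub>R e') (dual e) = (\<Sum>e'\<in>E. if e' = e then a e' else 0)"
    unfolding sum_fun_apply using e by (intro sum.cong) (auto simp: dual scaleR_fun_apply)
  then show ?thesis using e E_finite by simp
qed

lemma sum_E_T: "(\<Sum>e\<in>E. a e *\<^sub>R e) \<in> T"
  unfolding E_span[symmetric] by (intro span_sum span_scale span_base)

lemma dv_T: "dv v f \<in> T"
  unfolding dv_def by (rule sum_E_T)

lemma dv_dual: "e \<in> E \<Longrightarrow> dv v f (dual e) = v (\<lambda>q. f q (dual e))"
  unfolding dv_def by (rule sum_E_dual)

lemma T_eqI: "u \<in> T \<Longrightarrow> v \<in> T \<Longrightarrow> (\<And>e. e \<in> E \<Longrightarrow> u (dual e) = v (dual e)) \<Longrightarrow> u = v"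
proof -
  assume u: "u \<in> T" and v: "v \<in> T" and eq: "\<And>e. e \<in> E \<Longrightarrow> u (dual e) = v (dual e)"
  have "(\<Sum>e\<in>E. u (dual e) *\<^sub>R e) = (\<Sum>e\<in>E. v (dual e) *\<^sub>R e)"
    using eq by (intro sum.cong) simp_all
  then show "u = v" using T_expansion[OF u] T_expansion[OF v] by argo
qed

lemmas T_closed = subspace_add[OF subspace_tangent_space] subspace_scale[OF subspace_tangent_space]
  subspace_diff[OF subspace_tangent_space] subspace_0[OF subspace_tangent_space]

lemma linear_T_expansion: "linear L \<Longrightarrow> u \<in> T \<Longrightarrow> L u = (\<Sum>e\<in>E. u (dual e) *\<^sub>R L e)"
  using linear_expansion[of L u] by (simp add: E_span ip_E)

lemma bilinear_T_expansion:
  assumes \<beta>: "bilinear \<beta>" and u: "u \<in> T" and w: "w \<in> T"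
  shows "\<beta> u w = (\<Sum>e\<in>E. \<Sum>e'\<in>E. (u (dual e) * w (dual e')) *\<^sub>R \<beta> e e')"
proof -
  have "\<beta> u w = (\<Sum>e\<in>E. u (dual e) *\<^sub>R \<beta> e w)"
    using \<beta> linear_T_expansion[OF _ u, of "\<lambda>u. \<beta> u w"] by (simp add: bilinear_def)
  also have "\<dots> = (\<Sum>e\<in>E. u (dual e) *\<^sub>R (\<Sum>e'\<in>E. w (dual e') *\<^sub>R \<beta> e e'))"
    using \<beta> linear_T_expansion[OF _ w, of "\<beta> e" for e] by (simp add: bilinear_def)
  finally show ?thesis by (simp add: scaleR_sum_right)
qed

lemma dv_add_left: "dv (u + v) f = dv u f + dv v f"
  by (simp add: dv_def scaleR_add_left sum.distrib)

lemma dv_scale_left: "dv (r *\<^sub>R v) f = r *\<^sub>R dv v f"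
  by (simp add: dv_def scaleR_fun_apply scaleR_sum_right)

lemma dv_sum_lf: "lf (\<Sum>e\<in>E. a e *\<^sub>R e) p k = (\<Sum>e\<in>E. a e * lf e p k)"
  by (simp add: lf_simps sum_fun_apply scaleR_fun_apply)

lemma lf_T_apply: "u \<in> T \<Longrightarrow> lf u p k = (\<Sum>e\<in>E. u (dual e) * lf e p k)"
  by (subst T_expansion, assumption) (rule dv_sum_lf)

context
  fixes M :: "('c::{t2_space, second_countable_topology}, 'd::euclidean_space) atlas"
  assumes M: "manifold M"
begin

interpretation M: manifold M by (rule M)

lemma smooth_T_const: "u \<in> T \<Longrightarrow> smooth_T M (\<lambda>_. u)"
  by (simp add: smooth_T_def M.smooth_fun_const)

lemma smooth_T_add: "smooth_T M f \<Longrightarrow> smooth_T M k \<Longrightarrow> smooth_T M (\<lambda>p. f p + k p)"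
  by (simp add: smooth_T_def M.smooth_fun_add T_closed)

lemma smooth_T_dv: "vector_field M X \<Longrightarrow> smooth_T M f \<Longrightarrow> smooth_T M (\<lambda>p. dv (X p) f)"
  by (simp add: smooth_T_def dv_T dv_dual M.vector_fieldD(2))

lemma smooth_T_bilinear:
  assumes \<beta>: "bilinear \<beta>" "\<And>u w. \<beta> u w \<in> T" and f: "smooth_T M f" and k: "smooth_T M k"
  shows "smooth_T M (\<lambda>p. \<beta> (f p) (k p))"
proof -
  have "smooth_fun M (\<lambda>p. \<beta> (f p) (k p) (dual e))" if "e \<in> E" for e
    unfolding bilinear_T_expansion[OF \<beta>(1) smooth_TD(1)[OF f] smooth_TD(1)[OF k]] sum_fun_apply scaleR_fun_apply
      real_scaleR_def
    by (intro M.smooth_fun_sum M.smooth_fun_mult M.smooth_fun_const smooth_TD(2)[OF f] smooth_TD(2)[OF k])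
  then show ?thesis using \<beta>(2) by (simp add: smooth_T_def)
qed

lemma dv_const: "v \<in> tangent_space M p \<Longrightarrow> dv v (\<lambda>_. u) = 0"
  by (simp add: dv_def M.tangent_const)

lemma dv_add:
  assumes "v \<in> tangent_space M p" "smooth_T M f" "smooth_T M k"
  shows "dv v (\<lambda>q. f q + k q) = dv v f + dv v k"
  unfolding dv_def using M.tangent_add[OF assms(1)] smooth_TD(2)[OF assms(2)] smooth_TD(2)[OF assms(3)]
  by (simp add: scaleR_add_left sum.distrib)

lemma dv_scale:
  assumes v: "v \<in> tangent_space M p" and f: "smooth_T M f" and k: "smooth_fun M k"
  shows "dv v (\<lambda>q. k q *\<^sub>R f q) = v k *\<^sub>R f p + k p *\<^sub>R dv v f"
proof (rule T_eqI)
  fix e assume e: "e \<in> E"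
  show "dv v (\<lambda>q. k q *\<^sub>R f q) (dual e) = (v k *\<^sub>R f p + k p *\<^sub>R dv v f) (dual e)"
    using M.tangent_mult[OF v k smooth_TD(2)[OF f e]] e
    by (simp add: dv_dual scaleR_fun_apply)
qed (intro dv_T T_closed smooth_TD(1)[OF f])+

text \<open>In the basis \<open>E\<close> a bilinear map has the constant coefficients
  \<open>\<beta> e e' (dual i)\<close>, so this is the Leibniz rule for the products of
  components.\<close>

lemma dv_bilinear:
  assumes v: "v \<in> tangent_space M p" and \<beta>: "bilinear \<beta>" "\<And>u w. \<beta> u w \<in> T"
    and f: "smooth_T M f" and k: "smooth_T M k"
  shows "dv v (\<lambda>q. \<beta> (f q) (k q)) = \<beta> (dv v f) (k p) + \<beta> (f p) (dv v k)"
proof (rule T_eqI)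
  fix i assume i: "i \<in> E"
  note fs = smooth_TD(2)[OF f] and ks = smooth_TD(2)[OF k]
  note fT = smooth_TD(1)[OF f] and kT = smooth_TD(1)[OF k]
  have x: "\<beta> a b (dual i) = (\<Sum>e\<in>E. \<Sum>e'\<in>E. (a (dual e) * b (dual e')) * \<beta> e e' (dual i))"
    if "a \<in> T" "b \<in> T" for a b
    by (subst bilinear_T_expansion[OF \<beta>(1) that]) (simp add: sum_fun_apply scaleR_fun_apply)
  have s: "smooth_fun M (\<lambda>q. (f q (dual e) * k q (dual e')) * \<beta> e e' (dual i))"
    if "e \<in> E" "e' \<in> E" for e e'
    using that by (intro M.smooth_fun_mult fs ks M.smooth_fun_const)
  have d: "v (\<lambda>q. (f q (dual e) * k q (dual e')) * \<beta> e e' (dual i)) =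
      (dv v f (dual e) * k p (dual e')) * \<beta> e e' (dual i) + (f p (dual e) * dv v k (dual e')) * \<beta> e e' (dual i)"
    if "e \<in> E" "e' \<in> E" for e e'
    using that M.tangent_mult[OF v M.smooth_fun_mult[OF fs ks] M.smooth_fun_const, of e e' "\<beta> e e' (dual i)"]
      M.tangent_mult[OF v fs ks, of e e'] M.tangent_const[OF v]
    by (simp add: dv_dual algebra_simps)
  have "dv v (\<lambda>q. \<beta> (f q) (k q)) (dual i) =
      v (\<lambda>q. \<Sum>e\<in>E. \<Sum>e'\<in>E. (f q (dual e) * k q (dual e')) * \<beta> e e' (dual i))"
    unfolding dv_dual[OF i] x[OF fT kT] ..
  also have "\<dots> = (\<Sum>e\<in>E. v (\<lambda>q. \<Sum>e'\<in>E. (f q (dual e) * k q (dual e')) * \<beta> e e' (dual i)))"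
    by (rule M.tangent_sum[OF v]) (intro M.smooth_fun_sum s)
  also have "\<dots> = (\<Sum>e\<in>E. \<Sum>e'\<in>E. v (\<lambda>q. (f q (dual e) * k q (dual e')) * \<beta> e e' (dual i)))"
    by (intro sum.cong refl M.tangent_sum[OF v] s)
  also have "\<dots> = (\<Sum>e\<in>E. \<Sum>e'\<in>E. (dv v f (dual e) * k p (dual e')) * \<beta> e e' (dual i)
      + (f p (dual e) * dv v k (dual e')) * \<beta> e e' (dual i))"
    by (intro sum.cong refl d)
  also have "\<dots> = (\<beta> (dv v f) (k p) + \<beta> (f p) (dv v k)) (dual i)"
    by (simp add: x[OF dv_T kT] x[OF fT dv_T] sum.distrib)
  finally show "dv v (\<lambda>q. \<beta> (f q) (k q)) (dual i) = (\<beta> (dv v f) (k p) + \<beta> (f p) (dv v k)) (dual i)" .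
qed (intro dv_T T_closed \<beta>)+

lemma tangent_ip:
  assumes v: "v \<in> tangent_space M p" and f: "smooth_T M f" and k: "smooth_T M k"
  shows "v (\<lambda>q. ip (f q) (k q)) = ip (dv v f) (k p) + ip (f p) (dv v k)"
proof -
  have "v (\<lambda>q. ip (f q) (k q)) = (\<Sum>e\<in>E. v (\<lambda>q. f q (dual e) * k q (dual e)))"
    unfolding ip_def
    by (rule M.tangent_sum[OF v]) (intro M.smooth_fun_mult smooth_TD(2)[OF f] smooth_TD(2)[OF k])
  also have "\<dots> = (\<Sum>e\<in>E. dv v f (dual e) * k p (dual e) + f p (dual e) * dv v k (dual e))"
    using M.tangent_mult[OF v smooth_TD(2)[OF f] smooth_TD(2)[OF k]] by (intro sum.cong) (auto simp: dv_dual)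
  finally show ?thesis by (simp add: ip_def sum.distrib)
qed

lemma section_lf:
  assumes \<phi>: "smooth_map M A \<phi>" and f: "smooth_T M f"
  shows "section_along M A \<phi> (\<lambda>p. lf (f p) (\<phi> p))"
  unfolding section_along_def
proof (intro conjI allI impI)
  show "lf (f p) (\<phi> p) \<in> tangent_space A (\<phi> p)" for p
    by (rule lf_tangent[OF smooth_TD(1)[OF f]])
  fix k assume k: "smooth_fun A k"
  have "smooth_fun M (\<lambda>p. lf e (\<phi> p) k)" if "e \<in> E" for e
    by (rule smooth_fun_compose[OF M manifold_axioms \<phi> vector_fieldD(2)[OF vector_field_lf[OF E_T[OF that]] k]])
  then show "smooth_fun M (\<lambda>p. lf (f p) (\<phi> p) k)"
    unfolding lf_T_apply[OF smooth_TD(1)[OF f]]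
    by (intro M.smooth_fun_sum M.smooth_fun_mult smooth_TD(2)[OF f])
qed

text \<open>The components are \<open>V p\<close> applied to \<open>dual e\<close> after translation
  by the inverse of \<open>\<phi> p\<close>; smoothness follows from
  \<open>section_translate_smooth\<close> with inversion after \<open>\<phi>\<close>.\<close>

lemma section_hat:
  assumes \<phi>: "smooth_map M A \<phi>" and V: "section_along M A \<phi> V"
  shows "smooth_T M (\<lambda>p. hat (\<phi> p) (V p))"
  unfolding smooth_T_def
proof (intro conjI allI ballI)
  show "hat (\<phi> p) (V p) \<in> T" for p using V by (simp add: section_along_def hat_tangent)
  have \<psi>: "smooth_into M A (\<lambda>p. inv (\<phi> p))"
    unfolding smooth_into_def
  proof (intro conjI allI impI)
    show "continuous_on UNIV (\<lambda>p. inv (\<phi> p))"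
      using \<phi> inv_smooth unfolding smooth_map_def by (auto intro: continuous_on_compose2)
    fix U c W d p assume U: "(U, c) \<in> M" "p \<in> U" and W: "(W, d) \<in> A" "inv (\<phi> p) \<in> W"
    obtain W' d' where W': "(W', d') \<in> A" "\<phi> p \<in> W'" using chart_exists by blast
    have "local_rep W' d' (\<lambda>q. d (inv q)) (\<phi> p)"
      by (rule smooth_map_local_rep[OF manifold_axioms manifold_axioms inv_smooth W' W local_rep_chart])
    from smooth_map_local_rep[OF M manifold_axioms \<phi> U W' this]
    show "local_rep U c (\<lambda>q. d (inv (\<phi> q))) p" .
  qed
  show "smooth_fun M (\<lambda>p. hat (\<phi> p) (V p) (dual e))" for e
    using section_translate_smooth[OF M \<phi> V \<psi> dual(1)] by (simp add: hat_apply dual)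
qed

end

text \<open>One formula for two connections: with the identity as \<open>\<phi>\<close> it is the
  Levi-Civita connection, in general its pull-back.\<close>

definition conn :: "('c \<Rightarrow> 'a) \<Rightarrow> ('c \<Rightarrow> 'c tangent) \<Rightarrow> ('c \<Rightarrow> 'a tangent) \<Rightarrow> 'c \<Rightarrow> 'a tangent" where
  "conn \<phi> X V p = lf (dv (X p) (\<lambda>q. hat (\<phi> q) (V q))
      + nab (hat (\<phi> p) (differential A \<phi> (X p))) (hat (\<phi> p) (V p))) (\<phi> p)"

lemma hat_conn: "hat (\<phi> p) (conn \<phi> X V p) =
    dv (X p) (\<lambda>q. hat (\<phi> q) (V q)) + nab (hat (\<phi> p) (differential A \<phi> (X p))) (hat (\<phi> p) (V p))"
  unfolding conn_def by (intro hat_lf T_closed dv_T nab_T)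

lemma connection_along_conn:
  fixes M :: "('c::{t2_space, second_countable_topology}, 'd::euclidean_space) atlas"
  assumes M: "manifold M" and \<phi>: "smooth_map M A \<phi>"
  shows "connection_along M A \<phi> (conn \<phi>)"
  unfolding connection_along_def
proof (intro allI impI conjI)
  interpret M: manifold M by (rule M)
  fix X V assume X: "vector_field M X" and V: "section_along M A \<phi> V"
  note XT = M.vector_fieldD(1)[OF X]
  note hV = section_hat[OF M \<phi> V]
  have hX: "smooth_T M (\<lambda>p. hat (\<phi> p) (differential A \<phi> (X p)))"
    by (rule section_hat[OF M \<phi> differential_section[OF M manifold_axioms \<phi> X]])
  have "section_along M A \<phi> (\<lambda>p. lf (dv (X p) (\<lambda>q. hat (\<phi> q) (V q))
      + nab (hat (\<phi> p) (differential A \<phi> (X p))) (hat (\<phi> p) (V p))) (\<phi> p))"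
    by (rule section_lf[OF M \<phi> smooth_T_add[OF M smooth_T_dv[OF M X hV]
          smooth_T_bilinear[OF M bilinear_nab nab_T hX hV]]])
  then show "section_along M A \<phi> (conn \<phi> X V)" unfolding conn_def .
  show "conn \<phi> (\<lambda>p. X p + Y p) V = (\<lambda>p. conn \<phi> X V p + conn \<phi> Y V p)" for Y
    unfolding conn_def
    by (simp only: differential_add hat_simps dv_add_left nab_simps lf_simps add.assoc add.left_commute)
  show "conn \<phi> X (\<lambda>p. V p + W p) = (\<lambda>p. conn \<phi> X V p + conn \<phi> X W p)" if W: "section_along M A \<phi> W" for W
    unfolding conn_def
    by (simp only: hat_simps dv_add[OF M XT hV section_hat[OF M \<phi> W]] nab_simps lf_simps add.assoc add.left_commute)
  show "conn \<phi> (\<lambda>p. f p *\<^sub>R X p) V = (\<lambda>p. f p *\<^sub>R conn \<phi> X V p)" for f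
    unfolding conn_def
    by (simp only: differential_scale hat_simps dv_scale_left nab_simps lf_simps scaleR_add_right)
  show "conn \<phi> X (\<lambda>p. f p *\<^sub>R V p) = (\<lambda>p. X p f *\<^sub>R V p + f p *\<^sub>R conn \<phi> X V p)" if f: "smooth_fun M f" for f
  proof
    fix p
    have "V p \<in> tangent_space A (\<phi> p)" using V by (simp add: section_along_def)
    then have "X p f *\<^sub>R V p = lf (X p f *\<^sub>R hat (\<phi> p) (V p)) (\<phi> p)" by (simp add: lf_simps)
    then show "conn \<phi> X (\<lambda>p. f p *\<^sub>R V p) p = X p f *\<^sub>R V p + f p *\<^sub>R conn \<phi> X V p"
      unfolding conn_def
      by (simp only: hat_simps dv_scale[OF M XT hV f] nab_simps lf_simps scaleR_add_right add.assoc)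
  qed
qed

lemma vector_field_hat: "vector_field A X \<Longrightarrow> smooth_T A (\<lambda>p. hat p (X p))"
  using section_hat[OF manifold_axioms smooth_map_ident[OF manifold_axioms]] by (simp add: vector_field_def)

lemma hat_lie_bracket:
  assumes X: "vector_field A X" and Y: "vector_field A Y"
  shows "hat p (lie_bracket X Y p) =
    dv (X p) (\<lambda>q. hat q (Y q)) - dv (Y p) (\<lambda>q. hat q (X q)) + br (hat p (X p)) (hat p (Y p))"
proof -
  let ?x = "\<lambda>e q. hat q (X q) (dual e)" and ?y = "\<lambda>e q. hat q (Y q) (dual e)"
  let ?R = "dv (X p) (\<lambda>q. hat q (Y q)) - dv (Y p) (\<lambda>q. hat q (X q)) + br (hat p (X p)) (hat p (Y p))"
  have brT: "br u v \<in> T" for u v using br_span E_span by simp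
  have RT: "?R \<in> T" by (intro T_closed dv_T brT)
  \<comment> \<open>Both fields are expanded in the left invariant frame. The first sum is of first
    order in \<open>f\<close>; the second carries the iterated derivatives, which in the commutator
    become the brackets \<open>br e e'\<close>.\<close>
  have one: "U p (\<lambda>q. W q f) = (\<Sum>e\<in>E. U p (\<lambda>q. hat q (W q) (dual e)) * lf e p f)
      + (\<Sum>e\<in>E. \<Sum>e'\<in>E. hat p (U p) (dual e) * hat p (W p) (dual e') * lf e p (\<lambda>q. lf e' q f))"
    if U: "vector_field A U" and W: "vector_field A W" and f: "smooth_fun A f" for U W f
  proof -
    note UT = vector_fieldD(1)[OF U, of p]
    note ws = smooth_TD(2)[OF vector_field_hat[OF W]]
    have ls: "smooth_fun A (\<lambda>q. lf e q f)" if "e \<in> E" for e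
      by (rule vector_fieldD(2)[OF vector_field_lf[OF E_T[OF that]] f])
    have ex: "Z q k = (\<Sum>e\<in>E. hat q (Z q) (dual e) * lf e q k)" if "vector_field A Z" for Z q k
    proof -
      have "Z q k = lf (hat q (Z q)) q k" using vector_fieldD(1)[OF that] by simp
      also have "\<dots> = (\<Sum>e\<in>E. hat q (Z q) (dual e) * lf e q k)"
        by (rule lf_T_apply[OF hat_tangent[OF vector_fieldD(1)[OF that]]])
      finally show ?thesis .
    qed
    have "U p (\<lambda>q. W q f) = U p (\<lambda>q. \<Sum>e\<in>E. hat q (W q) (dual e) * lf e q f)"
      by (rule arg_cong[of _ _ "U p"]) (rule ext, rule ex[OF W])
    also have "\<dots> = (\<Sum>e\<in>E. U p (\<lambda>q. hat q (W q) (dual e) * lf e q f))"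
      by (rule tangent_sum[OF UT]) (intro smooth_fun_mult ws ls)
    also have "\<dots> = (\<Sum>e\<in>E. U p (\<lambda>q. hat q (W q) (dual e)) * lf e p f
        + hat p (W p) (dual e) * U p (\<lambda>q. lf e q f))"
      by (rule sum.cong[OF refl]) (simp add: tangent_mult[OF UT ws ls])
    also have "\<dots> = (\<Sum>e\<in>E. U p (\<lambda>q. hat q (W q) (dual e)) * lf e p f)
        + (\<Sum>e\<in>E. hat p (W p) (dual e) * U p (\<lambda>q. lf e q f))"
      by (rule sum.distrib)
    also have "(\<Sum>e\<in>E. hat p (W p) (dual e) * U p (\<lambda>q. lf e q f)) =
        (\<Sum>e'\<in>E. \<Sum>e\<in>E. hat p (U p) (dual e) * hat p (W p) (dual e') * lf e p (\<lambda>q. lf e' q f))"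
    proof (rule sum.cong[OF refl])
      fix e' assume "e' \<in> E"
      have "hat p (W p) (dual e') * U p (\<lambda>q. lf e' q f) =
          hat p (W p) (dual e') * (\<Sum>e\<in>E. hat p (U p) (dual e) * lf e p (\<lambda>q. lf e' q f))"
        by (rule arg_cong[OF ex[OF U]])
      then show "hat p (W p) (dual e') * U p (\<lambda>q. lf e' q f) =
          (\<Sum>e\<in>E. hat p (U p) (dual e) * hat p (W p) (dual e') * lf e p (\<lambda>q. lf e' q f))"
        unfolding sum_distrib_left by (simp only: mult.assoc mult.left_commute)
    qed
    also have "\<dots> = (\<Sum>e\<in>E. \<Sum>e'\<in>E. hat p (U p) (dual e) * hat p (W p) (dual e') * lf e p (\<lambda>q. lf e' q f))"
      by (rule sum.swap)
    finally show ?thesis .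
  qed
  have "lie_bracket X Y p = lf ?R p"
  proof
    fix f
    show "lie_bracket X Y p f = lf ?R p f"
    proof (cases "smooth_fun A f")
      case True
      have b: "lf e p (\<lambda>q. lf e' q f) - lf e' p (\<lambda>q. lf e q f) = lf (br e e') p f"
        if "e \<in> E" "e' \<in> E" for e e'
        using lie_bracket_lf[OF E_T[OF that(1)] E_T[OF that(2)], of p] that
        by (simp add: br_eq E_T lie_bracket_def fun_eq_iff)
      have "lf (br (hat p (X p)) (hat p (Y p))) p f =
          (\<Sum>e\<in>E. \<Sum>e'\<in>E. ?x e p * ?y e' p * lf (br e e') p f)"
        unfolding bilinear_T_expansion[OF bilinear_br hat_tangent[OF vector_fieldD(1)[OF X]]
            hat_tangent[OF vector_fieldD(1)[OF Y]]]
        by (simp add: lf_simps sum_fun_apply scaleR_fun_apply)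
      also have "\<dots> = (\<Sum>e\<in>E. \<Sum>e'\<in>E. ?x e p * ?y e' p * lf e p (\<lambda>q. lf e' q f))
          - (\<Sum>e\<in>E. \<Sum>e'\<in>E. ?x e p * ?y e' p * lf e' p (\<lambda>q. lf e q f))"
        unfolding sum_subtractf[symmetric] right_diff_distrib[symmetric] by (intro sum.cong refl) (simp add: b)
      also have "(\<Sum>e\<in>E. \<Sum>e'\<in>E. ?x e p * ?y e' p * lf e' p (\<lambda>q. lf e q f)) =
          (\<Sum>e\<in>E. \<Sum>e'\<in>E. ?y e p * ?x e' p * lf e p (\<lambda>q. lf e' q f))"
        by (subst sum.swap) (simp add: mult.commute)
      finally have brf: "lf (br (hat p (X p)) (hat p (Y p))) p f =
          (\<Sum>e\<in>E. \<Sum>e'\<in>E. ?x e p * ?y e' p * lf e p (\<lambda>q. lf e' q f))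
          - (\<Sum>e\<in>E. \<Sum>e'\<in>E. ?y e p * ?x e' p * lf e p (\<lambda>q. lf e' q f))" .
      have dvf: "lf (dv v k) p f = (\<Sum>e\<in>E. v (\<lambda>q. k q (dual e)) * lf e p f)" for v :: "'a tangent" and k
        unfolding dv_def by (rule dv_sum_lf)
      have "lf ?R p f = lf (dv (X p) (\<lambda>q. hat q (Y q))) p f - lf (dv (Y p) (\<lambda>q. hat q (X q))) p f
          + lf (br (hat p (X p)) (hat p (Y p))) p f"
        by (simp add: lf_simps)
      then show ?thesis
        unfolding lie_bracket_def one[OF X Y True] one[OF Y X True] brf dvf by simp
    next
      case False
      then show ?thesis
        using tangent_non_smooth[OF lie_bracket_tangent[OF X Y] False] lf_non_smooth by simp
    qed
  qed
  then show ?thesis using hat_lf[OF RT] by simp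
qed

section \<open>Levi-Civita connection, curvature and pull-back connection\<close>

lemma metric_hat_ip: "u \<in> tangent_space A p \<Longrightarrow> v \<in> tangent_space A p \<Longrightarrow> g p u v = ip (hat p u) (hat p v)"
  by (simp add: ip_eq hat_tangent metric_hat)

lemma conn_ident_hat:
  "vector_field A X \<Longrightarrow> hat p (conn (\<lambda>x. x) X Y p) = dv (X p) (\<lambda>q. hat q (Y q)) + nab (hat p (X p)) (hat p (Y p))"
  using hat_conn[of "\<lambda>x. x" p X Y] by (simp add: differential_ident[OF vector_fieldD(1)])

lemma tangent_eqI_hat:
  "u \<in> tangent_space A p \<Longrightarrow> v \<in> tangent_space A p \<Longrightarrow> hat p u = hat p v \<Longrightarrow> u = v"
  by (metis lf_hat)

lemma conn_ident_field: "vector_field A X \<Longrightarrow> vector_field A Y \<Longrightarrow> vector_field A (conn (\<lambda>x. x) X Y)"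
  using connection_along_conn[OF manifold_axioms smooth_map_ident[OF manifold_axioms]]
  unfolding connection_along_def vector_field_def by blast

lemma is_levi_civita_conn: "is_levi_civita A g (conn (\<lambda>x. x))"
  unfolding is_levi_civita_def
proof (intro conjI allI impI)
  show "connection_along A A (\<lambda>p. p) (conn (\<lambda>x. x))"
    by (rule connection_along_conn[OF manifold_axioms smooth_map_ident[OF manifold_axioms]])
  fix X Y p assume X: "vector_field A X" and Y: "vector_field A Y"
  note C = conn_ident_field
  show "conn (\<lambda>x. x) X Y p - conn (\<lambda>x. x) Y X p = lie_bracket X Y p"
  proof (rule tangent_eqI_hat)
    show "conn (\<lambda>x. x) X Y p - conn (\<lambda>x. x) Y X p \<in> tangent_space A p"
      using vector_fieldD(1)[OF C[OF X Y]] vector_fieldD(1)[OF C[OF Y X]] by (intro T_closed)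
    show "hat p (conn (\<lambda>x. x) X Y p - conn (\<lambda>x. x) Y X p) = hat p (lie_bracket X Y p)"
    proof -
      have "hat p (conn (\<lambda>x. x) X Y p - conn (\<lambda>x. x) Y X p) =
          (dv (X p) (\<lambda>q. hat q (Y q)) + nab (hat p (X p)) (hat p (Y p)))
          - (dv (Y p) (\<lambda>q. hat q (X q)) + nab (hat p (Y p)) (hat p (X p)))"
        by (simp only: hat_simps(3) conn_ident_hat[OF X] conn_ident_hat[OF Y])
      also have "\<dots> = (dv (X p) (\<lambda>q. hat q (Y q)) - dv (Y p) (\<lambda>q. hat q (X q)))
          + (nab (hat p (X p)) (hat p (Y p)) - nab (hat p (Y p)) (hat p (X p)))"
        by (rule add_diff_add)
      also have "\<dots> = hat p (lie_bracket X Y p)"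
        by (simp only: nab_torsion hat_lie_bracket[OF X Y])
      finally show ?thesis .
    qed
  qed (rule lie_bracket_tangent[OF X Y])
next
  fix X Y Z p assume X: "vector_field A X" and Y: "vector_field A Y" and Z: "vector_field A Z"
  note T = vector_fieldD(1)[OF X] vector_fieldD(1)[OF Y] vector_fieldD(1)[OF Z]
  note C = conn_ident_field[THEN vector_fieldD(1)]
  have "(\<lambda>q. g q (Y q) (Z q)) = (\<lambda>q. ip (hat q (Y q)) (hat q (Z q)))"
    by (rule ext) (rule metric_hat_ip[OF T(2,3)])
  then have "X p (\<lambda>q. g q (Y q) (Z q)) =
      ip (dv (X p) (\<lambda>q. hat q (Y q))) (hat p (Z p)) + ip (hat p (Y p)) (dv (X p) (\<lambda>q. hat q (Z q)))"
    using tangent_ip[OF manifold_axioms T(1) vector_field_hat[OF Y] vector_field_hat[OF Z]] by simp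
  moreover have "g p (conn (\<lambda>x. x) X Y p) (Z p) =
      ip (dv (X p) (\<lambda>q. hat q (Y q))) (hat p (Z p)) + ip (nab (hat p (X p)) (hat p (Y p))) (hat p (Z p))"
    unfolding metric_hat_ip[OF C[OF X Y] T(3)] conn_ident_hat[OF X] by (simp add: ip_simps)
  moreover have "g p (Y p) (conn (\<lambda>x. x) X Z p) =
      ip (hat p (Y p)) (dv (X p) (\<lambda>q. hat q (Z q))) + ip (hat p (Y p)) (nab (hat p (X p)) (hat p (Z p)))"
    unfolding metric_hat_ip[OF T(2) C[OF X Z]] conn_ident_hat[OF X] by (simp add: ip_simps)
  ultimately show "X p (\<lambda>q. g q (Y q) (Z q)) = g p (conn (\<lambda>x. x) X Y p) (Z p) + g p (Y p) (conn (\<lambda>x. x) X Z p)"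
    using nab_skew[of "hat p (X p)" "hat p (Y p)" "hat p (Z p)"] by simp
qed

text \<open>The chosen operator and \<open>conn\<close> satisfy the same Koszul formula; pairing
  with the frame fields \<open>lf e\<close> determines all components.\<close>

lemma levi_civita_eq:
  assumes X: "vector_field A X" and Y: "vector_field A Y"
  shows "levi_civita A g X Y = conn (\<lambda>x. x) X Y"
proof
  fix p
  define D where "D = levi_civita A g"
  have D: "is_levi_civita A g D"
    unfolding D_def levi_civita_def by (rule someI[of "is_levi_civita A g"]) (rule is_levi_civita_conn)
  have DT: "D X Y p \<in> tangent_space A p"
    using D X Y unfolding is_levi_civita_def connection_along_def vector_field_def section_along_def by blast
  have CT: "conn (\<lambda>x. x) X Y p \<in> tangent_space A p" by (rule vector_fieldD(1)[OF conn_ident_field[OF X Y]])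
  have "hat p (D X Y p) (dual e) = hat p (conn (\<lambda>x. x) X Y p) (dual e)" if e: "e \<in> E" for e
  proof -
    note L = vector_field_lf[OF E_T[OF e]]
    have "g p (D X Y p) (lf e p) = g p (conn (\<lambda>x. x) X Y p) (lf e p)"
      using levi_civita_koszul[OF manifold_axioms metric D X Y L, of p]
        levi_civita_koszul[OF manifold_axioms metric is_levi_civita_conn X Y L, of p] by simp
    then show ?thesis
      using metric_hat_ip[OF DT vector_fieldD(1)[OF L]] metric_hat_ip[OF CT vector_fieldD(1)[OF L]] e
      by (simp add: E_T ip_E)
  qed
  then have "hat p (D X Y p) = hat p (conn (\<lambda>x. x) X Y p)"
    by (intro T_eqI hat_tangent DT CT)
  then show "levi_civita A g X Y p = conn (\<lambda>x. x) X Y p"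
    using tangent_eqI_hat[OF DT CT] by (simp add: D_def)
qed

lemma levi_civita_hat:
  assumes X: "vector_field A X" and Y: "vector_field A Y"
  shows "hat p (levi_civita A g X Y p) = dv (X p) (\<lambda>q. hat q (Y q)) + nab (hat p (X p)) (hat p (Y p))"
  unfolding levi_civita_eq[OF assms] by (rule conn_ident_hat[OF X])

lemma levi_civita_field: "vector_field A X \<Longrightarrow> vector_field A Y \<Longrightarrow> vector_field A (levi_civita A g X Y)"
  using levi_civita_eq conn_ident_field by simp

lemma curvature_value:
  assumes X: "vector_field A X" and Y: "vector_field A Y" and Z: "vector_field A Z"
  shows "levi_civita A g X (levi_civita A g Y Z) q - levi_civita A g Y (levi_civita A g X Z) q
      - levi_civita A g (lie_bracket X Y) Z q = lf (curv (hat q (X q)) (hat q (Y q)) (hat q (Z q))) q"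
    (is "?l = ?r")
proof (rule tangent_eqI_hat)
  let ?D = "levi_civita A g" and ?z = "\<lambda>p. hat p (Z p)"
  note F = levi_civita_field
  note B = vector_field_lie_bracket[OF X Y]
  note hZ = vector_field_hat[OF Z]
  show "?l \<in> tangent_space A q"
    by (intro T_closed vector_fieldD(1) F X Y Z B)
  show "?r \<in> tangent_space A q" by (rule lf_tangent[OF curv_T])
  have DD: "hat q (?D U (?D W Z) q) = dv (U q) (\<lambda>p. dv (W p) ?z)
      + (nab (dv (U q) (\<lambda>p. hat p (W p))) (?z q) + nab (hat q (W q)) (dv (U q) ?z))
      + (nab (hat q (U q)) (dv (W q) ?z) + nab (hat q (U q)) (nab (hat q (W q)) (?z q)))"
    if U: "vector_field A U" and W: "vector_field A W" for U W
  proof -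
    note hW = vector_field_hat[OF W]
    have "hat q (?D U (?D W Z) q) = dv (U q) (\<lambda>p. dv (W p) ?z + nab (hat p (W p)) (?z p))
        + nab (hat q (U q)) (dv (W q) ?z + nab (hat q (W q)) (?z q))"
      unfolding levi_civita_hat[OF U F[OF W Z]] levi_civita_hat[OF W Z] ..
    then show ?thesis
      unfolding dv_add[OF manifold_axioms vector_fieldD(1)[OF U] smooth_T_dv[OF manifold_axioms W hZ]
          smooth_T_bilinear[OF manifold_axioms bilinear_nab nab_T hW hZ]]
        dv_bilinear[OF manifold_axioms vector_fieldD(1)[OF U] bilinear_nab nab_T hW hZ] nab_simps .
  qed
  \<comment> \<open>The commutator of two flat second derivatives is the derivative along the
    bracket, so flat curvature vanishes and only \<open>curv\<close> survives.\<close>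
  have dB: "dv (lie_bracket X Y q) ?z = dv (X q) (\<lambda>p. dv (Y p) ?z) - dv (Y q) (\<lambda>p. dv (X p) ?z)"
    by (rule T_eqI) (auto intro!: dv_T T_closed simp: dv_dual lie_bracket_def)
  show "hat q ?l = hat q ?r"
    unfolding hat_lf[OF curv_T] hat_simps DD[OF X Y] DD[OF Y X] levi_civita_hat[OF B Z]
      hat_lie_bracket[OF X Y] dB nab_simps by (simp add: curv_def)
qed

text \<open>By \<open>curvature_value\<close> every choice of extensions gives the same vector, and
  left invariant extensions show that a choice exists; thus \<open>SOME\<close> has exactly one
  candidate.\<close>

lemma curvature_at_eq:
  assumes "u \<in> tangent_space A q" "v \<in> tangent_space A q" "w \<in> tangent_space A q"
  shows "curvature_at A g q u v w = lf (curv (hat q u) (hat q v) (hat q w)) q"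
proof -
  let ?D = "levi_civita A g"
  let ?c = "lf (curv (hat q u) (hat q v) (hat q w)) q"
  define P where "P = (\<lambda>z. \<exists>X Y Z. vector_field A X \<and> vector_field A Y \<and> vector_field A Z \<and>
       X q = u \<and> Y q = v \<and> Z q = w \<and>
       z = ?D X (?D Y Z) q - ?D Y (?D X Z) q - ?D (lie_bracket X Y) Z q)"
  have "z = ?c" if Pz: "P z" for z
  proof -
    obtain X Y Z where "vector_field A X" "vector_field A Y" "vector_field A Z" "X q = u" "Y q = v" "Z q = w"
      "z = ?D X (?D Y Z) q - ?D Y (?D X Z) q - ?D (lie_bracket X Y) Z q"
      using Pz unfolding P_def by (elim exE conjE)
    then show ?thesis by (simp only: curvature_value)
  qed
  moreover have "P ?c"
    unfolding P_def
    by (rule exI[of _ "lf (hat q u)"], rule exI[of _ "lf (hat q v)"], rule exI[of _ "lf (hat q w)"])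
      (use assms in \<open>simp add: vector_field_lf hat_tangent curvature_value\<close>)
  ultimately have "(SOME z. P z) = ?c" by (rule some_equality[of P, rotated])
  then show ?thesis unfolding curvature_at_def Let_def P_def .
qed

text \<open>Every section is globally a combination of the sections \<open>lf e\<close> composed
  with \<open>\<phi>\<close>, with smooth coefficients. Leibniz reduces the claim to these, and
  there the defining property of a pull-back applies.\<close>

lemma pullback_unique:
  fixes M :: "('c::{t2_space, second_countable_topology}, 'd::euclidean_space) atlas"
  assumes M: "manifold M" and \<phi>: "smooth_map M A \<phi>"
    and P: "is_pullback_connection M A \<phi> (levi_civita A g) P"
    and X: "vector_field M X" and V: "section_along M A \<phi> V"
  shows "P X V = conn \<phi> X V"
proof
  fix p
  interpret M: manifold M by (rule M)
  note hV = section_hat[OF M \<phi> V]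
  let ?x = "hat (\<phi> p) (differential A \<phi> (X p))"
  let ?v = "\<lambda>e p. hat (\<phi> p) (V p) (dual e)"
  have dT: "differential A \<phi> (X p) \<in> tangent_space A (\<phi> p)"
    using differential_section[OF M manifold_axioms \<phi> X] by (simp add: section_along_def)
  have PC: "connection_along M A \<phi> P" using P by (simp add: is_pullback_connection_def)
  have Veq: "V q = (\<Sum>e\<in>E. ?v e q *\<^sub>R lf e (\<phi> q))" for q
  proof -
    have q: "V q \<in> tangent_space A (\<phi> q)" using V by (simp add: section_along_def)
    have "V q = lf (\<Sum>e\<in>E. ?v e q *\<^sub>R e) (\<phi> q)"
      using T_expansion[OF hat_tangent[OF q]] lf_hat[OF q] by argo
    then show ?thesis by (simp only: lf_simps)
  qed
  have W: "section_along M A \<phi> (\<lambda>q. lf e (\<phi> q))" if "e \<in> E" for e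
    by (rule section_lf[OF M \<phi> smooth_T_const[OF M E_T[OF that]]])
  \<comment> \<open>The vector \<open>differential A \<phi> (X p)\<close> is extended by the left
    invariant field of \<open>?x\<close>. The trivialisation of \<open>lf e\<close> is constant, so
    only the Koszul product contributes.\<close>
  have PW: "P X (\<lambda>q. lf e (\<phi> q)) p = lf (nab ?x e) (\<phi> p)" if e: "e \<in> E" for e
  proof -
    note x = hat_tangent[OF dT]
    note Z = vector_field_lf[OF x] and Y = vector_field_lf[OF E_T[OF e]]
    have "P X (\<lambda>q. lf e (\<phi> q)) p = levi_civita A g (lf ?x) (lf e) (\<phi> p)"
      using P X Y Z lf_hat[OF dT] unfolding is_pullback_connection_def by blast
    also have "\<dots> = lf (dv (lf ?x (\<phi> p)) (\<lambda>q. hat q (lf e q)) + nab ?x e) (\<phi> p)"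
      unfolding levi_civita_eq[OF Z Y] conn_def
      by (simp add: differential_ident[OF lf_tangent[OF x]] x E_T[OF e])
    also have "dv (lf ?x (\<phi> p)) (\<lambda>q. hat q (lf e q)) = 0"
      using dv_const[OF manifold_axioms lf_tangent[OF x]] by (simp add: E_T[OF e])
    finally show ?thesis by simp
  qed
  have Vf: "V = (\<lambda>q. \<Sum>e\<in>E. ?v e q *\<^sub>R lf e (\<phi> q))" by (rule ext) (rule Veq)
  have "P X (\<lambda>q. \<Sum>e\<in>E. ?v e q *\<^sub>R lf e (\<phi> q)) =
      (\<lambda>p. \<Sum>e\<in>E. X p (?v e) *\<^sub>R lf e (\<phi> p) + ?v e p *\<^sub>R P X (\<lambda>q. lf e (\<phi> q)) p)"
    by (rule connection_along_sum[OF PC M manifold_axioms X W smooth_TD(2)[OF hV] E_finite, THEN conjunct2])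
  then have "P X (\<lambda>q. \<Sum>e\<in>E. ?v e q *\<^sub>R lf e (\<phi> q)) p =
      (\<Sum>e\<in>E. X p (?v e) *\<^sub>R lf e (\<phi> p) + ?v e p *\<^sub>R P X (\<lambda>q. lf e (\<phi> q)) p)"
    by (rule fun_cong)
  moreover have "P X V p = P X (\<lambda>q. \<Sum>e\<in>E. ?v e q *\<^sub>R lf e (\<phi> q)) p"
    by (rule arg_cong[where f = "\<lambda>V. P X V p", OF Vf])
  ultimately have "P X V p = (\<Sum>e\<in>E. X p (?v e) *\<^sub>R lf e (\<phi> p) + ?v e p *\<^sub>R P X (\<lambda>q. lf e (\<phi> q)) p)"
    by (rule trans[rotated])
  also have "\<dots> = (\<Sum>e\<in>E. lf (X p (?v e) *\<^sub>R e + ?v e p *\<^sub>R nab ?x e) (\<phi> p))"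
    by (rule sum.cong[OF refl]) (simp only: PW lf_simps)
  also have "\<dots> = lf (dv (X p) (\<lambda>q. hat (\<phi> q) (V q)) + (\<Sum>e\<in>E. ?v e p *\<^sub>R nab ?x e)) (\<phi> p)"
    by (simp only: lf_simps sum.distrib dv_def)
  also have "(\<Sum>e\<in>E. ?v e p *\<^sub>R nab ?x e) = nab ?x (hat (\<phi> p) (V p))"
    using linear_T_expansion[of "nab ?x", OF _ smooth_TD(1)[OF hV]] bilinear_nab by (simp add: bilinear_def)
  finally show "P X V p = conn \<phi> X V p" by (simp only: conn_def)
qed

lemma is_pullback_conn:
  fixes M :: "('c::{t2_space, second_countable_topology}, 'd::euclidean_space) atlas"
  assumes M: "manifold M" and \<phi>: "smooth_map M A \<phi>"
  shows "is_pullback_connection M A \<phi> (levi_civita A g) (conn \<phi>)"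
  unfolding is_pullback_connection_def
proof (intro conjI allI impI)
  show "connection_along M A \<phi> (conn \<phi>)" by (rule connection_along_conn[OF M \<phi>])
  fix X Y Z p assume X: "vector_field M X" and Y: "vector_field A Y" and Z: "vector_field A Z"
    and eq: "Z (\<phi> p) = differential A \<phi> (X p)"
  have "dv (X p) (\<lambda>q. hat (\<phi> q) (Y (\<phi> q))) = dv (Z (\<phi> p)) (\<lambda>q. hat q (Y q))"
    unfolding dv_def eq
    by (rule sum.cong[OF refl])
      (use smooth_TD(2)[OF vector_field_hat[OF Y]] in \<open>simp add: differential_def o_def\<close>)
  then show "conn \<phi> X (\<lambda>q. Y (\<phi> q)) p = levi_civita A g Z Y (\<phi> p)"
    unfolding levi_civita_eq[OF Z Y] conn_def
    by (simp add: eq[symmetric] differential_ident[OF vector_fieldD(1)[OF Z]])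
qed

lemma pullback_connection_eq:
  fixes M :: "('c::{t2_space, second_countable_topology}, 'd::euclidean_space) atlas"
  assumes M: "manifold M" and \<phi>: "smooth_map M A \<phi>" and X: "vector_field M X" and V: "section_along M A \<phi> V"
  shows "pullback_connection M A \<phi> (levi_civita A g) X V = conn \<phi> X V"
proof -
  have "is_pullback_connection M A \<phi> (levi_civita A g) (pullback_connection M A \<phi> (levi_civita A g))"
    unfolding pullback_connection_def
    by (rule someI[where P = "is_pullback_connection M A \<phi> (levi_civita A g)", OF is_pullback_conn[OF M \<phi>]])
  from pullback_unique[OF M \<phi> this X V] show ?thesis .
qed

section \<open>Left invariant Killing and parallel fields\<close>

lemma killing_lf_iff:
  assumes t: "t \<in> T"
  shows "killing_field A g (lf t) \<longleftrightarrow> skew_ad t"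
proof
  assume k: "killing_field A g (lf t)"
  show "skew_ad t"
  proof (rule skew_adI)
    fix e f assume e: "e \<in> E" and f: "f \<in> E"
    note eT = E_T[OF e] and fT = E_T[OF f]
    \<comment> \<open>The Killing equation is tested on two left invariant fields at the identity;
      their inner product is constant, so the left side is 0.\<close>
    have "lf t \<one> (\<lambda>q. g q (lf e q) (lf f q)) =
        g \<one> (lie_bracket (lf t) (lf e) \<one>) (lf f \<one>) + g \<one> (lf e \<one>) (lie_bracket (lf t) (lf f) \<one>)"
      using k vector_field_lf[OF eT] vector_field_lf[OF fT] unfolding killing_field_def by blast
    moreover have "lf t \<one> (\<lambda>q. g q (lf e q) (lf f q)) = 0"
      unfolding metric_lf[OF eT fT] using tangent_const[OF lf_tangent[OF t]] .
    moreover have "lie_bracket (lf t) (lf v) \<one> = br t v" if "v \<in> T" for v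
      using br_eq[OF t that] by (simp add: lie_alg_bracket_def)
    moreover have "br t v \<in> T" for v using br_span E_span by simp
    ultimately show "ip (br t e) f + ip (br t f) e = 0"
      using eT fT by (simp add: ip_eq metric_simps(1)[OF metric eT])
  qed
next
  assume s: "skew_ad t"
  show "killing_field A g (lf t)"
    unfolding killing_field_def
  proof (intro conjI allI impI)
    show "vector_field A (lf t)" by (rule vector_field_lf[OF t])
    fix Y Z p assume Y: "vector_field A Y" and Z: "vector_field A Z"
    note TY = vector_fieldD(1)[OF Y] and TZ = vector_fieldD(1)[OF Z]
    have b: "hat p (lie_bracket (lf t) U p) = dv (lf t p) (\<lambda>q. hat q (U q)) + br t (hat p (U p))"
      if "vector_field A U" for U
      using hat_lie_bracket[OF vector_field_lf[OF t] that, of p] t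
        dv_const[OF manifold_axioms vector_fieldD(1)[OF that], of p t] by simp
    note bt = lie_bracket_tangent[OF vector_field_lf[OF t]]
    have "(\<lambda>q. g q (Y q) (Z q)) = (\<lambda>q. ip (hat q (Y q)) (hat q (Z q)))"
      by (rule ext) (rule metric_hat_ip[OF TY TZ])
    then have "lf t p (\<lambda>q. g q (Y q) (Z q)) =
        ip (dv (lf t p) (\<lambda>q. hat q (Y q))) (hat p (Z p)) + ip (hat p (Y p)) (dv (lf t p) (\<lambda>q. hat q (Z q)))"
      using tangent_ip[OF manifold_axioms lf_tangent[OF t] vector_field_hat[OF Y] vector_field_hat[OF Z]] by simp
    moreover have "ip (br t (hat p (Y p))) (hat p (Z p)) + ip (hat p (Y p)) (br t (hat p (Z p))) = 0"
      using s unfolding skew_ad_def by (metis ip_sym)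
    ultimately show "lf t p (\<lambda>q. g q (Y q) (Z q)) =
        g p (lie_bracket (lf t) Y p) (Z p) + g p (Y p) (lie_bracket (lf t) Z p)"
      unfolding metric_hat_ip[OF bt[OF Y] TZ] metric_hat_ip[OF TY bt[OF Z]] b[OF Y] b[OF Z]
      by (simp add: ip_simps)
  qed
qed

lemma parallel_lf_iff:
  assumes t: "t \<in> T"
  shows "parallel_field A g (lf t) \<longleftrightarrow> (\<forall>v\<in>T. nab v t = 0)"
proof -
  note L = vector_field_lf[OF t]
  have v: "hat p (levi_civita A g Y (lf t) p) = nab (hat p (Y p)) t" if "vector_field A Y" for Y p
    using levi_civita_hat[OF that L] t dv_const[OF manifold_axioms vector_fieldD(1)[OF that], of p t] by simp
  have z: "levi_civita A g Y (lf t) p = 0 \<longleftrightarrow> nab (hat p (Y p)) t = 0" if "vector_field A Y" for Y p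
    using v[OF that, of p] lf_hat[OF vector_fieldD(1)[OF levi_civita_field[OF that L]], of p]
    by (metis hat_simps(5) lf_simps(5))
  show ?thesis
  proof
    assume p: "parallel_field A g (lf t)"
    show "\<forall>v\<in>T. nab v t = 0"
    proof
      fix v assume v: "v \<in> T"
      have "levi_civita A g (lf v) (lf t) \<one> = 0"
        using p vector_field_lf[OF v] unfolding parallel_field_def by blast
      then show "nab v t = 0" using z[OF vector_field_lf[OF v], of \<one>] v by (metis hat_lf)
    qed
  next
    assume "\<forall>v\<in>T. nab v t = 0"
    then show "parallel_field A g (lf t)"
      using L z hat_tangent vector_fieldD(1) unfolding parallel_field_def by blast
  qed
qed

end


section \<open>Homomorphisms that are Riemannian submersions\<close>

lemma trace_on_cong:
  assumes V: "subspace V" and eq: "\<And>v. v \<in> V \<Longrightarrow> S v = T v"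
  shows "trace_on V S = trace_on V T"
proof -
  define B where "B = (SOME B. independent B \<and> span B = V)"
  have "\<exists>B. independent B \<and> span B = V"
    using basis_exists[of V] V by (metis span_minimal subset_antisym)
  then have "span B = V" unfolding B_def by (metis (mono_tags, lifting) someI_ex)
  then have "(\<Sum>b\<in>B. representation B (S b) b) = (\<Sum>b\<in>B. representation B (T b) b)"
    using eq by (intro sum.cong refl) (metis span_base)
  then show ?thesis unfolding trace_on_def Let_def B_def .
qed

context riem_lie_group_onb begin

lemma frame_exists: "\<exists>Es. local_orthonormal_frame A g p Es"
proof -
  obtain es where es: "set es = E" "distinct es" using finite_distinct_list[OF E_finite] by blast
  have "local_orthonormal_frame A g p (map lf es)"
    unfolding local_orthonormal_frame_def
  proof (intro conjI exI[of _ UNIV] ballI allI impI)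
    show "vector_field A X" if "X \<in> set (map lf es)" for X
      using that es(1) E_T vector_field_lf by auto
    fix q
    have "(\<lambda>X. X q) ` set (map lf es) = (\<lambda>u. lf u q) ` E" using es(1) by auto
    then have "span ((\<lambda>X. X q) ` set (map lf es)) = (\<lambda>u. lf u q) ` T"
      using linear_span_image[OF linear_lf, of q E] E_span by simp
    also have "\<dots> = tangent_space A q"
    proof (intro equalityI subsetI)
      fix v assume "v \<in> tangent_space A q"
      then show "v \<in> (\<lambda>u. lf u q) ` T" using lf_hat hat_tangent by (intro image_eqI[of _ _ "hat q v"]) simp_all
    qed (use lf_tangent in auto)
    finally show "span ((\<lambda>X. X q) ` set (map lf es)) = tangent_space A q" .
    fix i j assume i: "i < length (map lf es)" and j: "j < length (map lf es)"
    then have "es ! i \<in> E" "es ! j \<in> E" using es(1) nth_mem by fastforce+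
    then have "g q (lf (es ! i) q) (lf (es ! j) q) = (if es ! i = es ! j then 1 else 0)"
      by (simp add: metric_lf E_T E_orth)
    then show "g q ((map lf es ! i) q) ((map lf es ! j) q) = (if i = j then 1 else 0)"
      using i j es(2) by (simp add: nth_eq_iff_index_eq)
  qed auto
  then show ?thesis by blast
qed

text \<open>Trivialised at \<open>p\<close>, any orthonormal frame becomes an orthonormal basis of
  \<open>T\<close>, and by \<open>bilinear_trace\<close> the sum does not depend on it. This removes
  the choice of frame from the tension and bitension fields.\<close>

lemma frame_trace:
  fixes \<beta> :: "'a tangent \<Rightarrow> 'a tangent \<Rightarrow> 'w::real_vector"
  assumes Es: "local_orthonormal_frame A g p Es" and \<beta>: "bilinear \<beta>"
  shows "(\<Sum>X\<leftarrow>Es. \<beta> (hat p (X p)) (hat p (X p))) = (\<Sum>e\<in>E. \<beta> e e)"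
proof -
  obtain U where U: "\<forall>X\<in>set Es. vector_field A X" "p \<in> U" "\<forall>q\<in>U.
        span ((\<lambda>X. X q) ` set Es) = tangent_space A q \<and>
        (\<forall>i<length Es. \<forall>j<length Es. g q ((Es ! i) q) ((Es ! j) q) = (if i = j then 1 else 0))"
    using Es unfolding local_orthonormal_frame_def by (elim conjE exE) (rule that; blast)
  define xs where "xs = map (\<lambda>X. hat p (X p)) Es"
  have o: "ip (xs ! i) (xs ! j) = (if i = j then 1 else 0)" if "i < length Es" "j < length Es" for i j
  proof -
    have "(Es ! i) p \<in> tangent_space A p" "(Es ! j) p \<in> tangent_space A p"
      using U(1) that vector_fieldD(1) nth_mem by blast+
    then show ?thesis using U(2,3) that by (simp add: xs_def metric_hat_ip[symmetric])
  qed
  \<comment> \<open>The frame is a list; excluding repetitions lets the list sum become a sum over a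
    set.\<close>
  have d: "distinct xs"
    unfolding distinct_conv_nth
  proof (intro allI impI)
    fix i j assume ij: "i < length xs" "j < length xs" "i \<noteq> j"
    then have l: "i < length Es" "j < length Es" by (simp_all add: xs_def)
    show "xs ! i \<noteq> xs ! j"
    proof
      assume eq: "xs ! i = xs ! j"
      show False using o[OF l] o[OF l(1,1)] ij(3) unfolding eq by simp
    qed
  qed
  have "span (set xs) = hat p ` span ((\<lambda>X. X p) ` set Es)"
    by (simp add: xs_def image_image linear_span_image[OF linear_hat, symmetric])
  also have "\<dots> = hat p ` tangent_space A p" using U by simp
  also have "\<dots> = T"
  proof (intro equalityI subsetI)
    fix v assume "v \<in> T"
    then show "v \<in> hat p ` tangent_space A p" using lf_tangent by (intro image_eqI[of _ _ "lf v p"]) simp_all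
  qed (use hat_tangent in auto)
  finally have s: "span (set xs) = span E" by (simp only: E_span)
  have "(\<Sum>x\<in>set xs. \<beta> x x) = (\<Sum>e\<in>E. \<beta> e e)"
  proof (rule bilinear_trace[OF \<beta> finite_set s])
    fix e e' assume "e \<in> set xs" "e' \<in> set xs"
    then obtain i j where ij: "e = xs ! i" "e' = xs ! j" "i < length xs" "j < length xs" by (metis in_set_conv_nth)
    have "xs ! i = xs ! j \<longleftrightarrow> i = j" by (rule nth_eq_iff_index_eq[OF d ij(3,4)])
    moreover have "ip (xs ! i) (xs ! j) = (if i = j then 1 else 0)"
      by (rule o) (use ij(3,4) in \<open>simp_all add: xs_def\<close>)
    ultimately show "ip e e' = (if e = e' then 1 else 0)" unfolding ij(1,2) by simp
  qed
  moreover have "(\<Sum>x\<leftarrow>xs. \<beta> x x) = (\<Sum>x\<in>set xs. \<beta> x x)" by (rule sum_list_distinct_conv_sum_set[OF d])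
  ultimately show ?thesis by (simp add: xs_def o_def)
qed

lemma br_T: "br u v \<in> T"
  using br_span E_span by simp

lemma br_proj: "br (proj u) (proj v) = br u v"
  by (simp add: br_def proj_T)

lemma trace_br:
  assumes "finite S" "S \<subseteq> T" "\<And>e e'. e \<in> S \<Longrightarrow> e' \<in> S \<Longrightarrow> g \<one> e e' = (if e = e' then 1 else 0)"
    and "\<And>v. v \<in> span S \<Longrightarrow> br u v \<in> span S" and u: "u \<in> T"
  shows "trace_on (span S) (lie_alg_bracket G A u) = (\<Sum>e\<in>S. ip (br u e) e)"
proof -
  have ST: "span S \<subseteq> T" using assms(2) by (simp add: span_minimal subspace_tangent_space)
  have "trace_on (span S) (lie_alg_bracket G A u) = trace_on (span S) (br u)"
    by (rule trace_on_cong) (use ST u br_eq in auto)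
  also have "\<dots> = (\<Sum>e\<in>S. ip (br u e) e)"
  proof (rule trace_on_orthonormal[OF bil_ip assms(1)])
    show "ip e e' = (if e = e' then 1 else 0)" if "e \<in> S" "e' \<in> S" for e e'
      using ip_eq[of e e'] assms(2,3) that by (simp add: subset_eq)
    show "linear (br u)" using bilinear_br by (simp add: bilinear_def)
  qed (rule assms(4))
  finally show ?thesis .
qed

lemma unimodular_ctr:
  assumes "unimodular T (lie_alg_bracket G A)"
  shows "ctr = 0"
proof (rule ip_eqI[OF ctr_span span_zero])
  fix w
  have "trace_on (span E) (lie_alg_bracket G A (proj w)) = (\<Sum>e\<in>E. ip (br (proj w) e) e)"
    by (rule trace_br) (use E_finite E_T E_orth br_span proj_T in auto)
  moreover have "trace_on (span E) (lie_alg_bracket G A (proj w)) = 0"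
    using assms proj_T unfolding unimodular_def E_span by blast
  moreover have "br (proj w) e = br w e" if "e \<in> E" for e
    using br_proj[of w e] E_T[OF that] by simp
  ultimately show "ip ctr w = ip 0 w" by (simp add: ip_ctr ip_simps)
qed

end

section \<open>Tension and bitension of a homomorphism\<close>

locale lie_hom = G: riem_lie_group_onb G A g E + H: riem_lie_group_onb H B h F
  for G :: "('a::{t2_space, second_countable_topology}, 'm) monoid_scheme"
    and A :: "('a, 'e::euclidean_space) atlas" and g :: "'a metric" and E
    and H :: "('b::{t2_space, second_countable_topology}, 'n) monoid_scheme"
    and B :: "('b, 'f::euclidean_space) atlas" and h :: "'b metric" and F +
  fixes \<phi> :: "'a \<Rightarrow> 'b"
  assumes hom: "\<phi> \<in> hom G H" and smooth: "smooth_map A B \<phi>"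
begin

abbreviation "xi \<equiv> differential B \<phi>"

definition K :: "'a tangent set" where "K = {u \<in> lie_algebra G A. xi u = 0}"

abbreviation "hor \<equiv> {u \<in> lie_algebra G A. \<forall>k\<in>K. g \<one>\<^bsub>G\<^esub> u k = 0}"

lemma phi_mult [simp]: "\<phi> (x \<otimes>\<^bsub>G\<^esub> y) = \<phi> x \<otimes>\<^bsub>H\<^esub> \<phi> y"
  using hom G.G_carrier by (simp add: hom_def)

lemma phi_one [simp]: "\<phi> \<one>\<^bsub>G\<^esub> = \<one>\<^bsub>H\<^esub>"
  using hom_one[OF hom G.G_group H.G_group] .

lemma pull: "smooth_fun B f \<Longrightarrow> smooth_fun A (\<lambda>x. f (\<phi> x))"
  by (rule smooth_fun_compose[OF G.manifold_axioms H.manifold_axioms smooth])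

lemma xi_tangent: "v \<in> tangent_space A p \<Longrightarrow> xi v \<in> tangent_space B (\<phi> p)"
  by (rule differential_tangent[OF G.manifold_axioms pull H.manifold_axioms])

lemma xi_T: "u \<in> G.T \<Longrightarrow> xi u \<in> H.T"
  using xi_tangent[of u "\<one>\<^bsub>G\<^esub>"] by simp

lemma xi_apply: "smooth_fun B f \<Longrightarrow> xi v f = v (\<lambda>x. f (\<phi> x))"
  by (simp add: differential_def o_def)

lemmas xi_simps = linear_add[OF linear_differential[of B \<phi>]] linear_scale[OF linear_differential[of B \<phi>]]
  linear_diff[OF linear_differential[of B \<phi>]] linear_sum[OF linear_differential[of B \<phi>]]
  linear_0[OF linear_differential[of B \<phi>]]

text \<open>A homomorphism intertwines left translation by \<open>p\<close> with left translation by
  \<open>\<phi> p\<close>.\<close>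

lemma xi_lf: "xi (G.lf u p) = H.lf (xi u) (\<phi> p)"
proof
  fix f show "xi (G.lf u p) f = H.lf (xi u) (\<phi> p) f"
  proof (cases "smooth_fun B f")
    case True
    then show ?thesis
      by (simp add: xi_apply G.lf_apply H.lf_apply pull H.smooth_fun_translate)
  next
    case False
    then show ?thesis by (simp add: H.lf_non_smooth differential_def)
  qed
qed

lemma hat_xi: "v \<in> tangent_space A p \<Longrightarrow> H.hat (\<phi> p) (xi v) = xi (G.hat p v)"
  using xi_lf[of "G.hat p v" p] by (simp add: xi_T G.hat_tangent)

text \<open>On the Lie algebra \<open>xi\<close> has constant matrix entries
  \<open>xi e' (dual e)\<close>, and a constant linear map commutes with differentiation.\<close>

lemma dv_xi:
  assumes v: "v \<in> tangent_space A p" and f: "G.smooth_T A f"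
  shows "H.dv v (\<lambda>q. xi (f q)) = xi (G.dv v f)"
proof (rule H.T_eqI[OF H.dv_T xi_T[OF G.dv_T]])
  fix e assume e: "e \<in> F"
  note fs = G.smooth_TD(2)[OF f]
  have x: "xi u (H.dual e) = (\<Sum>e'\<in>E. u (G.dual e') * xi e' (H.dual e))" if "u \<in> G.T" for u
    by (subst G.linear_T_expansion[OF linear_differential that]) (simp add: sum_fun_apply scaleR_fun_apply)
  have "H.dv v (\<lambda>q. xi (f q)) (H.dual e) = v (\<lambda>q. \<Sum>e'\<in>E. f q (G.dual e') * xi e' (H.dual e))"
    unfolding H.dv_dual[OF e] x[OF G.smooth_TD(1)[OF f]] ..
  also have "\<dots> = (\<Sum>e'\<in>E. v (\<lambda>q. f q (G.dual e') * xi e' (H.dual e)))"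
    by (rule G.tangent_sum[OF v]) (intro G.smooth_fun_mult fs G.smooth_fun_const)
  also have "\<dots> = (\<Sum>e'\<in>E. G.dv v f (G.dual e') * xi e' (H.dual e))"
    by (rule sum.cong[OF refl])
      (simp add: G.tangent_mult[OF v fs G.smooth_fun_const] G.tangent_const[OF v] G.dv_dual)
  also have "\<dots> = xi (G.dv v f) (H.dual e)" by (rule x[OF G.dv_T, symmetric])
  finally show "H.dv v (\<lambda>q. xi (f q)) (H.dual e) = xi (G.dv v f) (H.dual e)" .
qed

lemma xi_br:
  assumes u: "u \<in> G.T" and v: "v \<in> G.T"
  shows "xi (G.br u v) = H.br (xi u) (xi v)"
proof
  fix f
  show "xi (G.br u v) f = H.br (xi u) (xi v) f"
  proof (cases "smooth_fun B f")
    case True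
    have l: "G.lf w q (\<lambda>x. f (\<phi> x)) = H.lf (xi w) (\<phi> q) f" for w q
      using fun_cong[OF xi_lf[of w q], of f] by (simp add: xi_apply True)
    have s: "smooth_fun B (\<lambda>q. H.lf (xi w) q f)" if "w \<in> G.T" for w
      by (rule H.vector_fieldD(2)[OF H.vector_field_lf[OF xi_T[OF that]] True])
    show ?thesis
      using u v
      by (simp add: G.br_eq H.br_eq xi_T xi_apply True lie_alg_bracket_def lie_bracket_def l s)
  next
    case False
    then show ?thesis using H.tangent_non_smooth[OF H.br_T] by (simp add: differential_def)
  qed
qed

definition tau :: "'b tangent" where
  "tau = (\<Sum>e\<in>E. H.nab (xi e) (xi e) - xi (G.nab e e))"

lemma tau_T: "tau \<in> H.T"
  unfolding tau_def by (intro subspace_sum H.subspace_tangent_space H.T_closed H.nab_T xi_T G.nab_T)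

lemma hat_xi_smooth: "vector_field A X \<Longrightarrow> H.smooth_T A (\<lambda>p. xi (G.hat p (X p)))"
  using H.section_hat[OF G.manifold_axioms smooth
      differential_section[OF G.manifold_axioms H.manifold_axioms smooth]]
  by (simp add: hat_xi G.vector_fieldD(1))

lemma xi_eq_lf: "v \<in> tangent_space A p \<Longrightarrow> xi v = H.lf (xi (G.hat p v)) (\<phi> p)"
  using xi_lf[of "G.hat p v" p] by simp

text \<open>Both terms of the second fundamental form contain the flat derivative of the trivialised
  \<open>X\<close>, mapped by \<open>xi\<close>. Its cancellation makes the result bilinear in the
  value of \<open>X\<close> at \<open>p\<close>.\<close>

lemma hessian_eq:
  assumes X: "vector_field A X"
  shows "hessian_map A g B h \<phi> X X p =
    H.lf (H.nab (xi (G.hat p (X p))) (xi (G.hat p (X p))) - xi (G.nab (G.hat p (X p)) (G.hat p (X p)))) (\<phi> p)"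
proof -
  let ?x = "G.hat p (X p)"
  note XT = G.vector_fieldD(1)[OF X]
  note s = differential_section[OF G.manifold_axioms H.manifold_axioms smooth X]
  have "pullback_connection A B \<phi> (levi_civita B h) X (\<lambda>q. xi (X q)) p =
      H.lf (H.dv (X p) (\<lambda>q. xi (G.hat q (X q))) + H.nab (xi ?x) (xi ?x)) (\<phi> p)"
    unfolding H.pullback_connection_eq[OF G.manifold_axioms smooth X s] H.conn_def hat_xi[OF XT] ..
  also have "\<dots> = H.lf (xi (G.dv (X p) (\<lambda>q. G.hat q (X q))) + H.nab (xi ?x) (xi ?x)) (\<phi> p)"
    unfolding dv_xi[OF XT G.vector_field_hat[OF X]] ..
  finally have 1: "pullback_connection A B \<phi> (levi_civita B h) X (\<lambda>q. xi (X q)) p =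
      H.lf (xi (G.dv (X p) (\<lambda>q. G.hat q (X q))) + H.nab (xi ?x) (xi ?x)) (\<phi> p)" .
  have 2: "xi (levi_civita A g X X p) =
      H.lf (xi (G.dv (X p) (\<lambda>q. G.hat q (X q))) + xi (G.nab ?x ?x)) (\<phi> p)"
    unfolding xi_eq_lf[OF G.vector_fieldD(1)[OF G.levi_civita_field[OF X X]]] G.levi_civita_hat[OF X X] xi_simps ..
  show ?thesis unfolding hessian_map_def 1 2 H.lf_simps by simp
qed

lemma sum_list_lf: "(\<Sum>x\<leftarrow>xs. H.lf (f x) q) = H.lf (\<Sum>x\<leftarrow>xs. f x) q"
  by (induction xs) (simp_all only: list.map sum_list.Nil sum_list.Cons H.lf_simps)

lemma tension_eq: "tension_field A g B h \<phi> p = H.lf tau (\<phi> p)"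
proof -
  define Es where "Es = (SOME Es. local_orthonormal_frame A g p Es)"
  have Es: "local_orthonormal_frame A g p Es"
    unfolding Es_def by (rule someI_ex[OF G.frame_exists])
  let ?b = "\<lambda>x y. H.nab (xi x) (xi y) - xi (G.nab x y)"
  have b: "bilinear ?b"
    unfolding bilinear_def
    by (auto intro!: linearI simp: xi_simps H.nab_simps G.nab_simps scaleR_diff_right)
  have "(\<Sum>X\<leftarrow>Es. hessian_map A g B h \<phi> X X p) = (\<Sum>X\<leftarrow>Es. H.lf (?b (G.hat p (X p)) (G.hat p (X p))) (\<phi> p))"
    by (rule arg_cong[of _ _ sum_list], rule map_cong[OF refl], rule hessian_eq)
      (use Es in \<open>simp add: local_orthonormal_frame_def\<close>)
  also have "\<dots> = H.lf tau (\<phi> p)"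
    unfolding sum_list_lf G.frame_trace[OF Es b] tau_def ..
  finally show ?thesis unfolding tension_field_def Let_def Es_def .
qed

definition bit :: "'b tangent" where
  "bit = (\<Sum>e\<in>E. H.nab (xi e) (H.nab (xi e) tau) - H.nab (xi (G.nab e e)) tau + H.curv tau (xi e) (xi e))"

lemma pullback_tension:
  assumes X: "vector_field A X"
  shows "pullback_connection A B \<phi> (levi_civita B h) X (tension_field A g B h \<phi>) =
    (\<lambda>p. H.lf (H.nab (xi (G.hat p (X p))) tau) (\<phi> p))"
proof
  fix p
  have t: "tension_field A g B h \<phi> = (\<lambda>p. H.lf tau (\<phi> p))" by (rule ext) (rule tension_eq)
  have s: "section_along A B \<phi> (\<lambda>p. H.lf tau (\<phi> p))"
    by (rule H.section_lf[OF G.manifold_axioms smooth H.smooth_T_const[OF G.manifold_axioms tau_T]])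
  show "pullback_connection A B \<phi> (levi_civita B h) X (tension_field A g B h \<phi>) p =
    H.lf (H.nab (xi (G.hat p (X p))) tau) (\<phi> p)"
    unfolding t H.pullback_connection_eq[OF G.manifold_axioms smooth X s] H.conn_def
      hat_xi[OF G.vector_fieldD(1)[OF X]] H.hat_lf[OF tau_T]
      H.dv_const[OF G.manifold_axioms G.vector_fieldD(1)[OF X]] by simp
qed

lemma pullback_pullback_tension:
  assumes X: "vector_field A X"
  shows "pullback_connection A B \<phi> (levi_civita B h) X
      (pullback_connection A B \<phi> (levi_civita B h) X (tension_field A g B h \<phi>)) p =
    H.lf (H.nab (xi (G.dv (X p) (\<lambda>q. G.hat q (X q)))) tau
      + H.nab (xi (G.hat p (X p))) (H.nab (xi (G.hat p (X p))) tau)) (\<phi> p)"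
proof -
  note XT = G.vector_fieldD(1)[OF X]
  note c = H.smooth_T_const[OF G.manifold_axioms tau_T]
  note hs = hat_xi_smooth[OF X]
  have s: "section_along A B \<phi> (\<lambda>p. H.lf (H.nab (xi (G.hat p (X p))) tau) (\<phi> p))"
    by (rule H.section_lf[OF G.manifold_axioms smooth
          H.smooth_T_bilinear[OF G.manifold_axioms H.bilinear_nab H.nab_T hs c]])
  have "H.dv (X p) (\<lambda>q. H.nab (xi (G.hat q (X q))) tau) =
      H.nab (xi (G.dv (X p) (\<lambda>q. G.hat q (X q)))) tau"
    using H.dv_bilinear[OF G.manifold_axioms XT H.bilinear_nab H.nab_T hs c, of p]
    unfolding dv_xi[OF XT G.vector_field_hat[OF X]] H.dv_const[OF G.manifold_axioms XT]
    by (simp add: H.nab_simps)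
  then show ?thesis
    unfolding pullback_tension[OF X] H.pullback_connection_eq[OF G.manifold_axioms smooth X s] H.conn_def
      hat_xi[OF XT] H.hat_lf[OF H.nab_T] by simp
qed

text \<open>The flat derivative of the trivialised \<open>X\<close> in the iterated pull-back
  derivative is cancelled by the derivative along \<open>levi_civita A g X X\<close>. The remainder
  is the bilinear expression \<open>?b\<close> at the value of \<open>X\<close>, so
  \<open>frame_trace\<close> applies to the unknown frame.\<close>

lemma bitension_eq: "bitension_field A g B h \<phi> p = - H.lf bit (\<phi> p)"
proof -
  define Es where "Es = (SOME Es. local_orthonormal_frame A g p Es)"
  have Es: "local_orthonormal_frame A g p Es"
    unfolding Es_def by (rule someI_ex[OF G.frame_exists])
  let ?P = "pullback_connection A B \<phi> (levi_civita B h)" and ?t = "tension_field A g B h \<phi>"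
  let ?b = "\<lambda>x y. H.nab (xi x) (H.nab (xi y) tau) - H.nab (xi (G.nab x y)) tau + H.curv tau (xi x) (xi y)"
  have b: "bilinear ?b"
    unfolding bilinear_def H.curv_def
    by (auto intro!: linearI simp: xi_simps H.nab_simps G.nab_simps H.br_simps scaleR_diff_right scaleR_add_right)
  have "(\<Sum>X\<leftarrow>Es. (?P X (?P X ?t) p - ?P (levi_civita A g X X) ?t p)
              + curvature_at B h (\<phi> p) (?t p) (xi (X p)) (xi (X p)))
      = (\<Sum>X\<leftarrow>Es. H.lf (?b (G.hat p (X p)) (G.hat p (X p))) (\<phi> p))"
  proof (rule arg_cong[of _ _ sum_list], rule map_cong[OF refl])
    fix X assume "X \<in> set Es"
    then have X: "vector_field A X" using Es by (simp add: local_orthonormal_frame_def)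
    note XT = G.vector_fieldD(1)[OF X]
    let ?x = "G.hat p (X p)"
    have c: "curvature_at B h (\<phi> p) (?t p) (xi (X p)) (xi (X p)) = H.lf (H.curv tau (xi ?x) (xi ?x)) (\<phi> p)"
      unfolding tension_eq
      by (subst H.curvature_at_eq[OF H.lf_tangent[OF tau_T] xi_tangent[OF XT] xi_tangent[OF XT]])
        (simp only: H.hat_lf[OF tau_T] hat_xi[OF XT])
    show "(?P X (?P X ?t) p - ?P (levi_civita A g X X) ?t p)
        + curvature_at B h (\<phi> p) (?t p) (xi (X p)) (xi (X p)) = H.lf (?b ?x ?x) (\<phi> p)"
      unfolding pullback_pullback_tension[OF X] pullback_tension[OF G.levi_civita_field[OF X X]] c
        G.levi_civita_hat[OF X X] xi_simps H.nab_simps H.lf_simps by simp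
  qed
  also have "\<dots> = H.lf bit (\<phi> p)"
    unfolding sum_list_lf G.frame_trace[OF Es b] bit_def ..
  finally show ?thesis unfolding bitension_field_def Let_def Es_def by (rule arg_cong)
qed

lemma bit_T: "bit \<in> H.T"
  unfolding bit_def by (intro subspace_sum H.subspace_tangent_space H.T_closed H.nab_T H.curv_T)

text \<open>The bitension field is the translate of one fixed vector, so it vanishes everywhere once
  it vanishes at the identity.\<close>

lemma biharmonic_iff: "biharmonic A g B h \<phi> \<longleftrightarrow> bit = 0"
proof
  assume "biharmonic A g B h \<phi>"
  then have "bitension_field A g B h \<phi> \<one>\<^bsub>G\<^esub> = 0" unfolding biharmonic_def by (rule spec)
  then have "- bit = 0" unfolding bitension_eq phi_one H.lf_one[OF bit_T] .
  then show "bit = 0" by (rule neg_equal_0_iff_equal[THEN iffD1])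
next
  assume "bit = 0"
  then have "bitension_field A g B h \<phi> p = 0" for p unfolding bitension_eq by (simp only: H.lf_simps minus_zero)
  then show "biharmonic A g B h \<phi>" unfolding biharmonic_def by blast
qed

lemma tension_one: "tension_field A g B h \<phi> \<one>\<^bsub>G\<^esub> = tau"
  unfolding tension_eq phi_one by (rule H.lf_one[OF tau_T])

end

lemma form_diff_expansion:
  fixes s :: "'v::real_vector \<Rightarrow> 'v \<Rightarrow> real"
  assumes V: "subspace V"
    and add: "\<And>u v x. u \<in> V \<Longrightarrow> v \<in> V \<Longrightarrow> x \<in> V \<Longrightarrow> s (u + x) v = s u v + s x v"
    and scale: "\<And>u v r. u \<in> V \<Longrightarrow> v \<in> V \<Longrightarrow> s (r *\<^sub>R u) v = r * s u v"
    and E: "finite E" "E \<subseteq> V"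
    and orth: "\<And>e e'. e \<in> E \<Longrightarrow> e' \<in> E \<Longrightarrow> s e e' = (if e = e' then 1 else 0)"
    and u: "u \<in> V" and e: "e \<in> E"
  shows "s (u - (\<Sum>e\<in>E. s u e *\<^sub>R e)) e = 0"
proof -
  let ?p = "\<Sum>e\<in>E. s u e *\<^sub>R e"
  have p: "?p \<in> V" using E(2) V by (intro subspace_sum subspace_scale) auto
  have eV: "e \<in> V" using E(2) e by blast
  have "s ?p e = (\<Sum>e'\<in>E. s u e' * s e' e)" by (rule form_sum[OF V add scale E eV])
  also have "\<dots> = (\<Sum>e'\<in>E. if e' = e then s u e' else 0)" using e by (intro sum.cong) (auto simp: orth)
  finally have "s ?p e = s u e" using e E(1) by simp
  moreover have "s (u - ?p + ?p) e = s (u - ?p) e + s ?p e"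
    by (rule add[OF subspace_diff[OF V u p] eV p])
  ultimately show ?thesis by simp
qed

text \<open>An orthonormal basis of the Lie algebra of \<open>G\<close> adapted to the submersion: \<open>C\<close> spans the kernel
  of the differential and \<open>F\<close> is the image of the horizontal part \<open>D\<close>.\<close>

locale lie_submersion = lie_hom G A g "C \<union> D" H B h F \<phi>
  for G :: "('a::{t2_space, second_countable_topology}, 'm) monoid_scheme"
    and A :: "('a, 'e::euclidean_space) atlas" and g :: "'a metric" and C D
    and H :: "('b::{t2_space, second_countable_topology}, 'n) monoid_scheme"
    and B :: "('b, 'f::euclidean_space) atlas" and h :: "'b metric" and F and \<phi> +
  assumes disjoint: "C \<inter> D = {}" and C_span: "span C = K"
    and D_span: "span D = hor"
    and F: "F = differential B \<phi> ` D" and inj: "inj_on (differential B \<phi>) D"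
begin

lemma finite_CD: "finite C" "finite D"
  using G.E_finite by auto

lemma C_K: "e \<in> C \<Longrightarrow> e \<in> K" and D_hor: "e \<in> D \<Longrightarrow> e \<in> hor"
  using span_base[of e C] span_base[of e D] unfolding C_span D_span by blast+

lemma xi_K [simp]: "e \<in> K \<Longrightarrow> xi e = 0" and K_T: "e \<in> K \<Longrightarrow> e \<in> G.T"
  by (auto simp: K_def)

lemma subspace_hor: "subspace hor"
  using subspace_span[of D] unfolding D_span .

lemma sum_CD: "(\<Sum>e\<in>C \<union> D. f e) = (\<Sum>e\<in>C. f e) + (\<Sum>e\<in>D. f e)"
  by (rule sum.union_disjoint[OF finite_CD disjoint])

lemma sum_F: "(\<Sum>e\<in>F. f e) = (\<Sum>e\<in>D. f (xi e))"
  unfolding F by (rule sum.reindex[OF inj, unfolded o_def])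

text \<open>One horizontal argument is enough: the vertical part of \<open>x\<close> is killed by
  \<open>xi\<close> on the left and is orthogonal to \<open>y\<close> on the right.\<close>

lemma xi_isometry:
  assumes x: "x \<in> G.T" and y: "y \<in> hor"
  shows "H.ip (xi x) (xi y) = G.ip x y"
proof -
  have base: "H.ip (xi e) (xi e') = G.ip e e'" if "e \<in> C \<union> D" "e' \<in> D" for e e'
  proof (cases "e \<in> D")
    case True
    then show ?thesis
      using H.orth[of "xi e" "xi e'"] G.orth[of e e'] that inj_on_eq_iff[OF inj True that(2)] F by simp
  next
    case False
    then have e: "e \<in> C" using that(1) by blast
    then have "e \<noteq> e'" using disjoint that(2) by blast
    then show ?thesis using C_K[OF e] G.orth[of e e'] that by (simp add: H.ip_simps)
  qed
  have lH: "linear (\<lambda>x. H.ip (xi x) z)" "linear (\<lambda>x. H.ip z (xi x))" for z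
    by (rule linearI; simp add: xi_simps H.ip_simps)+
  have lG: "linear (\<lambda>x. G.ip x z)" "linear (G.ip z)" for z
    using G.bil_ip by (auto simp: bilinear_def)
  have 1: "H.ip (xi x) (xi e') = G.ip x e'" if "e' \<in> D" for e'
    by (rule linear_eq_on_span[OF lH(1) lG(1), of "C \<union> D"]) (use x base that G.E_span in auto)
  show ?thesis
    by (rule linear_eq_on_span[OF lH(2) lG(2), of D]) (use y 1 D_span in auto)
qed

lemma xi_hor: "xi ` hor = H.T"
  unfolding D_span[symmetric] linear_span_image[OF linear_differential, symmetric] F[symmetric] by (rule H.E_span)

lemma inj_hor: "inj_on xi hor"
proof (rule inj_onI)
  fix x y assume x: "x \<in> hor" and y: "y \<in> hor" and eq: "xi x = xi y"
  have d: "x - y \<in> hor" by (rule subspace_diff[OF subspace_hor x y])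
  then have dT: "x - y \<in> G.T" by blast
  have "xi (x - y) = 0" unfolding xi_simps eq by (rule diff_self)
  then have "x - y \<in> K" using dT unfolding K_def by blast
  then have "g \<one>\<^bsub>G\<^esub> (x - y) (x - y) = 0" using d by blast
  then have "x - y = 0" using G.metric_simps(4)[OF G.metric dT dT] by force
  then show "x = y" by (rule eq_iff_diff_eq_0[THEN iffD2])
qed

definition lift :: "'b tangent \<Rightarrow> 'a tangent" where
  "lift = the_inv_into hor xi"

lemma lift_hor: "w \<in> H.T \<Longrightarrow> lift w \<in> hor" and xi_lift: "w \<in> H.T \<Longrightarrow> xi (lift w) = w"
  unfolding lift_def using the_inv_into_into[OF inj_hor] f_the_inv_into_f[OF inj_hor] unfolding xi_hor by blast+

lemma lift_T: "w \<in> H.T \<Longrightarrow> lift w \<in> G.T"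
  using lift_hor by blast

text \<open>In the first half of \<open>tau\<close> the vectors of \<open>C\<close> contribute
  nothing, and \<open>xi\<close> turns \<open>D\<close> into the orthonormal basis
  \<open>F\<close>.\<close>

lemma tau_ctr: "tau = H.ctr - xi G.ctr"
proof -
  have "(\<Sum>e\<in>C. H.nab (xi e) (xi e)) = 0"
    by (rule sum.neutral) (simp add: C_K H.nab_simps)
  then show ?thesis
    unfolding tau_def sum_subtractf G.ctr_def xi_simps H.ctr_def sum_F sum_CD[of "\<lambda>e. H.nab (xi e) (xi e)"]
    by simp
qed

text \<open>Vertical vectors drop out as in \<open>tau_ctr\<close>, which also identifies the image
  of the trace vector of the source with \<open>H.ctr - tau\<close>.\<close>

lemma bit_bitension: "bit = H.bitension tau"
proof -
  let ?c = "\<lambda>x. H.nab x (H.nab x tau) + H.curv tau x x"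
  have "(\<Sum>e\<in>C. ?c (xi e)) = 0"
    by (rule sum.neutral) (simp add: C_K H.nab_simps H.curv_def)
  then have 1: "(\<Sum>e\<in>C \<union> D. ?c (xi e)) = (\<Sum>f\<in>F. ?c f)"
    unfolding sum_CD sum_F by simp
  have "linear (\<lambda>x. H.nab (xi x) tau)"
    by (rule linearI) (simp_all only: xi_simps H.nab_simps)
  then have 2: "H.nab (xi G.ctr) tau = (\<Sum>e\<in>C \<union> D. H.nab (xi (G.nab e e)) tau)"
    unfolding G.ctr_def by (rule linear_sum)
  have 3: "H.ctr - tau = xi G.ctr" by (simp add: tau_ctr)
  have "bit = (\<Sum>e\<in>C \<union> D. ?c (xi e) - H.nab (xi (G.nab e e)) tau)"
    unfolding bit_def by (rule sum.cong) simp_all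
  then show ?thesis unfolding sum_subtractf 1 H.bitension_def 2 3 .
qed

section \<open>Traces on the kernel\<close>

definition trK :: "'a tangent \<Rightarrow> real" where
  "trK x = (\<Sum>e\<in>C. G.ip (G.br x e) e)"

lemma trK_diff: "trK (x - y) = trK x - trK y"
  by (simp add: trK_def G.br_simps G.ip_simps sum_subtractf)

lemma br_K: "x \<in> G.T \<Longrightarrow> k \<in> K \<Longrightarrow> G.br x k \<in> K"
proof -
  assume x: "x \<in> G.T" and k: "k \<in> K"
  have "xi (G.br x k) = 0"
    unfolding xi_br[OF x K_T[OF k]] xi_K[OF k] by (rule H.br_simps(10))
  then show "G.br x k \<in> K" unfolding K_def using G.br_T by blast
qed

text \<open>The kernel is an ideal, so both adjoint maps restrict to it and can be expanded in
  \<open>C\<close>. The traces of the two composites are then the same double sum with the indices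
  exchanged.\<close>

lemma trK_br:
  assumes x: "x \<in> G.T" and y: "y \<in> G.T"
  shows "trK (G.br x y) = 0"
proof -
  have t: "(\<Sum>e\<in>C. G.ip (G.br u (G.br v e)) e) = (\<Sum>e\<in>C. \<Sum>e'\<in>C. G.ip (G.br v e) e' * G.ip (G.br u e') e)"
    if v: "v \<in> G.T" for u v
  proof (rule sum.cong[OF refl])
    fix e assume e: "e \<in> C"
    have lin: "linear (\<lambda>z. G.ip (G.br u z) e)"
      by (rule linearI) (simp_all add: G.br_simps G.ip_simps)
    have "G.br v e \<in> span C" unfolding C_span by (rule br_K[OF v C_K[OF e]])
    then have "G.br v e = (\<Sum>e'\<in>C. G.ip (G.br v e) e' *\<^sub>R e')"
      by (rule orthonormal_expansion[OF G.bil_ip finite_CD(1) G.orth, rotated 2]) auto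
    from arg_cong[OF this, of "\<lambda>z. G.ip (G.br u z) e"]
    show "G.ip (G.br u (G.br v e)) e = (\<Sum>e'\<in>C. G.ip (G.br v e) e' * G.ip (G.br u e') e)"
      by (simp add: linear_sum[OF lin] linear_scale[OF lin])
  qed
  have j: "G.br (G.br x y) e = G.br x (G.br y e) - G.br y (G.br x e)" for e
    using G.jacobi[of x y e] by simp
  have "trK (G.br x y) = (\<Sum>e\<in>C. G.ip (G.br x (G.br y e)) e) - (\<Sum>e\<in>C. G.ip (G.br y (G.br x e)) e)"
    unfolding trK_def j by (simp add: G.ip_simps sum_subtractf)
  also have "\<dots> = 0"
    unfolding t[OF x] t[OF y] by (subst sum.swap) (simp add: mult.commute)
  finally show ?thesis .
qed

text \<open>The trace of the adjoint of \<open>lift w\<close> splits into a kernel part and a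
  horizontal part. By \<open>xi_isometry\<close> the latter is the trace of the adjoint of
  \<open>w\<close>, and \<open>tau_ctr\<close> subtracts the two totals.\<close>

lemma ip_tau:
  assumes w: "w \<in> H.T"
  shows "H.ip tau w = - trK (lift w)"
proof -
  note l = lift_T[OF w] and lh = lift_hor[OF w]
  have ctr: "G.ctr \<in> G.T" using G.ctr_span G.E_span by simp
  have "H.ip (H.br w (xi e)) (xi e) = G.ip (G.br (lift w) e) e" if e: "e \<in> D" for e
  proof -
    have eT: "e \<in> G.T" using D_hor[OF e] by blast
    have "H.br w (xi e) = xi (G.br (lift w) e)" using xi_br[OF l eT] xi_lift[OF w] by simp
    then show ?thesis using xi_isometry[OF G.br_T D_hor[OF e]] by simp
  qed
  then have 1: "H.ip H.ctr w = (\<Sum>e\<in>D. G.ip (G.br (lift w) e) e)"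
    unfolding H.ip_ctr sum_F by (rule sum.cong[OF refl])
  have "H.ip (xi G.ctr) w = G.ip G.ctr (lift w)"
    using xi_isometry[OF ctr lh] xi_lift[OF w] by simp
  then have 2: "H.ip (xi G.ctr) w = trK (lift w) + (\<Sum>e\<in>D. G.ip (G.br (lift w) e) e)"
    unfolding G.ip_ctr sum_CD trK_def .
  show ?thesis unfolding tau_ctr H.ip_simps 1 2 by simp
qed

lemma unimodular_trK:
  assumes "unimodular K (lie_alg_bracket G A)" and k: "k \<in> K"
  shows "trK k = 0"
proof -
  have "trace_on (span C) (lie_alg_bracket G A k) = (\<Sum>e\<in>C. G.ip (G.br k e) e)"
  proof (rule G.trace_br[OF finite_CD(1) _ _ _ K_T[OF k]])
    show "C \<subseteq> G.T" using C_K K_T by blast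
    show "g \<one>\<^bsub>G\<^esub> e e' = (if e = e' then 1 else 0)" if "e \<in> C" "e' \<in> C" for e e'
      using G.E_orth that by blast
    show "G.br k v \<in> span C" if "v \<in> span C" for v
      using br_K[OF K_T[OF k]] that unfolding C_span .
  qed
  moreover have "trace_on (span C) (lie_alg_bracket G A k) = 0"
    using assms unfolding unimodular_def C_span by blast
  ultimately show ?thesis by (simp add: trK_def)
qed

lemma tau_perp_bracket:
  assumes "unimodular K (lie_alg_bracket G A) \<or>
    (\<forall>u\<in>H.T. \<forall>v\<in>H.T. lie_alg_bracket G A (lift u) (lift v) - lift (lie_alg_bracket H B u v) = 0)"
  shows "H.ip (H.br u v) tau = 0"
proof -
  let ?u = "H.proj u" and ?v = "H.proj v"
  \<comment> \<open>This is the value of \<open>\<omega>\<close> on the projected arguments. It is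
    vertical, as \<open>xi\<close> maps both terms to the same bracket. Since \<open>trK\<close>
    vanishes on brackets, the pairing of \<open>tau\<close> with the bracket is
    \<open>trK k\<close>, and either alternative of the assumption makes it 0.\<close>
  define k where "k = G.br (lift ?u) (lift ?v) - lift (H.br ?u ?v)"
  note l = lift_T[OF H.proj_T[of u]] lift_T[OF H.proj_T[of v]] lift_T[OF H.br_T[of ?u ?v]]
  have "trK (lift (H.br ?u ?v)) = trK (G.br (lift ?u) (lift ?v) - k)" by (simp add: k_def)
  also have "\<dots> = - trK k" unfolding trK_diff trK_br[OF l(1,2)] by simp
  also have "trK k = 0"
    using assms
  proof
    assume U: "unimodular K (lie_alg_bracket G A)"
    have "k \<in> G.T" unfolding k_def by (intro G.T_closed G.br_T l)
    moreover have "xi k = 0"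
      unfolding k_def xi_simps xi_br[OF l(1,2)] xi_lift[OF H.proj_T] xi_lift[OF H.br_T] by (rule diff_self)
    ultimately have "k \<in> K" unfolding K_def by blast
    then show ?thesis by (rule unimodular_trK[OF U])
  next
    assume "\<forall>u\<in>H.T. \<forall>v\<in>H.T. lie_alg_bracket G A (lift u) (lift v) - lift (lie_alg_bracket H B u v) = 0"
    then have "k = 0"
      unfolding k_def G.br_eq[OF l(1,2)] H.br_eq[OF H.proj_T H.proj_T] using H.proj_T by blast
    then show ?thesis by (simp add: trK_def G.br_simps G.ip_simps)
  qed
  finally have "H.ip tau (H.br ?u ?v) = 0" unfolding ip_tau[OF H.br_T] by simp
  then show ?thesis by (simp only: H.br_proj H.ip_sym)
qed

theorem biharmonic_iff_killing:
  assumes "unimodular H.T (lie_alg_bracket H B)"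
  shows "biharmonic A g B h \<phi> \<longleftrightarrow> killing_field B h (H.lf tau)"
  unfolding biharmonic_iff bit_bitension H.killing_lf_iff[OF tau_T]
  by (rule H.bitension_zero_iff_skew[OF H.unimodular_ctr[OF assms]])

theorem biharmonic_iff_parallel:
  assumes "unimodular K (lie_alg_bracket G A) \<or>
    (\<forall>u\<in>H.T. \<forall>v\<in>H.T. lie_alg_bracket G A (lift u) (lift v) - lift (lie_alg_bracket H B u v) = 0)"
  shows "biharmonic A g B h \<phi> \<longleftrightarrow> parallel_field B h (H.lf tau)"
  unfolding biharmonic_iff bit_bitension H.parallel_lf_iff[OF tau_T] H.E_span[symmetric]
  by (rule H.bitension_zero_iff_parallel[OF tau_perp_bracket[OF assms]])

end

section \<open>Existence of an adapted basis and conclusion\<close>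

lemma riem_lie_groupI: "riemannian_lie_group G A g \<Longrightarrow> riem_lie_group G A g"
  unfolding riem_lie_group_def riem_lie_group_axioms_def manifold_def
  by (auto simp: riemannian_lie_group_def connected_lie_group_def)

text \<open>\<open>C\<close> and \<open>D\<close> are orthonormal bases of the kernel and of its
  orthogonal complement. The isometry condition makes the image of \<open>D\<close> orthonormal, and
  surjectivity of the differential makes it spanning.\<close>

lemma lie_submersion_exists:
  fixes G :: "('a::{t2_space, second_countable_topology}, 'm) monoid_scheme"
    and A :: "('a, 'e::euclidean_space) atlas" and g :: "'a metric"
    and H :: "('b::{t2_space, second_countable_topology}, 'n) monoid_scheme"
    and B :: "('b, 'f::euclidean_space) atlas" and h :: "'b metric"
  assumes G: "riemannian_lie_group G A g" and H: "riemannian_lie_group H B h"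
    and hom: "\<phi> \<in> hom G H" and sub: "riemannian_submersion A g B h \<phi>"
  shows "\<exists>C D F. lie_submersion G A g C D H B h F \<phi>"
proof -
  interpret G: riem_lie_group G A g by (rule riem_lie_groupI[OF G])
  interpret H: riem_lie_group H B h by (rule riem_lie_groupI[OF H])
  let ?xi = "differential B \<phi>"
  define K where K_def': "K = {u \<in> lie_algebra G A. ?xi u = 0}"
  define L where "L = {u \<in> lie_algebra G A. \<forall>k\<in>K. g \<one>\<^bsub>G\<^esub> u k = 0}"
  have m1: "g \<one>\<^bsub>G\<^esub> u v = g \<one>\<^bsub>G\<^esub> v u" if "u \<in> G.T" "v \<in> G.T" for u v
    by (rule G.metric_simps(1)[OF G.metric that])
  have m2: "g \<one>\<^bsub>G\<^esub> (c *\<^sub>R u) v = c * g \<one>\<^bsub>G\<^esub> u v" if "u \<in> G.T" "v \<in> G.T" for u v c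
    by (rule G.metric_simps(2)[OF G.metric that])
  have m3: "g \<one>\<^bsub>G\<^esub> (u + w) v = g \<one>\<^bsub>G\<^esub> u v + g \<one>\<^bsub>G\<^esub> w v" if "u \<in> G.T" "v \<in> G.T" "w \<in> G.T" for u v w
    by (rule G.metric_simps(3)[OF G.metric that])
  note T0 = subspace_0[OF G.subspace_tangent_space[of "\<one>\<^bsub>G\<^esub>"]]
    and Tadd = subspace_add[OF G.subspace_tangent_space[of "\<one>\<^bsub>G\<^esub>"]]
    and Tscale = subspace_scale[OF G.subspace_tangent_space[of "\<one>\<^bsub>G\<^esub>"]]
  have one: "\<phi> \<one>\<^bsub>G\<^esub> = \<one>\<^bsub>H\<^esub>" using hom_one[OF hom G.G_group H.G_group] .
  have smooth: "smooth_map A B \<phi>" using sub by (simp add: riemannian_submersion_def)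
  have L_alt: "L = {u \<in> G.T. \<forall>k\<in>G.T. ?xi k = 0 \<longrightarrow> g \<one>\<^bsub>G\<^esub> u k = 0}"
    unfolding L_def K_def' by blast
  have sub1: "?xi ` G.T = H.T \<and>
      (\<forall>u\<in>L. \<forall>v\<in>L. h \<one>\<^bsub>H\<^esub> (?xi u) (?xi v) = g \<one>\<^bsub>G\<^esub> u v)"
    using sub[unfolded riemannian_submersion_def Let_def, THEN conjunct2, THEN spec, of "\<one>\<^bsub>G\<^esub>"]
    unfolding one L_alt .
  have surj: "?xi ` G.T = H.T" by (rule sub1[THEN conjunct1])
  have iso: "h \<one>\<^bsub>H\<^esub> (?xi u) (?xi v) = g \<one>\<^bsub>G\<^esub> u v" if "u \<in> L" "v \<in> L" for u v
    using sub1 that by blast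
  have KT: "K \<subseteq> G.T" and LT: "L \<subseteq> G.T" by (auto simp: K_def' L_def)
  have xi_lin: "?xi (u + v) = ?xi u + ?xi v" "?xi (c *\<^sub>R u) = c *\<^sub>R ?xi u" "?xi 0 = 0" for u v c
    using linear_add linear_scale linear_0 linear_differential by blast+
  have K: "subspace K"
  proof (rule subspaceI)
    show "0 \<in> K" unfolding K_def' using T0 xi_lin(3) by blast
    show "x + y \<in> K" if "x \<in> K" "y \<in> K" for x y
      using that Tadd xi_lin(1)[of x y] by (simp add: K_def')
    show "c *\<^sub>R x \<in> K" if "x \<in> K" for c x
      using that Tscale xi_lin(2)[of c x] by (simp add: K_def')
  qed
  have ortho: "subspace {u \<in> G.T. g \<one>\<^bsub>G\<^esub> u k = 0}" if k: "k \<in> G.T" for k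
  proof (rule subspaceI)
    have "g \<one>\<^bsub>G\<^esub> (0 *\<^sub>R 0) k = 0" using m2[OF T0 k, of 0] by simp
    then show "0 \<in> {u \<in> G.T. g \<one>\<^bsub>G\<^esub> u k = 0}" using T0 by simp
    show "x + y \<in> {u \<in> G.T. g \<one>\<^bsub>G\<^esub> u k = 0}"
      if "x \<in> {u \<in> G.T. g \<one>\<^bsub>G\<^esub> u k = 0}" "y \<in> {u \<in> G.T. g \<one>\<^bsub>G\<^esub> u k = 0}" for x y
      using that m3[of x k y] k Tadd by simp
    show "c *\<^sub>R x \<in> {u \<in> G.T. g \<one>\<^bsub>G\<^esub> u k = 0}" if "x \<in> {u \<in> G.T. g \<one>\<^bsub>G\<^esub> u k = 0}" for c x
      using that m2[of x k c] k Tscale by simp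
  qed
  have L_eq: "L = G.T \<inter> (\<Inter>k\<in>K. {u \<in> G.T. g \<one>\<^bsub>G\<^esub> u k = 0})"
    unfolding L_def by blast
  have L: "subspace L"
    unfolding L_eq
    by (intro subspace_inter G.subspace_tangent_space subspace_Inter) (use ortho KT in auto)
  obtain C where C: "finite C" "C \<subseteq> K" "span C = K"
    "\<And>e e'. e \<in> C \<Longrightarrow> e' \<in> C \<Longrightarrow> g \<one>\<^bsub>G\<^esub> e e' = (if e = e' then 1 else 0)"
    using G.orthonormal_subspace_basis[OF G.metric K KT] by blast
  obtain D where D: "finite D" "D \<subseteq> L" "span D = L"
    "\<And>e e'. e \<in> D \<Longrightarrow> e' \<in> D \<Longrightarrow> g \<one>\<^bsub>G\<^esub> e e' = (if e = e' then 1 else 0)"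
    using G.orthonormal_subspace_basis[OF G.metric L LT] by blast
  have CT: "C \<subseteq> G.T" and DT: "D \<subseteq> G.T" using C D KT LT by auto
  have cross: "g \<one>\<^bsub>G\<^esub> d c = 0" "g \<one>\<^bsub>G\<^esub> c d = 0" if "c \<in> C" "d \<in> D" for c d
  proof -
    show "g \<one>\<^bsub>G\<^esub> d c = 0" using that C(2) D(2) unfolding L_def by blast
    then show "g \<one>\<^bsub>G\<^esub> c d = 0" using m1[of c d] that CT DT by auto
  qed
  have disj: "C \<inter> D = {}" using cross C(4) by fastforce
  \<comment> \<open>Subtracting the orthogonal projection onto the kernel. Orthogonality to the
    vectors of \<open>C\<close> spreads to their span because the vectors orthogonal to
    \<open>u - ?p\<close> form a subspace.\<close>
  have Tsplit: "u - (\<Sum>e\<in>C. g \<one>\<^bsub>G\<^esub> u e *\<^sub>R e) \<in> L" if u: "u \<in> G.T" for u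
  proof -
    let ?p = "\<Sum>e\<in>C. g \<one>\<^bsub>G\<^esub> u e *\<^sub>R e"
    have "?p \<in> K" unfolding C(3)[symmetric] by (intro span_sum span_scale span_base)
    then have dT: "u - ?p \<in> G.T" using KT u subspace_diff[OF G.subspace_tangent_space] by blast
    have z: "g \<one>\<^bsub>G\<^esub> (u - ?p) e = 0" if "e \<in> C" for e
      by (rule form_diff_expansion[where s = "g \<one>\<^bsub>G\<^esub>", OF G.subspace_tangent_space m3 m2 C(1) CT C(4) u that])
    have "g \<one>\<^bsub>G\<^esub> (u - ?p) k = 0" if k: "k \<in> K" for k
    proof -
      have kT: "k \<in> G.T" using k KT by blast
      note ortho[OF dT]
      moreover have "C \<subseteq> {y \<in> G.T. g \<one>\<^bsub>G\<^esub> y (u - ?p) = 0}"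
      proof
        fix e assume e: "e \<in> C"
        then have eT: "e \<in> G.T" using CT by blast
        show "e \<in> {y \<in> G.T. g \<one>\<^bsub>G\<^esub> y (u - ?p) = 0}"
          using eT z[OF e] m1[OF eT dT] by simp
      qed
      ultimately have "span C \<subseteq> {y \<in> G.T. g \<one>\<^bsub>G\<^esub> y (u - ?p) = 0}" by (simp add: span_minimal)
      then have "g \<one>\<^bsub>G\<^esub> k (u - ?p) = 0" using k C(3) by blast
      then show ?thesis using m1[OF kT dT] by simp
    qed
    then show ?thesis using dT unfolding L_def by blast
  qed
  have span: "span (C \<union> D) = G.T"
  proof
    show "span (C \<union> D) \<subseteq> G.T" using CT DT by (simp add: span_minimal G.subspace_tangent_space)
    show "G.T \<subseteq> span (C \<union> D)"
    proof
      fix u assume "u \<in> G.T"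
      let ?p = "\<Sum>e\<in>C. g \<one>\<^bsub>G\<^esub> u e *\<^sub>R e"
      have "u - ?p \<in> span (C \<union> D)" using Tsplit[OF \<open>u \<in> G.T\<close>] D(3) span_mono[of D "C \<union> D"] by blast
      moreover have "?p \<in> span (C \<union> D)" by (intro span_sum span_scale span_base) blast
      ultimately have "u - ?p + ?p \<in> span (C \<union> D)" by (rule span_add)
      then show "u \<in> span (C \<union> D)" by simp
    qed
  qed
  have isoD: "h \<one>\<^bsub>H\<^esub> (?xi d) (?xi d') = (if d = d' then 1 else 0)" if "d \<in> D" "d' \<in> D" for d d'
    using iso[of d d'] D(4)[OF that] subsetD[OF D(2)] that by simp
  have inj: "inj_on ?xi D"
  proof (rule inj_onI)
    fix x y assume xy: "x \<in> D" "y \<in> D" "?xi x = ?xi y"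
    show "x = y" using isoD[OF xy(1,2)] isoD[OF xy(1,1)] unfolding xy(3) by (simp split: if_splits)
  qed
  \<comment> \<open>The differential is onto, \<open>C \<union> D\<close> spans its domain, and
    \<open>C\<close> is mapped to 0.\<close>
  have spanF: "span (?xi ` D) = H.T"
  proof -
    have C0: "?xi c = 0" if "c \<in> C" for c using that C(2) unfolding K_def' by blast
    have "H.T = span (?xi ` (C \<union> D))"
      unfolding surj[symmetric] span[symmetric] by (rule linear_span_image[OF linear_differential, symmetric])
    also have "\<dots> = span (?xi ` D)"
    proof (rule antisym)
      show "span (?xi ` (C \<union> D)) \<subseteq> span (?xi ` D)"
        by (rule span_minimal[OF _ subspace_span]) (auto simp: C0 span_zero span_base)
      show "span (?xi ` D) \<subseteq> span (?xi ` (C \<union> D))" by (rule span_mono) blast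
    qed
    finally show ?thesis by (rule sym)
  qed
  have "riem_lie_group_onb G A g (C \<union> D)"
  proof (unfold_locales)
    show "finite (C \<union> D)" using C D by blast
    show "span (C \<union> D) = G.T" by (rule span)
    show "g \<one>\<^bsub>G\<^esub> e e' = (if e = e' then 1 else 0)" if "e \<in> C \<union> D" "e' \<in> C \<union> D" for e e'
      using that C(4) D(4) cross disj by (metis IntI Un_iff empty_iff)
  qed
  moreover have "riem_lie_group_onb H B h (?xi ` D)"
  proof (unfold_locales)
    show "finite (?xi ` D)" using D by blast
    show "span (?xi ` D) = H.T" by (rule spanF)
    show "h \<one>\<^bsub>H\<^esub> f f' = (if f = f' then 1 else 0)" if "f \<in> ?xi ` D" "f' \<in> ?xi ` D" for f f'
      using that isoD inj_on_eq_iff[OF inj] by auto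
  qed
  ultimately have hom: "lie_hom G A g (C \<union> D) H B h (?xi ` D) \<phi>"
    using hom smooth by (simp add: lie_hom_def lie_hom_axioms_def)
  interpret lie_hom G A g "C \<union> D" H B h "?xi ` D" \<phi> by (rule hom)
  have "lie_submersion G A g C D H B h (?xi ` D) \<phi>"
    by unfold_locales (use disj C(3) D(3) inj in \<open>simp_all add: K_def L_def K_def'\<close>)
  then show ?thesis by blast
qed

theorem theorem5p3:
  fixes G :: "('a::{t2_space, second_countable_topology}, 'm) monoid_scheme"
    and A :: "('a, 'e::euclidean_space) atlas" and g :: "'a metric"
    and H :: "('b::{t2_space, second_countable_topology}, 'n) monoid_scheme"
    and B :: "('b, 'f::euclidean_space) atlas" and h :: "'b metric"
    and \<phi> :: "'a \<Rightarrow> 'b"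
    and \<xi> :: "'a tangent \<Rightarrow> 'b tangent" and K :: "'a tangent set"
    and r :: "'b tangent \<Rightarrow> 'a tangent"
    and \<omega> :: "'b tangent \<Rightarrow> 'b tangent \<Rightarrow> 'a tangent"
    and \<tau> :: "'b tangent"
  assumes G: "riemannian_lie_group G A g"
    and H: "riemannian_lie_group H B h"
    and hom: "\<phi> \<in> hom G H"
    and submersion: "riemannian_submersion A g B h \<phi>"
    and \<xi>: "\<xi> = differential B \<phi>"
    and \<tau>: "\<tau> = tension_field A g B h \<phi> \<one>\<^bsub>G\<^esub>"
    and K: "K = {u \<in> lie_algebra G A. \<xi> u = 0}"
    and r: "r = the_inv_into {u \<in> lie_algebra G A. \<forall>k\<in>K. g \<one>\<^bsub>G\<^esub> u k = 0} \<xi>"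
    and \<omega>: "\<omega> = (\<lambda>h1 h2. lie_alg_bracket G A (r h1) (r h2) - r (lie_alg_bracket H B h1 h2))"
  shows "(unimodular (lie_algebra H B) (lie_alg_bracket H B) \<longrightarrow>
            (biharmonic A g B h \<phi> \<longleftrightarrow> killing_field B h (left_invariant_field H B \<tau>))) \<and>
         (unimodular K (lie_alg_bracket G A) \<or>
          (\<forall>h1\<in>lie_algebra H B. \<forall>h2\<in>lie_algebra H B. \<omega> h1 h2 = 0) \<longrightarrow>
            (biharmonic A g B h \<phi> \<longleftrightarrow> parallel_field B h (left_invariant_field H B \<tau>)))"
proof -
  obtain C D F where S: "lie_submersion G A g C D H B h F \<phi>"
    using lie_submersion_exists[OF G H hom submersion] by blast
  interpret S: lie_submersion G A g C D H B h F \<phi> by (rule S)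
  have K': "K = S.K" unfolding K \<xi> S.K_def ..
  have r': "r = S.lift" unfolding r S.lift_def K' \<xi> ..
  have \<tau>': "\<tau> = S.tau" unfolding \<tau> by (rule S.tension_one)
  show ?thesis
    unfolding \<omega> r' \<tau>' K' using S.biharmonic_iff_killing S.biharmonic_iff_parallel by blast
qed

end
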